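(* Let $E$ be a locally compact, second-countable, Hausdorff space with topology metrized by a metric, and let $X$ be a Feller Markov process on $E$ such that, if $X'$ and $X''$ are two independent copies of $X$, then for all $t_0>0$ and $x'\in E$, $$\lim_{x''\to x'}\mathbb P^{x',x''}\{X'_t=X''_t\text{ for some }t\in[0,t_0]\}=1 .$$ Let $N\in\mathbb N\cup\{\infty\}$ and let $\mathbf x',\mathbf x''\in E^N$ be such that the sets $\{x_i':i\in[N]\}$ and $\{x_i'':i\in[N]\}$ have the same closure. Then the set-valued coalescing process $\Xi=(\Xi_t)_{t\ge0}$ has the same distribution under $\mathbb P^{\mathbf x'}$ and $\mathbb P^{\mathbf x''}$.
   Context: $[N]=\{1,\ldots,N\}$ if $N$ is finite and $[N]=\mathbb N=\{1,2,\dots\}$ if $N=\infty$; $E^\infty$ means $E^{\mathbb N}$. Coalescing system. Under $\mathbb P^{\mathbf x}$, $\mathbf x=(x_1,x_2,\ldots)\in E^N$, let $\xi_1,\xi_2,\ldots$ (indexed by $[N]$) be independent copies of $X$ with càdlàg paths and $\xi_i(0)=x_i$. Define $\zeta_1=\xi_1$, and for $i>1$ let $\tau_i=\inf\{t\ge 0:\xi_i(t)\in\{\zeta_1(t),\ldots,\zeta_{i-1}(t)\}\}$ (with $\inf\emptyset=\infty$), let $J_i=\min\{j\in\{1,\dots,i-1\}:\xi_i(\tau_i)=\zeta_j(\tau_i)\}$ if $\tau_i<\infty$, and set $\zeta_i(t)=\xi_i(t)$ for $t<\tau_i$ and $\zeta_i(t)=\zeta_{J_i}(t)$ for $t\ge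 \tau_i$. Let $\Xi_t$ be the closure in $E$ of $\{\zeta_i(t):i\in[N]\}$. State space of $\Xi$: if $E$ is compact, the set of nonempty compact subsets of $E$ with the Hausdorff metric; if $E$ is not compact, the set of nonempty closed subsets of $E$, each identified with its closure in the one-point compactification $\bar E$, with the metric induced by the Hausdorff metric on compact subsets of $\bar E$ (for some metric inducing the topology of $\bar E$). *)

theory Defs
  imports "HOL-Probability.Probability" "HOL-Library.Extended_Nat"
begin

section \<open>Feller Markov processes\<close>

text \<open>Time is the half-line \<open>{0..}\<close> inside \<^typ>\<open>real\<close>; values at negative times never matter.\<close>

definition cadlag :: "(real \<Rightarrow> 'a::topological_space) \<Rightarrow> bool" where
  "cadlag f \<longleftrightarrow>
     (\<forall>t\<ge>0. (f \<longlongrightarrow> f t) (at_right t)) \<and> (\<forall>t>0. \<exists>l. (f \<longlongrightarrow> l) (at_left t))"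

definition C0 :: "('a::topological_space \<Rightarrow> real) set" where
  "C0 = {f. continuous_on UNIV f \<and> (\<forall>e>0. \<exists>K. compact K \<and> (\<forall>x. x \<notin> K \<longrightarrow> \<bar>f x\<bar> < e))}"

definition feller_semigroup ::
    "(real \<Rightarrow> 'a::{metric_space, second_countable_topology} \<Rightarrow> 'a measure) \<Rightarrow> bool" where
  "feller_semigroup p \<longleftrightarrow>
     (\<forall>t\<ge>0. p t \<in> borel \<rightarrow>\<^sub>M prob_algebra borel) \<and>
     (\<forall>x. p 0 x = return borel x) \<and>
     (\<forall>s\<ge>0. \<forall>t\<ge>0. \<forall>x. p (s + t) x = p s x \<bind> p t) \<and>
     (\<forall>f\<in>C0. \<forall>t\<ge>0. (\<lambda>x. \<integral>y. f y \<partial>p t x) \<in> C0) \<and>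
     (\<forall>f\<in>C0. uniform_limit UNIV (\<lambda>t x. \<integral>y. f y \<partial>p t x) f (at_right 0))"

definition past :: "'w measure \<Rightarrow> (real \<Rightarrow> 'w \<Rightarrow> 'a::topological_space) \<Rightarrow> real \<Rightarrow> 'w measure" where
  "past M X s = sigma (space M) {X u -` B \<inter> space M | u B. 0 \<le> u \<and> u \<le> s \<and> B \<in> sets borel}"

text \<open>
  The Markov process \<open>X\<close> is given by a family of probability measures, \<open>P x\<close> being the
  measure under which \<open>X\<close> starts from \<open>x\<close>. The sample spaces for different \<open>x\<close> are not
  required to agree.
\<close>

definition feller_markov_process ::
    "('a::{metric_space, second_countable_topology} \<Rightarrow> 'w measure) \<Rightarrow> (real \<Rightarrow> 'w \<Rightarrow> 'a) \<Rightarrow> bool" where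
  "feller_markov_process P X \<longleftrightarrow>
     (\<forall>x. prob_space (P x)) \<and>
     (\<forall>x. \<forall>t\<ge>0. X t \<in> borel_measurable (P x)) \<and>
     (\<forall>x. \<forall>\<omega>\<in>space (P x). cadlag (\<lambda>t. X t \<omega>)) \<and>
     (\<forall>x. AE \<omega> in P x. X 0 \<omega> = x) \<and>
     (\<exists>p. feller_semigroup p \<and>
        (\<forall>x. \<forall>s\<ge>0. \<forall>t\<ge>0. \<forall>B\<in>sets borel.
           AE \<omega> in P x. real_cond_exp (P x) (past (P x) X s) (\<lambda>\<eta>. indicator B (X (s + t) \<eta>)) \<omega>
                        = measure (p t (X s \<omega>)) B))"

section \<open>Coalescing systems\<close>

text \<open>The set \<open>[N]\<close>; particle labels start at 1.\<close>

definition labels :: "enat \<Rightarrow> nat set" where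
  "labels N = {i. 1 \<le> i \<and> enat i \<le> N}"

definition sample_path :: "(real \<Rightarrow> 'w \<Rightarrow> 'a) \<Rightarrow> 'w \<Rightarrow> real \<Rightarrow> 'a" where
  "sample_path X \<omega> = (\<lambda>t\<in>{0..}. X t \<omega>)"

abbreviation path_algebra :: "(real \<Rightarrow> 'a::topological_space) measure" where
  "path_algebra \<equiv> PiM {0..} (\<lambda>_. borel)"

definition independent_copies ::
    "('a::topological_space \<Rightarrow> 'w measure) \<Rightarrow> (real \<Rightarrow> 'w \<Rightarrow> 'a) \<Rightarrow> nat set \<Rightarrow> (nat \<Rightarrow> 'a) \<Rightarrow>
     'v measure \<Rightarrow> (nat \<Rightarrow> real \<Rightarrow> 'v \<Rightarrow> 'a) \<Rightarrow> bool" where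
  "independent_copies P X I x M \<xi> \<longleftrightarrow>
     prob_space M \<and>
     (\<forall>i\<in>I. \<forall>\<omega>\<in>space M. cadlag (\<lambda>t. \<xi> i t \<omega>)) \<and>
     (\<forall>i\<in>I. AE \<omega> in M. \<xi> i 0 \<omega> = x i) \<and>
     (\<forall>i\<in>I. distr M path_algebra (sample_path (\<xi> i)) = distr (P (x i)) path_algebra (sample_path X)) \<and>
     prob_space.indep_vars M (\<lambda>_. path_algebra) (\<lambda>i. sample_path (\<xi> i)) I"

text \<open>
  The times \<open>\<tau>\<^sub>i\<close> and indices \<open>J\<^sub>i\<close> only inspect the members \<open>1, \<dots>, i - 1\<close> of the family
  \<open>\<zeta>\<close>. For right-continuous paths the infimum is attained, so that the set in
  \<open>meeting_index\<close> is nonempty whenever the meeting time is finite.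
\<close>

definition meeting_time :: "(nat \<Rightarrow> real \<Rightarrow> 'a) \<Rightarrow> (nat \<Rightarrow> real \<Rightarrow> 'a) \<Rightarrow> nat \<Rightarrow> ereal" where
  "meeting_time \<xi> \<zeta> i = Inf {ereal t | t. 0 \<le> t \<and> \<xi> i t \<in> {\<zeta> j t | j. j \<in> {1..<i}}}"

definition meeting_index :: "(nat \<Rightarrow> real \<Rightarrow> 'a) \<Rightarrow> (nat \<Rightarrow> real \<Rightarrow> 'a) \<Rightarrow> nat \<Rightarrow> nat" where
  "meeting_index \<xi> \<zeta> i =
     (let \<tau> = real_of_ereal (meeting_time \<xi> \<zeta> i) in Min {j \<in> {1..<i}. \<xi> i \<tau> = \<zeta> j \<tau>})"

lemma meeting_time_cong:
  "(\<And>j. j \<in> {1..<i} \<Longrightarrow> \<zeta> j = \<zeta>' j) \<Longrightarrow> meeting_time \<xi> \<zeta> i = meeting_time \<xi> \<zeta>' i"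
  unfolding meeting_time_def by (rule arg_cong[where f = Inf]) (auto, metis+)

lemma meeting_index_cong:
  assumes "\<And>j. j \<in> {1..<i} \<Longrightarrow> \<zeta> j = \<zeta>' j"
  shows "meeting_index \<xi> \<zeta> i = meeting_index \<xi> \<zeta>' i"
proof -
  have "meeting_time \<xi> \<zeta> i = meeting_time \<xi> \<zeta>' i"
    by (rule meeting_time_cong) (rule assms)
  then show ?thesis
    unfolding meeting_index_def Let_def using assms by (auto intro!: arg_cong[where f = Min])
qed

text \<open>
  The guard \<open>1 \<le> j \<and> j < i\<close> is there for termination only; the lemmas below are the defining
  equations of the \<open>\<zeta>\<^sub>i\<close>.
\<close>

function coalesce :: "(nat \<Rightarrow> real \<Rightarrow> 'a) \<Rightarrow> nat \<Rightarrow> real \<Rightarrow> 'a" where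
  "coalesce \<xi> i =
     (let \<zeta> = (\<lambda>j. if 1 \<le> j \<and> j < i then coalesce \<xi> j else \<xi> j)
      in (\<lambda>t. if ereal t < meeting_time \<xi> \<zeta> i then \<xi> i t else \<zeta> (meeting_index \<xi> \<zeta> i) t))"
  by pat_completeness auto
termination by (relation "Wellfounded.measure snd") auto

declare coalesce.simps [simp del]

lemma coalesce_1: "coalesce \<xi> 1 = \<xi> 1"
  by (rule ext) (simp add: coalesce.simps[of \<xi> "Suc 0"] meeting_time_def top_ereal_def Let_def)

lemma coalesce_less:
  assumes "ereal t < meeting_time \<xi> (coalesce \<xi>) i"
  shows "coalesce \<xi> i t = \<xi> i t"
proof -
  let ?z = "\<lambda>j. if 1 \<le> j \<and> j < i then coalesce \<xi> j else \<xi> j"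
  have "meeting_time \<xi> ?z i = meeting_time \<xi> (coalesce \<xi>) i"
    by (rule meeting_time_cong) auto
  then show ?thesis
    using assms unfolding coalesce.simps[of \<xi> i] Let_def by simp
qed

lemma coalesce_ge:
  assumes "meeting_time \<xi> (coalesce \<xi>) i \<le> ereal t"
    and "{j \<in> {1..<i}. \<xi> i (real_of_ereal (meeting_time \<xi> (coalesce \<xi>) i))
            = coalesce \<xi> j (real_of_ereal (meeting_time \<xi> (coalesce \<xi>) i))} \<noteq> {}" (is "?S \<noteq> {}")
  shows "coalesce \<xi> i t = coalesce \<xi> (meeting_index \<xi> (coalesce \<xi>) i) t"
proof -
  let ?z = "\<lambda>j. if 1 \<le> j \<and> j < i then coalesce \<xi> j else \<xi> j"
  have 1: "meeting_time \<xi> ?z i = meeting_time \<xi> (coalesce \<xi>) i"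
    by (rule meeting_time_cong) auto
  have 2: "meeting_index \<xi> ?z i = meeting_index \<xi> (coalesce \<xi>) i"
    by (rule meeting_index_cong) auto
  have "Min ?S \<in> ?S" using assms(2) by (intro Min_in) auto
  then have "1 \<le> meeting_index \<xi> (coalesce \<xi>) i \<and> meeting_index \<xi> (coalesce \<xi>) i < i"
    by (simp add: meeting_index_def Let_def)
  then show ?thesis
    using assms(1)[folded not_less] unfolding coalesce.simps[of \<xi> i] Let_def 1 2 by simp
qed

text \<open>
  Meeting times are first hitting times of the diagonal by cadlag paths, and these are in general
  measurable only after completing the underlying measure. Events and distributions that involve
  them are therefore taken with respect to \<^const>\<open>completion\<close>.
\<close>

definition coalescing_set ::
    "enat \<Rightarrow> (nat \<Rightarrow> real \<Rightarrow> 'v \<Rightarrow> 'a::topological_space) \<Rightarrow> real \<Rightarrow> 'v \<Rightarrow> 'a set" where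
  "coalescing_set N \<xi> t \<omega> = closure {coalesce (\<lambda>i s. \<xi> i s \<omega>) i t | i. i \<in> labels N}"

section \<open>The state space of the set-valued process\<close>

definition hausdorff_distance :: "('b \<Rightarrow> 'b \<Rightarrow> real) \<Rightarrow> 'b set \<Rightarrow> 'b set \<Rightarrow> real" where
  "hausdorff_distance d A B =
     max (SUP a\<in>A. INF b\<in>B. d a b) (SUP b\<in>B. INF a\<in>A. d a b)"

text \<open>
  The compactification lives on \<^typ>\<open>'a option\<close>, with \<^const>\<open>None\<close> as the point at infinity.
\<close>

abbreviation compactified :: "'a::topological_space option topology" where
  "compactified \<equiv> Alexandroff_compactification euclidean"

definition set_states :: "'a::topological_space set set" where
  "set_states =
     (if compact (UNIV :: 'a set) then {A. A \<noteq> {} \<and> compact A} else {A. A \<noteq> {} \<and> closed A})"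

text \<open>
  In the noncompact case \<open>d\<close> is a metric for the topology of the compactification; in the
  compact case it plays no role. Outside the state space the distance is set to 0 since
  \<^locale>\<open>Metric_space\<close> asks for nonnegativity and symmetry on the whole type.
\<close>

definition set_distance ::
    "('a::metric_space option \<Rightarrow> 'a option \<Rightarrow> real) \<Rightarrow> 'a set \<Rightarrow> 'a set \<Rightarrow> real" where
  "set_distance d A B =
     (if A \<in> set_states \<and> B \<in> set_states then
        if compact (UNIV :: 'a set) then hausdorff_distance dist A B
        else hausdorff_distance d (compactified closure_of (Some ` A)) (compactified closure_of (Some ` B))
      else 0)"

definition set_borel :: "('a::metric_space option \<Rightarrow> 'a option \<Rightarrow> real) \<Rightarrow> 'a set measure" where
  "set_borel d =
     sigma set_states {U. openin (Metric_space.mtopology set_states (set_distance d)) U}"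

abbreviation set_path_algebra ::
    "('a::metric_space option \<Rightarrow> 'a option \<Rightarrow> real) \<Rightarrow> (real \<Rightarrow> 'a set) measure" where
  "set_path_algebra d \<equiv> PiM {0..} (\<lambda>_. set_borel d)"

end

theory Submission
  imports Defs
begin

text \<open>
  Everything is reduced to finite systems. The Borel sets of the Hausdorff metric lie in the
  \<open>\<sigma>\<close>-algebra generated by the sets of states that meet a given open set
  (\<open>set_borel_subset_hit\<close>). Hence the law of \<open>\<Xi>\<close> is determined by the probabilities
  that \<open>\<Xi>\<^sub>t\<close> meets \<open>G\<close> for all pairs \<open>(t, G)\<close> in a finite list
  \<open>L\<close> of times and open sets. An open set meets the closure of the set of particle positions iff it
  contains one of them, and the recursion that defines a particle never looks at later labels. So such a
  probability is the increasing limit of \<open>hit_prob\<close>, the corresponding probability for the system of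
  the first \<open>n\<close> particles (\<open>hits_Union\<close>, \<open>hits_lim\<close>).

  As a function of the list of starting points, \<open>hit_prob\<close> has three properties. It increases when
  points are appended (\<open>hit_prob_prefix\<close>). It depends only on the multiset of the points
  (\<open>hit_prob_mset\<close>). If \<open>a\<close> occurs in the list and no time in \<open>L\<close> is less
  than \<open>t0\<close>, then appending \<open>z\<close> increases it at most by the probability that independent
  copies of \<open>X\<close> from \<open>z\<close> and \<open>a\<close> do not meet by time \<open>t0\<close>: one
  may put \<open>a\<close> first, and a new particle that has met the first one follows an older particle from
  then on and hits nothing new (\<open>hit_prob_append_first\<close>, \<open>hit_prob_append_close\<close>). If
  the closures of the two families of starting points agree, each of the first \<open>n\<close> points of
  \<open>x'\<close> lies so close to some point of \<open>x''\<close> that the probability of not meeting is at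
  most \<open>e / n\<close>. Consequently the hitting probabilities for \<open>x'\<close> exceed those for
  \<open>x''\<close> at most by \<open>e\<close>, and the roles can be exchanged (\<open>hits_le\<close>,
  \<open>hits_eq\<close>). This argument needs \<open>t0 > 0\<close>; at time 0 the set
  \<open>\<Xi>\<^sub>0\<close> is almost surely the common closure (\<open>hits_start\<close>).

  That the order of the labels does not matter is the main point. It suffices to transpose two neighbours
  \<open>k\<close> and \<open>k + 1\<close>. Let \<open>T\<close> be the time when their original paths meet
  first, provided that neither has met a coalesced path with label less than \<open>k\<close> up to then, and
  \<open>\<infinity>\<close> otherwise. From \<open>T\<close> on both particles follow the original path
  \<open>k\<close> until it meets an earlier one, whereas in the opposite order both would follow the path
  \<open>k + 1\<close> in this way. Exchanging the two original paths from \<open>T\<close> on compensates for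
  this: the coalescing system of the exchanged and relabelled paths is, path by path, the old one with relabelled
  particles (\<open>coalesce_swap\<close>). At \<open>T\<close> the two paths are at the same point, so by the
  strong Markov property the exchange preserves their joint law (\<open>swapped_law\<close>). For the latter
  \<open>T\<close> is approximated by discrete times from above. At a fixed time the Feller property makes
  conditional expectations of future observations continuous functions of the current positions, and by right
  continuity the two positions almost agree shortly after \<open>T\<close>.

  Meeting times of cadlag paths are hitting times of the diagonal by right-continuous processes, so their
  measurability is a question about projections. It is answered by Choquet's capacitability argument in a complete
  measure space (\<open>hitting_event_measurable\<close>). Applied to the completion of the past at each time, it
  shows that meeting times are stopping times (\<open>stopping_first_meeting\<close>).
\<close>

section \<open>Measurability of hitting events\<close>

text \<open>
  Choquet's argument. The set \<open>{(s, \<omega>). g s \<omega> = 0}\<close> is the intersection over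
  \<open>n\<close> of countable unions of sets \<open>C n m\<close>: by right continuity, where \<open>g\<close>
  is less than \<open>1 / Suc n\<close> it is bounded by a smaller rational on some interval to the right. All
  sections of \<open>C n m\<close> at fixed \<open>\<omega>\<close> are compact. Because the outer measure is
  continuous along increasing sequences of arbitrary sets, each union over \<open>m\<close> can be cut down to a
  finite one, \<open>m \<le> \<phi> n\<close>, while the projection keeps outer measure above \<open>a\<close>.
  What remains has compact sections, so its projection is the intersection of the projections
  \<open>B \<phi> n\<close> of the first \<open>n\<close> stages, and these are measurable.
\<close>

lemma hitting_event_inner_approx:
  fixes g :: "real \<Rightarrow> 'w \<Rightarrow> real"
  assumes fin: "finite_measure N"
    and meas: "\<And>s. 0 \<le> s \<Longrightarrow> s < t \<Longrightarrow> g s \<in> borel_measurable N"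
    and rc: "\<And>s \<omega>. \<omega> \<in> space N \<Longrightarrow> 0 \<le> s \<Longrightarrow> s < t \<Longrightarrow> ((\<lambda>u. g u \<omega>) \<longlongrightarrow> g s \<omega>) (at_right s)"
    and nonneg: "\<And>s \<omega>. 0 \<le> g s \<omega>"
    and a: "a < outer_measure_of N {\<omega>\<in>space N. \<exists>s\<in>{0..<t}. g s \<omega> = 0}" (is "_ < outer_measure_of N ?H")
  shows "\<exists>K\<in>sets N. K \<subseteq> ?H \<and> a \<le> emeasure N K"
proof -
  interpret finite_measure N by fact
  \<comment> \<open>The times up to \<open>r'\<close> from which on \<open>g\<close> is at most \<open>c\<close> until
    \<open>r\<close>. As \<open>r' < r\<close>, right continuity makes this set closed: a limit point
    \<open>l\<close> is at most \<open>r'\<close>, so \<open>g \<le> c\<close> holds immediately to its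
    right.\<close>
  define S where "S \<theta> \<omega> = (case \<theta> of (r', r, c) \<Rightarrow>
      {s. 0 \<le> s \<and> s \<le> r' \<and> (\<forall>u. s \<le> u \<and> u < r \<longrightarrow> g u \<omega> \<le> c)})" for \<theta> :: "real \<times> real \<times> real" and \<omega>
  define V where "V n = {(r', r, c). r' \<in> \<rat> \<and> r \<in> \<rat> \<and> c \<in> \<rat> \<and> r' < r \<and> r < t \<and> c < 1 / real (Suc n)}" for n
  have V_count: "countable (V n)" for n
    by (rule countable_subset[of _ "\<rat> \<times> \<rat> \<times> \<rat>"]) (auto simp: V_def intro!: countable_SIGMA countable_rat)
  have V_ne: "V n \<noteq> {}" for n
  proof -
    obtain r where "r \<in> \<rat>" "r < t" using Rats_dense_in_real[of "t-1" t] by auto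
    moreover then obtain r' where "r' \<in> \<rat>" "r' < r" using Rats_dense_in_real[of "r-1" r] by auto
    ultimately have "(r', r, 0) \<in> V n" by (auto simp: V_def)
    then show ?thesis by blast
  qed
  define \<theta> where "\<theta> n m = from_nat_into (V n) m" for n m
  have \<theta>V: "\<theta> n m \<in> V n" for n m unfolding \<theta>_def by (rule from_nat_into[OF V_ne])
  define C where "C n m \<omega> = S (\<theta> n m) \<omega>" for n m \<omega>

  have S_closed: "closed (S x \<omega>)" if x: "x \<in> V n" and \<omega>: "\<omega> \<in> space N" for x n \<omega>
  proof -
    obtain r' r c where xe: "x = (r', r, c)" by (cases x) auto
    with x have rr: "r' < r" "r < t" by (auto simp: V_def)
    show ?thesis
      unfolding closed_sequential_limits
    proof (intro allI impI, elim conjE)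
      fix f l assume f: "\<forall>k. f k \<in> S x \<omega>" and l: "f \<longlonglongrightarrow> l"
      have fk: "0 \<le> f k" "f k \<le> r'" "\<And>u. f k \<le> u \<Longrightarrow> u < r \<Longrightarrow> g u \<omega> \<le> c" for k
        using f by (auto simp: S_def xe)
      have l0: "0 \<le> l" using fk(1) l by (intro LIMSEQ_le_const) auto
      have lr: "l \<le> r'" using fk(2) l by (intro LIMSEQ_le_const2) auto
      have gt: "g u \<omega> \<le> c" if u: "l < u" "u < r" for u
      proof -
        have "eventually (\<lambda>k. f k < u) sequentially" using l u(1) by (rule order_tendstoD)
        then obtain k where "f k < u" by (auto simp: eventually_sequentially)
        then show ?thesis using fk(3)[of k u] u by auto
      qed
      have "g l \<omega> \<le> c"
      proof (rule tendsto_upperbound)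
        show "((\<lambda>u. g u \<omega>) \<longlongrightarrow> g l \<omega>) (at_right l)" using rc[OF \<omega> l0] lr rr by auto
        show "eventually (\<lambda>u. g u \<omega> \<le> c) (at_right l)"
          unfolding eventually_at_right_field using gt lr rr by (intro exI[of _ r]) auto
      qed auto
      then show "l \<in> S x \<omega>" using l0 lr gt by (auto simp: S_def xe le_less)
    qed
  qed
  have S_compact: "compact (S x \<omega>)" if "x \<in> V n" "\<omega> \<in> space N" for x n \<omega>
  proof -
    have "S x \<omega> \<subseteq> {0..fst x}" by (auto simp: S_def split: prod.splits)
    then show ?thesis
      using S_closed[OF that] by (meson bounded_closed_interval bounded_subset compact_eq_bounded_closed)
  qed
  have S_meas: "{\<omega>\<in>space N. s \<in> S x \<omega>} \<in> sets N" if "x \<in> V n" for s x n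
  proof -
    obtain r' r c where xe: "x = (r', r, c)" by (cases x) auto
    with that have rr: "r' < r" "r < t" by (auto simp: V_def)
    show ?thesis
    proof (cases "0 \<le> s \<and> s \<le> r'")
      case False
      then have "{\<omega>\<in>space N. s \<in> S x \<omega>} = {}" by (auto simp: S_def xe)
      then show ?thesis by (simp only: sets.empty_sets)
    next
      case True
      define Q where "Q = insert s (\<rat> \<inter> {s<..<r})"
      have "{\<omega>\<in>space N. s \<in> S x \<omega>} = {\<omega>\<in>space N. \<forall>u\<in>Q. g u \<omega> \<le> c}"
      proof (rule Collect_cong, rule conj_cong[OF refl])
        fix \<omega> assume \<omega>: "\<omega> \<in> space N"
        have "g u \<omega> \<le> c" if Q: "\<forall>u\<in>Q. g u \<omega> \<le> c" and u: "s \<le> u" "u < r" for u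
        proof (rule ccontr)
          assume "\<not> g u \<omega> \<le> c"
          moreover have "((\<lambda>v. g v \<omega>) \<longlongrightarrow> g u \<omega>) (at_right u)"
            using rc[OF \<omega>, of u] True u rr by auto
          ultimately have "eventually (\<lambda>v. c < g v \<omega>) (at_right u)"
            by (intro order_tendstoD(1)) auto
          then obtain b where b: "u < b" "\<And>v. u < v \<Longrightarrow> v < b \<Longrightarrow> c < g v \<omega>"
            by (auto simp: eventually_at_right_field)
          obtain q where q: "q \<in> \<rat>" "u < q" "q < min b r"
            using Rats_dense_in_real[of u "min b r"] b u by auto
          then have "q \<in> Q" using u by (auto simp: Q_def)
          then show False using b(2)[of q] Q q by force
        qed
        moreover have "s \<in> S x \<omega> \<longleftrightarrow> (\<forall>u. s \<le> u \<and> u < r \<longrightarrow> g u \<omega> \<le> c)"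
          using True by (simp add: S_def xe)
        moreover have "s \<le> u \<and> u < r" if "u \<in> Q" for u
          using that True rr by (auto simp: Q_def)
        ultimately show "s \<in> S x \<omega> \<longleftrightarrow> (\<forall>u\<in>Q. g u \<omega> \<le> c)" by blast
      qed
      also have "\<dots> \<in> sets N"
      proof (rule sets.sets_Collect_countable_All')
        show "countable Q" unfolding Q_def by (auto intro: countable_subset[OF _ countable_rat])
        fix u assume "u \<in> Q"
        then have "g u \<in> borel_measurable N" using True rr by (intro meas) (auto simp: Q_def)
        then show "{\<omega>\<in>space N. g u \<omega> \<le> c} \<in> sets N" by simp
      qed
      finally show ?thesis .
    qed
  qed
  have S_up: "s' \<in> S x \<omega>" if "s \<in> S x \<omega>" "s \<le> s'" "s' \<le> fst x" for s s' x \<omega>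
    using that by (auto simp: S_def split: prod.splits)

  have cover: "(s \<in> {0..<t} \<and> g s \<omega> = 0) \<longleftrightarrow> (\<forall>n. \<exists>m. s \<in> C n m \<omega>)" if \<omega>: "\<omega> \<in> space N" for s \<omega>
  proof
    assume s: "s \<in> {0..<t} \<and> g s \<omega> = 0"
    show "\<forall>n. \<exists>m. s \<in> C n m \<omega>"
    proof
      fix n
      obtain c where c: "c \<in> \<rat>" "0 < c" "c < 1 / real (Suc n)"
        using Rats_dense_in_real[of 0 "1 / real (Suc n)"] by auto
      have "eventually (\<lambda>u. g u \<omega> < c) (at_right s)"
        using rc[OF \<omega>, of s] s c by (intro order_tendstoD(2)) auto
      then obtain b where b: "s < b" "\<And>u. s < u \<Longrightarrow> u < b \<Longrightarrow> g u \<omega> < c"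
        by (auto simp: eventually_at_right_field)
      obtain r where r: "r \<in> \<rat>" "s < r" "r < min b t"
        using Rats_dense_in_real[of s "min b t"] b s by auto
      obtain r' where r': "r' \<in> \<rat>" "s < r'" "r' < r"
        using Rats_dense_in_real[of s r] r by auto
      have "(r', r, c) \<in> V n" using c r r' by (auto simp: V_def)
      then obtain m where m: "\<theta> n m = (r', r, c)"
        unfolding \<theta>_def using from_nat_into_surj[OF V_count] by blast
      have "g u \<omega> \<le> c" if "s \<le> u" "u < r" for u
        using b(2)[of u] that s c r by (cases "u = s") auto
      then have "s \<in> C n m \<omega>" using s r' by (auto simp: C_def m S_def)
      then show "\<exists>m. s \<in> C n m \<omega>" ..
    qed
  next
    assume s: "\<forall>n. \<exists>m. s \<in> C n m \<omega>"
    have *: "0 \<le> s \<and> s < t \<and> g s \<omega> < 1 / real (Suc n)" for n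
    proof -
      obtain m where m: "s \<in> C n m \<omega>" using s by blast
      obtain r' r c where xe: "\<theta> n m = (r', r, c)" by (cases "\<theta> n m") auto
      then show ?thesis using m \<theta>V[of n m] by (force simp: C_def S_def V_def)
    qed
    have "g s \<omega> \<le> 0"
    proof (rule field_le_epsilon)
      fix e :: real assume "0 < e"
      then obtain n where "inverse (real (Suc n)) < e" using reals_Archimedean by blast
      then show "g s \<omega> \<le> 0 + e" using *[of n] by (auto simp: inverse_eq_divide)
    qed
    then show "s \<in> {0..<t} \<and> g s \<omega> = 0" using *[of 0] nonneg[of s \<omega>] by auto
  qed

  \<comment> \<open>\<open>A \<phi> n\<close> keeps the full condition next to the first \<open>n\<close> finite ones, and
    so is not yet known to be measurable; \<open>B \<phi> n\<close> retains only the finite ones.\<close>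
  define A where "A \<phi> n = {\<omega>\<in>space N. \<exists>s. (\<forall>k<n. \<exists>m\<le>\<phi> k. s \<in> C k m \<omega>) \<and> (\<forall>k. \<exists>m. s \<in> C k m \<omega>)}"
    for \<phi> :: "nat \<Rightarrow> nat" and n
  define B where "B \<phi> n = {\<omega>\<in>space N. \<exists>s. \<forall>k<n. \<exists>m\<le>\<phi> k. s \<in> C k m \<omega>}"
    for \<phi> :: "nat \<Rightarrow> nat" and n
  have A_cong: "A \<phi> n = A \<phi>' n" if "\<And>k. k < n \<Longrightarrow> \<phi> k = \<phi>' k" for \<phi> \<phi>' n
    using that by (simp add: A_def)
  have A0: "A \<phi> 0 = ?H" for \<phi>
  proof -
    have "(\<exists>s. \<forall>k. \<exists>m. s \<in> C k m \<omega>) \<longleftrightarrow> (\<exists>s\<in>{0..<t}. g s \<omega> = 0)" if "\<omega> \<in> space N" for \<omega>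
      using cover[OF that] by blast
    then show ?thesis unfolding A_def by (intro Collect_cong conj_cong refl) simp
  qed
  have A_step: "\<exists>m. a < outer_measure_of N (A (\<phi>(n := m)) (Suc n))" if "a < outer_measure_of N (A \<phi> n)" for \<phi> n
  proof -
    have inc: "incseq (\<lambda>m. A (\<phi>(n := m)) (Suc n))"
    proof (intro incseq_SucI subsetI)
      fix m \<omega> assume "\<omega> \<in> A (\<phi>(n := m)) (Suc n)"
      then obtain s where s: "\<omega> \<in> space N" "\<And>k. k < Suc n \<Longrightarrow> \<exists>l\<le>(\<phi>(n := m)) k. s \<in> C k l \<omega>"
        "\<forall>k. \<exists>l. s \<in> C k l \<omega>"
        unfolding A_def by blast
      have "(\<phi>(n := m)) k \<le> (\<phi>(n := Suc m)) k" for k by simp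
      then have "\<exists>l\<le>(\<phi>(n := Suc m)) k. s \<in> C k l \<omega>" if "k < Suc n" for k
        using s(2)[OF that] order.trans by blast
      then show "\<omega> \<in> A (\<phi>(n := Suc m)) (Suc n)" using s(1,3) unfolding A_def by blast
    qed
    have un: "(\<Union>m. A (\<phi>(n := m)) (Suc n)) = A \<phi> n"
    proof (intro equalityI subsetI)
      fix \<omega> assume "\<omega> \<in> (\<Union>m. A (\<phi>(n := m)) (Suc n))"
      then obtain m s where s: "\<omega> \<in> space N" "\<forall>k<Suc n. \<exists>l\<le>(\<phi>(n := m)) k. s \<in> C k l \<omega>"
        "\<forall>k. \<exists>l. s \<in> C k l \<omega>"
        unfolding A_def by blast
      have "\<exists>l\<le>\<phi> k. s \<in> C k l \<omega>" if "k < n" for k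
        using s(2)[rule_format, of k] that by simp
      then show "\<omega> \<in> A \<phi> n" using s unfolding A_def by blast
    next
      fix \<omega> assume "\<omega> \<in> A \<phi> n"
      then obtain s where s: "\<omega> \<in> space N" "\<forall>k<n. \<exists>l\<le>\<phi> k. s \<in> C k l \<omega>" "\<forall>k. \<exists>l. s \<in> C k l \<omega>"
        by (auto simp: A_def)
      then obtain m where "s \<in> C n m \<omega>" by blast
      then have "\<omega> \<in> A (\<phi>(n := m)) (Suc n)" using s by (auto simp: A_def less_Suc_eq)
      then show "\<omega> \<in> (\<Union>m. A (\<phi>(n := m)) (Suc n))" by blast
    qed
    have "(SUP m. outer_measure_of N (A (\<phi>(n := m)) (Suc n))) = outer_measure_of N (A \<phi> n)"
      unfolding un[symmetric] using inc by (intro SUP_outer_measure_of_incseq) (auto simp: A_def)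
    then have "a < (SUP m. outer_measure_of N (A (\<phi>(n := m)) (Suc n)))" using that by simp
    then show ?thesis unfolding less_SUP_iff by blast
  qed
  define F where "F = rec_nat (\<lambda>_. 0) (\<lambda>n \<phi>. \<phi>(n := SOME m. a < outer_measure_of N (A (\<phi>(n := m)) (Suc n))))"
  have F_Suc: "F (Suc n) = (F n)(n := SOME m. a < outer_measure_of N (A ((F n)(n := m)) (Suc n)))" for n
    by (simp add: F_def)
  have F_big: "a < outer_measure_of N (A (F n) n)" for n
  proof (induction n)
    case 0 then show ?case using a by (simp only: A0)
  next
    case (Suc n) then show ?case unfolding F_Suc by (rule someI_ex[OF A_step])
  qed
  define \<phi> where "\<phi> k = F (Suc k) k" for k
  have F_\<phi>: "F n k = \<phi> k" if "k < n" for n k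
    using that
  proof (induction n)
    case (Suc n)
    then show ?case by (cases "k = n") (auto simp: \<phi>_def F_Suc[of n])
  qed simp
  have A_big: "a < outer_measure_of N (A \<phi> n)" for n
    using F_big[of n] A_cong[of n "F n" \<phi>] F_\<phi> by simp

  \<comment> \<open>A section of \<open>S (r', r, c)\<close> contains with \<open>s\<close> all times between
    \<open>s\<close> and \<open>r'\<close>. So a common time in finitely many such sections may be moved up
    to one of the finitely many endpoints \<open>r'\<close>, and the existential quantifier over time
    becomes finite.\<close>
  have B_meas: "B \<phi> n \<in> sets N" for n
  proof (cases "n = 0")
    case True then show ?thesis by (simp add: B_def)
  next
    case False
    define R where "R = (\<lambda>(k, m). fst (\<theta> k m)) ` (SIGMA k:{..<n}. {..\<phi> k})"
    have "finite R" unfolding R_def by auto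
    have "B \<phi> n = {\<omega>\<in>space N. \<exists>s\<in>R. \<forall>k\<in>{..<n}. \<exists>m\<in>{..\<phi> k}. s \<in> C k m \<omega>}"
    proof (intro equalityI subsetI)
      fix \<omega> assume "\<omega> \<in> B \<phi> n"
      then obtain s where s: "\<omega> \<in> space N" "\<forall>k<n. \<exists>m\<le>\<phi> k. s \<in> C k m \<omega>" by (auto simp: B_def)
      then obtain m where m: "\<And>k. k < n \<Longrightarrow> m k \<le> \<phi> k \<and> s \<in> C k (m k) \<omega>" by metis
      let ?E = "(\<lambda>k. fst (\<theta> k (m k))) ` {..<n}"
      have E: "finite ?E" "?E \<noteq> {}" using False by auto
      define s' where "s' = Min ?E"
      have s'E: "s' \<in> ?E" unfolding s'_def by (rule Min_in[OF E])
      have sle: "s \<le> fst (\<theta> k (m k))" if "k < n" for k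
        using m[OF that] by (auto simp: C_def S_def split: prod.splits)
      have "s \<le> s'" using s'E sle by auto
      moreover have "s' \<le> fst (\<theta> k (m k))" if "k < n" for k
        unfolding s'_def using that by (intro Min_le) auto
      ultimately have "s' \<in> C k (m k) \<omega>" if "k < n" for k
        using m[OF that] S_up[of s "\<theta> k (m k)" \<omega> s'] that by (auto simp: C_def)
      moreover have "s' \<in> R" using s'E m by (force simp: R_def)
      ultimately show "\<omega> \<in> {\<omega>\<in>space N. \<exists>s\<in>R. \<forall>k\<in>{..<n}. \<exists>m\<in>{..\<phi> k}. s \<in> C k m \<omega>}"
        using s(1) m by blast
    next
      fix \<omega> assume "\<omega> \<in> {\<omega>\<in>space N. \<exists>s\<in>R. \<forall>k\<in>{..<n}. \<exists>m\<in>{..\<phi> k}. s \<in> C k m \<omega>}"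
      then obtain s where s: "\<omega> \<in> space N" "\<forall>k\<in>{..<n}. \<exists>m\<in>{..\<phi> k}. s \<in> C k m \<omega>" by blast
      then have "\<forall>k<n. \<exists>m\<le>\<phi> k. s \<in> C k m \<omega>" by (metis lessThan_iff atMost_iff)
      then show "\<omega> \<in> B \<phi> n" using s(1) unfolding B_def by blast
    qed
    also have "\<dots> \<in> sets N"
    proof (intro sets.sets_Collect_finite_Ex sets.sets_Collect_finite_All')
      show "{..<n} \<noteq> {}" using False by (simp add: lessThan_empty_iff)
    qed (use \<open>finite R\<close> S_meas[OF \<theta>V] in \<open>auto simp: C_def\<close>)
    finally show ?thesis .
  qed
  have B_dec: "decseq (B \<phi>)" unfolding decseq_def B_def by (auto, metis order_less_le_trans)
  have AB: "A \<phi> n \<subseteq> B \<phi> n" for n by (auto simp: A_def B_def)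
  define K where "K = (\<Inter>n. B \<phi> n)"
  have "K \<in> sets N" unfolding K_def using B_meas by auto
  moreover have "a \<le> emeasure N K"
  proof -
    have "(INF n. emeasure N (B \<phi> n)) = emeasure N K"
      unfolding K_def using B_meas B_dec by (intro INF_emeasure_decseq) auto
    moreover have "a \<le> emeasure N (B \<phi> n)" for n
      using A_big[of n] outer_measure_of_mono[OF AB[of n], of N] B_meas by (auto intro: order.trans less_imp_le)
    ultimately show ?thesis by (metis INF_greatest)
  qed
  moreover have "K \<subseteq> ?H"
  proof
    fix \<omega> assume \<omega>K: "\<omega> \<in> K"
    then have \<omega>: "\<omega> \<in> space N" by (auto simp: K_def B_def)
    define D where "D n = {s. \<forall>k<Suc n. \<exists>m\<le>\<phi> k. s \<in> C k m \<omega>}" for n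
    have D_eq: "D n = (\<Inter>k\<in>{..n}. \<Union>m\<in>{..\<phi> k}. C k m \<omega>)" for n
      by (auto simp: D_def less_Suc_eq_le)
    have "compact (D n)" for n
    proof -
      have "compact (\<Union>m\<in>{..\<phi> k}. C k m \<omega>)" for k
        using S_compact[OF \<theta>V \<omega>] by (intro compact_UN) (auto simp: C_def)
      then show ?thesis unfolding D_eq by (intro compact_Inter) auto
    qed
    moreover have "D n \<noteq> {}" for n
    proof -
      have "\<omega> \<in> B \<phi> (Suc n)" using \<omega>K by (auto simp: K_def)
      then show ?thesis by (auto simp: B_def D_def)
    qed
    moreover have "D n \<subseteq> D m" if "m \<le> n" for m n using that by (auto simp: D_def)
    ultimately have "\<Inter> (range D) \<noteq> {}" by (intro compact_nest) auto
    then obtain s where "\<And>n. s \<in> D n" by auto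
    then have "\<forall>k. \<exists>m. s \<in> C k m \<omega>" by (auto simp: D_def)
    then show "\<omega> \<in> ?H" using cover[OF \<omega>, of s] \<omega> by auto
  qed
  ultimately show ?thesis by blast
qed

text \<open>
  Inner approximation by measurable sets up to any \<open>e\<close> and a measurable cover of the same outer
  measure squeeze the event; completeness of the measure does the rest.
\<close>

lemma hitting_event_measurable:
  fixes g :: "real \<Rightarrow> 'w \<Rightarrow> real"
  assumes "complete_measure N" "finite_measure N"
    and "\<And>s. 0 \<le> s \<Longrightarrow> s < t \<Longrightarrow> g s \<in> borel_measurable N"
    and "\<And>s \<omega>. \<omega> \<in> space N \<Longrightarrow> 0 \<le> s \<Longrightarrow> s < t \<Longrightarrow> ((\<lambda>u. g u \<omega>) \<longlongrightarrow> g s \<omega>) (at_right s)"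
    and "\<And>s \<omega>. 0 \<le> g s \<omega>"
  shows "{\<omega>\<in>space N. \<exists>s\<in>{0..<t}. g s \<omega> = 0} \<in> sets N" (is "?H \<in> _")
proof -
  interpret complete_measure N by fact
  interpret finite_measure N by fact
  obtain E where E: "E \<in> sets N" "?H \<subseteq> E" "outer_measure_of N ?H = emeasure N E"
    using outer_measure_of_attain[of ?H N] by auto
  have "?H \<in> fmeasurable N"
    unfolding fmeasurable_inner_outer
  proof (intro allI impI)
    fix e :: real assume e: "0 < e"
    show "\<exists>T\<in>fmeasurable N. \<exists>U\<in>fmeasurable N. T \<subseteq> ?H \<and> ?H \<subseteq> U \<and> \<bar>measure N T - measure N U\<bar> < e"
    proof (cases "measure N E < e")
      case True
      then show ?thesis
        using E by (intro bexI[of _ "{}"] bexI[of _ E]) (auto simp: fmeasurable_eq_sets)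
    next
      case False
      have "ennreal (measure N E - e / 2) < outer_measure_of N ?H"
        using False e unfolding E(3) emeasure_eq_measure by (subst ennreal_less_iff) auto
      from hitting_event_inner_approx[OF assms(2-5) this]
      obtain K where K: "K \<in> sets N" "K \<subseteq> ?H" "ennreal (measure N E - e / 2) \<le> emeasure N K"
        by blast
      have "measure N E - e / 2 \<le> measure N K"
        using K(3) False e unfolding emeasure_eq_measure by (subst (asm) ennreal_le_iff) auto
      moreover have "measure N K \<le> measure N E"
        using K E by (intro finite_measure_mono) auto
      ultimately show ?thesis
        using K E e by (intro bexI[of _ K] bexI[of _ E]) (auto simp: fmeasurable_eq_sets)
    qed
  qed
  then show ?thesis by (simp add: fmeasurable_eq_sets)
qed

lemma meeting_event_measurable:
  fixes a z :: "real \<Rightarrow> 'w \<Rightarrow> 'a::{metric_space, second_countable_topology}"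
  assumes N: "complete_measure N" "finite_measure N"
    and meas: "\<And>s. 0 \<le> s \<Longrightarrow> s \<le> t \<Longrightarrow> a s \<in> borel_measurable N" "\<And>s. 0 \<le> s \<Longrightarrow> s \<le> t \<Longrightarrow> z s \<in> borel_measurable N"
    and rc: "\<And>s \<omega>. \<omega> \<in> space N \<Longrightarrow> 0 \<le> s \<Longrightarrow> ((\<lambda>u. a u \<omega>) \<longlongrightarrow> a s \<omega>) (at_right s)"
      "\<And>s \<omega>. \<omega> \<in> space N \<Longrightarrow> 0 \<le> s \<Longrightarrow> ((\<lambda>u. z u \<omega>) \<longlongrightarrow> z s \<omega>) (at_right s)"
  shows "{\<omega>\<in>space N. \<exists>s\<in>{0..t}. a s \<omega> = z s \<omega>} \<in> sets N"
proof (cases "0 \<le> t")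
  case True
  have 1: "{\<omega>\<in>space N. \<exists>s\<in>{0..<t}. dist (a s \<omega>) (z s \<omega>) = 0} \<in> sets N"
    using meas rc by (intro hitting_event_measurable[OF N] borel_measurable_dist tendsto_dist) auto
  have "(\<lambda>\<omega>. dist (a t \<omega>) (z t \<omega>)) \<in> borel_measurable N"
    using meas[OF True order_refl] by (intro borel_measurable_dist)
  then have 2: "{\<omega>\<in>space N. dist (a t \<omega>) (z t \<omega>) = 0} \<in> sets N"
    by (intro borel_measurable_eq borel_measurable_const)
  have "{0..t} = insert t {0..<t}" using True by auto
  then have "{\<omega>\<in>space N. \<exists>s\<in>{0..t}. a s \<omega> = z s \<omega>} =
      {\<omega>\<in>space N. \<exists>s\<in>{0..<t}. dist (a s \<omega>) (z s \<omega>) = 0} \<union> {\<omega>\<in>space N. dist (a t \<omega>) (z t \<omega>) = 0}"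
    by auto
  then show ?thesis using 1 2 by simp
qed simp

section \<open>The Borel sets of the Hausdorff metric\<close>

definition hit_set :: "'a::topological_space set \<Rightarrow> 'a set set" where
  "hit_set G = {A \<in> set_states. A \<inter> G \<noteq> {}}"

definition hit_algebra :: "'a::topological_space set measure" where
  "hit_algebra = sigma set_states {hit_set G | G. open G}"

lemma set_states_eq: "(set_states :: 'a::metric_space set set) = {A. A \<noteq> {} \<and> closed A}"
  by (auto simp: set_states_def compact_imp_closed intro: compact_Int_closed[of UNIV, simplified])

lemma hit_set_subset: "{hit_set G | G. open G} \<subseteq> Pow set_states"
  by (auto simp: hit_set_def)

lemma space_hit_algebra [simp]: "space hit_algebra = set_states"
  unfolding hit_algebra_def by (rule space_measure_of[OF hit_set_subset])

lemma sets_hit_algebra: "sets hit_algebra = sigma_sets set_states {hit_set G | G. open G}"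
  unfolding hit_algebra_def by (rule sets_measure_of[OF hit_set_subset])

lemma hit_set_in_sets: "open G \<Longrightarrow> hit_set G \<in> sets hit_algebra"
  unfolding sets_hit_algebra by auto

text \<open>
  Since \<open>\<rho>\<close> is totally bounded, nonempty finite subsets of a countable dense set are dense for
  the Hausdorff metric, and every open set is a countable union of closed balls around them. That \<open>A\<close>
  lies in the closed ball of radius \<open>q\<close> around a finite set \<open>S\<close> is a condition about
  hitting open sets: \<open>A\<close> misses the points farther than \<open>q\<close> from \<open>S\<close>, and
  it hits every ball of radius greater than \<open>q\<close> around a point of \<open>S\<close>.
\<close>

lemma hausdorff_borel:
  fixes \<rho> :: "'a::metric_space \<Rightarrow> 'a \<Rightarrow> real" and h :: "'a set \<Rightarrow> 'a set \<Rightarrow> real"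
  assumes \<rho>: "Metric_space UNIV \<rho>"
    and op: "\<And>U. open U \<longleftrightarrow> (\<forall>x\<in>U. \<exists>r>0. \<forall>y. \<rho> x y < r \<longrightarrow> y \<in> U)"
    and tb: "\<And>e. e > 0 \<Longrightarrow> \<exists>F. finite F \<and> (\<forall>x. \<exists>y\<in>F. \<rho> x y < e)"
    and h: "\<And>A B. A \<in> set_states \<Longrightarrow> B \<in> set_states \<Longrightarrow> h A B = hausdorff_distance \<rho> A B"
    and h0: "\<And>A B. \<not> (A \<in> set_states \<and> B \<in> set_states) \<Longrightarrow> h A B = 0"
  shows "sigma_sets set_states {U. openin (Metric_space.mtopology set_states h) U} \<subseteq> sets hit_algebra"
proof -
  interpret \<rho>: Metric_space UNIV \<rho> by fact
  define dS where "dS x B = (INF b\<in>B. \<rho> x b)" for x and B :: "'a set"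
  have bddb: "bdd_below (\<rho> x ` B)" for x B by (rule bdd_belowI2[of _ 0]) simp
  have dS_nonneg: "0 \<le> dS x B" if "B \<noteq> {}" for x B
    unfolding dS_def using that by (intro cINF_greatest) auto
  have dS_le: "dS x B \<le> \<rho> x b" if "b \<in> B" for x b B
    unfolding dS_def using that bddb by (intro cINF_lower)
  have dS_less: "dS x B < r \<longleftrightarrow> (\<exists>b\<in>B. \<rho> x b < r)" if "B \<noteq> {}" for x B r
    unfolding dS_def using that bddb by (intro cINF_less_iff)
  have dS_tri: "dS x B \<le> \<rho> x y + dS y B" if "B \<noteq> {}" for x y B
  proof -
    have "dS x B - \<rho> x y \<le> dS y B"
      unfolding dS_def[of y]
    proof (rule cINF_greatest[OF that])
      fix b assume "b \<in> B"
      then show "dS x B - \<rho> x y \<le> \<rho> y b" using dS_le[of b B x] \<rho>.triangle[of x y b] by auto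
    qed
    then show ?thesis by simp
  qed
  obtain F1 where F1: "finite F1" "\<And>x. \<exists>y\<in>F1. \<rho> x y < 1" using tb[of 1] by auto
  have bound: "\<exists>D. \<forall>x y. \<rho> x y \<le> D"
  proof -
    define D where "D = Max (insert 0 ((\<lambda>(x, y). \<rho> x y) ` (F1 \<times> F1)))"
    have "\<rho> x y \<le> 2 + D" for x y
    proof -
      obtain x' y' where *: "x' \<in> F1" "\<rho> x x' < 1" "y' \<in> F1" "\<rho> y y' < 1" using F1(2) by meson
      have "\<rho> x' y' \<le> D" unfolding D_def using * F1(1) by (intro Max_ge) auto
      then show ?thesis
        using \<rho>.triangle[of x x' y] \<rho>.triangle[of x' y' y] \<rho>.commute[of y' y] * by auto
    qed
    then show ?thesis by blast
  qed
  then obtain D where D: "\<And>x y. \<rho> x y \<le> D" by blast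
  have dS_D: "dS x B \<le> D" if "B \<noteq> {}" for x B
    using that dS_le[of _ B x] D order.trans by (metis ex_in_conv)
  have h_le: "h A B \<le> r \<longleftrightarrow> (\<forall>a\<in>A. dS a B \<le> r) \<and> (\<forall>b\<in>B. dS b A \<le> r)"
    if "A \<in> set_states" "B \<in> set_states" for A B r
  proof -
    have ne: "A \<noteq> {}" "B \<noteq> {}" using that by (auto simp: set_states_eq)
    have "bdd_above ((\<lambda>a. dS a B) ` A)" "bdd_above ((\<lambda>b. dS b A) ` B)"
      using dS_D ne by (auto intro!: bdd_aboveI2[of _ _ D])
    moreover have "(INF a\<in>A. \<rho> a b) = dS b A" for b unfolding dS_def by (simp add: \<rho>.commute)
    ultimately show ?thesis
      using ne by (simp add: h[OF that] hausdorff_distance_def cSUP_le_iff flip: dS_def)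
  qed
  have h_dS: "dS a B \<le> h A B" if "A \<in> set_states" "B \<in> set_states" "a \<in> A" for a A B
    using h_le[of A B "h A B"] that by auto
  have h_sym: "h A B = h B A" for A B
  proof (cases "A \<in> set_states \<and> B \<in> set_states")
    case True
    then show ?thesis using h_le[of A B "h B A"] h_le[of B A "h A B"] h_le[of A B "h A B"] h_le[of B A "h B A"]
      by (intro antisym) auto
  qed (use h0 in auto)
  have h_nonneg: "0 \<le> h A B" for A B
  proof (cases "A \<in> set_states \<and> B \<in> set_states")
    case True
    then obtain a where "a \<in> A" "B \<noteq> {}" by (auto simp: set_states_eq)
    then show ?thesis using h_dS[of A B a] dS_nonneg[of B a] True by auto
  qed (use h0 in auto)
  have h_tri: "h A C \<le> h A B + h B C" if "A \<in> set_states" "B \<in> set_states" "C \<in> set_states" for A B C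
  proof -
    have half: "dS a C \<le> h A B + h B C" if "a \<in> A" "A \<in> set_states" "B \<in> set_states" "C \<in> set_states" for a A B C
    proof -
      have ne: "B \<noteq> {}" "C \<noteq> {}" using that by (auto simp: set_states_eq)
      have "dS a C - h B C \<le> dS a B"
        unfolding dS_def[of a B]
      proof (rule cINF_greatest[OF ne(1)])
        fix b assume "b \<in> B"
        then show "dS a C - h B C \<le> \<rho> a b"
          using dS_tri[OF ne(2), of a b] h_dS[of B C b] that by auto
      qed
      then show ?thesis using h_dS[of A B a] that by auto
    qed
    show ?thesis
      unfolding h_le[OF that(1,3)]
      using half[of _ A B C] half[of _ C B A] that h_sym[of A B] h_sym[of B C] by (auto simp: add.commute)
  qed
  have dS0: "a \<in> B" if "dS a B = 0" "B \<in> set_states" for a B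
  proof (rule ccontr)
    assume "a \<notin> B"
    have "open (- B)" "B \<noteq> {}" using that by (auto simp: set_states_eq)
    then obtain r where r: "0 < r" "\<And>y. \<rho> a y < r \<Longrightarrow> y \<in> - B" using op[of "- B"] \<open>a \<notin> B\<close> by blast
    then show False using dS_less[OF \<open>B \<noteq> {}\<close>, of a r] that by auto
  qed
  have h_zero: "h A B = 0 \<longleftrightarrow> A = B" if "A \<in> set_states" "B \<in> set_states" for A B
  proof
    assume "h A B = 0"
    then have "\<forall>a\<in>A. dS a B \<le> 0" "\<forall>b\<in>B. dS b A \<le> 0" using h_le[OF that, of 0] by auto
    moreover have "A \<noteq> {}" "B \<noteq> {}" using that by (auto simp: set_states_eq)
    ultimately have "\<forall>a\<in>A. dS a B = 0" "\<forall>b\<in>B. dS b A = 0" using dS_nonneg antisym by metis+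
    then show "A = B" using dS0 that by blast
  next
    assume "A = B"
    have "dS a A \<le> 0" if "a \<in> A" for a using dS_le[OF that, of a] by simp
    then have "h A B \<le> 0" using h_le[OF that, of 0] \<open>A = B\<close> by auto
    then show "h A B = 0" using h_nonneg[of A B] by auto
  qed
  interpret h: Metric_space set_states h
    by unfold_locales (use h_nonneg h_sym h_zero h_tri in auto)

  obtain F where F: "\<And>n. finite (F n)" "\<And>n x. \<exists>y\<in>F n. \<rho> x y < 1 / real (Suc n)"
    using tb[of "1 / real (Suc _)"] by (metis divide_pos_pos of_nat_0_less_iff zero_less_Suc zero_less_one)
  define \<F> where "\<F> = {S. finite S \<and> S \<subseteq> (\<Union>n. F n) \<and> S \<noteq> {}}"
  have \<F>c: "countable \<F>"
  proof -
    have "countable (\<Union>n. F n)" using F(1) by (auto intro: countable_finite)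
    then have "countable {S. finite S \<and> S \<subseteq> (\<Union>n. F n)}" by (rule countable_Collect_finite_subset)
    then show ?thesis unfolding \<F>_def by (rule countable_subset[rotated]) auto
  qed
  have \<F>s: "S \<in> set_states" if "S \<in> \<F>" for S
    using that by (auto simp: \<F>_def set_states_eq finite_imp_closed)
  define cb where "cb S q = {A \<in> set_states. h A S \<le> q}" for S q
  have dense: "\<exists>S\<in>\<F>. h A S \<le> e" if Ae: "A \<in> set_states" "0 < e" for A e
  proof -
    obtain n where n: "inverse (real (Suc n)) < e" using reals_Archimedean[OF Ae(2)] by blast
    define S where "S = {y \<in> F n. \<exists>a\<in>A. \<rho> a y < 1 / real (Suc n)}"
    have near: "\<exists>y\<in>S. \<rho> a y < e" if "a \<in> A" for a
      using F(2)[of n a] n that by (fastforce simp: S_def inverse_eq_divide)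
    have "A \<noteq> {}" using Ae(1) by (auto simp: set_states_eq)
    then have "S \<noteq> {}" using near by auto
    then have S: "S \<in> \<F>" using F(1)[of n] by (auto simp: \<F>_def S_def)
    have "dS a S \<le> e" if "a \<in> A" for a
      using near[OF that] dS_le[of _ S a] by (auto intro: order.trans less_imp_le)
    moreover have "dS y A \<le> e" if yS: "y \<in> S" for y
    proof -
      obtain a where "a \<in> A" "\<rho> a y < e" using yS n by (auto simp: S_def inverse_eq_divide)
      then show ?thesis using dS_le[of a A y] \<rho>.commute[of a y] by auto
    qed
    ultimately show ?thesis using S h_le[OF Ae(1) \<F>s[OF S], of e] by blast
  qed
  have ball_open: "open {y. \<rho> x y < r}" for x r
    unfolding op
  proof (intro ballI)
    fix y assume "y \<in> {y. \<rho> x y < r}"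
    then have "\<rho> x y < r" by simp
    then show "\<exists>s>0. \<forall>z. \<rho> y z < s \<longrightarrow> z \<in> {y. \<rho> x y < r}"
      using \<rho>.triangle[of x y] by (intro exI[of _ "r - \<rho> x y"]) (auto, smt (verit))
  qed
  have far_open: "open {x. q < dS x S}" if "S \<noteq> {}" for q S
    unfolding op
  proof (intro ballI)
    fix x assume "x \<in> {x. q < dS x S}"
    then have "q < dS x S" by simp
    then show "\<exists>s>0. \<forall>z. \<rho> x z < s \<longrightarrow> z \<in> {x. q < dS x S}"
      using dS_tri[OF that, of x] by (intro exI[of _ "dS x S - q"]) (auto, smt (verit))
  qed
  have cb_meas: "cb S q \<in> sets hit_algebra" if S: "S \<in> \<F>" for S q
  proof -
    have Sfin: "finite S" "S \<noteq> {}" using S by (auto simp: \<F>_def)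
    let ?X = "set_states - hit_set {x. q < dS x S}"
    let ?Y = "\<lambda>y n. hit_set {x. \<rho> y x < q + 1 / real (Suc n)}"
    have "cb S q = ?X \<inter> (\<Inter>y\<in>S. \<Inter>n. ?Y y n)"
    proof (intro equalityI subsetI)
      fix A assume "A \<in> cb S q"
      then have A: "A \<in> set_states" "\<forall>a\<in>A. dS a S \<le> q" "\<forall>y\<in>S. dS y A \<le> q"
        using h_le[of A S q] \<F>s[OF S] by (auto simp: cb_def)
      have "A \<in> ?Y y n" if "y \<in> S" for y n
      proof -
        have "A \<noteq> {}" using A(1) by (auto simp: set_states_eq)
        moreover have "dS y A < q + 1 / real (Suc n)"
          using A(3) that by (auto intro: le_less_trans)
        ultimately show ?thesis using A(1) dS_less[of A y] by (auto simp: hit_set_def)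
      qed
      then show "A \<in> ?X \<inter> (\<Inter>y\<in>S. \<Inter>n. ?Y y n)" using A by (auto simp: hit_set_def)
    next
      fix A assume A: "A \<in> ?X \<inter> (\<Inter>y\<in>S. \<Inter>n. ?Y y n)"
      then have A1: "A \<in> set_states" "\<forall>a\<in>A. dS a S \<le> q" by (auto simp: hit_set_def)
      have "dS y A \<le> q" if "y \<in> S" for y
      proof (rule field_le_epsilon)
        fix e :: real assume "0 < e"
        then obtain n where n: "inverse (real (Suc n)) < e" using reals_Archimedean by blast
        have "A \<in> ?Y y n" using A that by auto
        then obtain a where "a \<in> A" "\<rho> y a < q + 1 / real (Suc n)" by (auto simp: hit_set_def)
        then show "dS y A \<le> q + e" using dS_le[of a A y] n by (auto simp: inverse_eq_divide)
      qed
      then show "A \<in> cb S q" using A1 h_le[OF A1(1) \<F>s[OF S]] by (auto simp: cb_def)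
    qed
    also have "\<dots> \<in> sets hit_algebra"
    proof (rule sets.Int)
      show "?X \<in> sets hit_algebra"
        using sets.compl_sets[OF hit_set_in_sets[OF far_open[OF Sfin(2), of q]]] by simp
      show "(\<Inter>y\<in>S. \<Inter>n. ?Y y n) \<in> sets hit_algebra"
        using Sfin hit_set_in_sets[OF ball_open] by (intro sets.finite_INT sets.countable_INT) auto
    qed
    finally show ?thesis .
  qed
  have "U \<in> sets hit_algebra" if U: "openin h.mtopology U" for U
  proof -
    have Us: "U \<subseteq> set_states" "\<And>A. A \<in> U \<Longrightarrow> \<exists>r>0. h.mball A r \<subseteq> U"
      using U by (auto simp: h.openin_mtopology)
    define I where "I = {(S, q). S \<in> \<F> \<and> q \<in> \<rat> \<and> cb S q \<subseteq> U}"
    have "countable I"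
      by (rule countable_subset[of _ "\<F> \<times> \<rat>"]) (auto simp: I_def intro: countable_SIGMA \<F>c countable_rat)
    moreover have "U = (\<Union>(S, q)\<in>I. cb S q)"
    proof (intro equalityI subsetI)
      fix A assume A: "A \<in> U"
      then obtain r where r: "0 < r" "h.mball A r \<subseteq> U" using Us by blast
      obtain q where q: "q \<in> \<rat>" "0 < q" "q < r / 2" using Rats_dense_in_real[of 0 "r/2"] r by auto
      have As: "A \<in> set_states" using A Us by auto
      obtain S where S: "S \<in> \<F>" "h A S \<le> q" using dense[OF As q(2)] by blast
      have "cb S q \<subseteq> U"
      proof
        fix B assume "B \<in> cb S q"
        then have B: "B \<in> set_states" "h B S \<le> q" by (auto simp: cb_def)
        then have "h A B < r" using h_tri[OF As \<F>s[OF S(1)] B(1)] S q h_sym[of B S] by auto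
        then show "B \<in> U" using r As B by (auto simp: h.in_mball)
      qed
      then have "(S, q) \<in> I" "A \<in> cb S q" using S q As by (auto simp: I_def cb_def)
      then show "A \<in> (\<Union>(S, q)\<in>I. cb S q)" by blast
    qed (auto simp: I_def)
    moreover have "(\<Union>(S, q)\<in>I. cb S q) \<in> sets hit_algebra"
      using \<open>countable I\<close> by (intro sets.countable_UN') (auto simp: I_def intro: cb_meas)
    ultimately show ?thesis by simp
  qed
  then have "sigma_sets (space hit_algebra) {U. openin h.mtopology U} \<subseteq> sets hit_algebra"
    by (intro sets.sigma_sets_subset) auto
  then show ?thesis by simp
qed

text \<open>
  The distance of a point to a set is continuous in the point and does not change when the set is closed. This is
  what allows the Hausdorff metric of the compactification to be pulled back to a metric on the original space.
\<close>

lemma hausdorff_distance_closure: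
  fixes m :: "'b \<Rightarrow> 'b \<Rightarrow> real" and A B :: "'b set"
  assumes m: "Metric_space UNIV m" and bd: "\<And>x y. m x y \<le> D" and ne: "A \<noteq> {}" "B \<noteq> {}"
  defines "cl \<equiv> \<lambda>S. Metric_space.mtopology UNIV m closure_of S"
  shows "hausdorff_distance m (cl A) (cl B) = hausdorff_distance m A B"
proof -
  interpret m: Metric_space UNIV m by fact
  have clI: "S \<subseteq> cl S" for S
    unfolding cl_def by (rule closure_of_subset) simp
  have clD: "\<exists>y\<in>S. m x y < e" if "x \<in> cl S" "0 < e" for x S e
    using that unfolding cl_def m.metric_closure_of by (auto simp: m.in_mball)
  have inf_eq: "(INF b\<in>cl S. m x b) = (INF b\<in>S. m x b)" if "S \<noteq> {}" for x S
  proof (rule antisym)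
    show "(INF b\<in>cl S. m x b) \<le> (INF b\<in>S. m x b)"
      using that clI by (intro cINF_superset_mono bdd_belowI2[of _ 0]) auto
    show "(INF b\<in>S. m x b) \<le> (INF b\<in>cl S. m x b)"
    proof (rule cINF_greatest)
      show "cl S \<noteq> {}" using clI[of S] that by auto
      fix b assume b: "b \<in> cl S"
      show "(INF b\<in>S. m x b) \<le> m x b"
      proof (rule field_le_epsilon)
        fix e :: real assume "0 < e"
        then obtain y where y: "y \<in> S" "m b y < e" using clD[OF b] by blast
        have "(INF b\<in>S. m x b) \<le> m x y" using y by (intro cINF_lower bdd_belowI2[of _ 0]) auto
        then show "(INF b\<in>S. m x b) \<le> m x b + e" using m.triangle[of x b y] y by auto
      qed
    qed
  qed
  have sup_eq: "(SUP a\<in>cl S. INF b\<in>R. m a b) = (SUP a\<in>S. INF b\<in>R. m a b)" if ne2: "S \<noteq> {}" "R \<noteq> {}" for S R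
  proof (rule antisym)
    have le: "(INF b\<in>R. m a b) \<le> D" for a
    proof -
      obtain b where "b \<in> R" using ne2 by auto
      then have "(INF b\<in>R. m a b) \<le> m a b" by (intro cINF_lower bdd_belowI2[of _ 0]) auto
      then show ?thesis using bd[of a b] by auto
    qed
    then have bda: "bdd_above ((\<lambda>a. INF b\<in>R. m a b) ` T)" for T by (intro bdd_aboveI2[of _ _ D])
    show "(SUP a\<in>S. INF b\<in>R. m a b) \<le> (SUP a\<in>cl S. INF b\<in>R. m a b)"
      using that clI bda by (intro cSUP_subset_mono) auto
    show "(SUP a\<in>cl S. INF b\<in>R. m a b) \<le> (SUP a\<in>S. INF b\<in>R. m a b)"
    proof (rule cSUP_least)
      show "cl S \<noteq> {}" using clI[of S] that by auto
      fix a assume a: "a \<in> cl S"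
      show "(INF b\<in>R. m a b) \<le> (SUP a\<in>S. INF b\<in>R. m a b)"
      proof (rule field_le_epsilon)
        fix e :: real assume "0 < e"
        then obtain y where y: "y \<in> S" "m a y < e" using clD[OF a] by blast
        have "(INF b\<in>R. m a b) - m a y \<le> (INF b\<in>R. m y b)"
        proof (rule cINF_greatest)
          fix b assume "b \<in> R"
          then have "(INF b\<in>R. m a b) \<le> m a b" by (intro cINF_lower bdd_belowI2[of _ 0]) auto
          then show "(INF b\<in>R. m a b) - m a y \<le> m y b" using m.triangle[of a y b] by auto
        qed (use that in auto)
        moreover have "(INF b\<in>R. m y b) \<le> (SUP a\<in>S. INF b\<in>R. m a b)"
          using y bda by (intro cSUP_upper)
        ultimately show "(INF b\<in>R. m a b) \<le> (SUP a\<in>S. INF b\<in>R. m a b) + e" using y by auto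
      qed
    qed
  qed
  have ne': "cl A \<noteq> {}" "cl B \<noteq> {}" using clI ne by blast+
  show ?thesis
    unfolding hausdorff_distance_def
    using sup_eq[OF ne(1) ne(2)] sup_eq[OF ne(2) ne(1)] inf_eq[OF ne(2)] inf_eq[OF ne(1)]
    by (simp add: m.commute[of _ _])
qed

text \<open>
  In both cases the metric of the state space is the Hausdorff metric of a totally bounded metric
  \<open>\<rho>\<close> that induces the topology: the given metric if the space is compact, and otherwise the
  restriction to the space of the metric of its compactification.
\<close>

lemma set_borel_subset_hit:
  fixes d :: "'a::metric_space option \<Rightarrow> 'a option \<Rightarrow> real"
  assumes "\<not> compact (UNIV :: 'a set) \<Longrightarrow>
           Metric_space UNIV d \<and> Metric_space.mtopology UNIV d = compactified"
  shows "sets (set_borel d) \<subseteq> sets hit_algebra" "space (set_borel d) = set_states"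
proof -
  have "sigma_sets set_states {U. openin (Metric_space.mtopology set_states (set_distance d)) U} \<subseteq> sets hit_algebra"
  proof (cases "compact (UNIV :: 'a set)")
    case True
    show ?thesis
    proof (rule hausdorff_borel)
      show "Metric_space UNIV (dist :: 'a \<Rightarrow> 'a \<Rightarrow> real)" by (rule Met_TC.Metric_space_axioms)
      show "\<exists>F::'a set. finite F \<and> (\<forall>x. \<exists>y\<in>F. dist x y < e)" if "0 < e" for e
      proof -
        obtain F :: "'a set" where "finite F" "UNIV \<subseteq> (\<Union>x\<in>F. ball x e)"
          using True \<open>0 < e\<close> unfolding compact_eq_totally_bounded by blast
        then show ?thesis by (intro exI[of _ F]) (force simp: dist_commute subset_eq)
      qed
      show "open U \<longleftrightarrow> (\<forall>x\<in>U. \<exists>r>0. \<forall>y. dist x y < r \<longrightarrow> y \<in> U)" for U :: "'a set"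
        by (simp add: open_dist dist_commute)
    qed (auto simp: set_distance_def True)
  next
    case False
    then have m: "Metric_space UNIV d" "Metric_space.mtopology UNIV d = compactified" using assms by auto
    interpret d: Metric_space UNIV d by fact
    have cs: "compact_space d.mtopology" unfolding m(2) by simp
    have tbd: "\<exists>K. finite K \<and> UNIV \<subseteq> (\<Union>x\<in>K. d.mball x e)" if "0 < e" for e
      using d.compactin_imp_mtotally_bounded[of UNIV] cs that
      by (auto simp: compact_space_def d.mtotally_bounded_def)
    obtain K where K: "finite K" "UNIV \<subseteq> (\<Union>x\<in>K. d.mball x 1)" using tbd[of 1] by auto
    define D where "D = Max (insert 0 ((\<lambda>(x, y). d x y) ` (K \<times> K)))"
    have bd: "d x y \<le> 2 + D" for x y
    proof -
      obtain x' y' where *: "x' \<in> K" "d x' x < 1" "y' \<in> K" "d y' y < 1"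
        using K(2) by (auto simp: d.in_mball subset_eq) meson
      have "d x' y' \<le> D" unfolding D_def using * K(1) by (intro Max_ge) auto
      then show ?thesis
        using d.triangle[of x x' y] d.triangle[of x' y' y] d.commute[of x x'] * by auto
    qed
    define \<rho> where "\<rho> x y = d (Some x) (Some y)" for x y :: 'a
    show ?thesis
    proof (rule hausdorff_borel[of \<rho>])
      show "Metric_space UNIV \<rho>"
        by unfold_locales (auto simp: \<rho>_def d.commute d.triangle)
      show "open U \<longleftrightarrow> (\<forall>x\<in>U. \<exists>r>0. \<forall>y. \<rho> x y < r \<longrightarrow> y \<in> U)" for U
      proof
        assume "open U"
        then have "openin d.mtopology (Some ` U)" unfolding m(2) by simp
        then show "\<forall>x\<in>U. \<exists>r>0. \<forall>y. \<rho> x y < r \<longrightarrow> y \<in> U"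
        proof (intro ballI)
          fix x assume "x \<in> U"
          then obtain r where "0 < r" "d.mball (Some x) r \<subseteq> Some ` U"
            using \<open>openin d.mtopology (Some ` U)\<close> unfolding d.openin_mtopology by blast
          then show "\<exists>r>0. \<forall>y. \<rho> x y < r \<longrightarrow> y \<in> U"
            by (intro exI[of _ r]) (auto simp: d.mball_def \<rho>_def)
        qed
      next
        assume U: "\<forall>x\<in>U. \<exists>r>0. \<forall>y. \<rho> x y < r \<longrightarrow> y \<in> U"
        show "open U"
          unfolding open_subopen[of U]
        proof
          fix x assume "x \<in> U"
          then obtain r where r: "0 < r" "\<forall>y. \<rho> x y < r \<longrightarrow> y \<in> U" using U by blast
          have "openin d.mtopology (d.mball (Some x) r)" by simp
          then have "openin euclidean {y \<in> topspace euclidean. Some y \<in> d.mball (Some x) r}"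
            unfolding m(2) by (intro openin_continuous_map_preimage[OF continuous_map_Some])
          then have "open {y. \<rho> x y < r}" by (simp add: d.in_mball \<rho>_def)
          then show "\<exists>T. open T \<and> x \<in> T \<and> T \<subseteq> U"
            using r by (intro exI[of _ "{y. \<rho> x y < r}"]) (auto simp: \<rho>_def)
        qed
      qed
      show "\<exists>F. finite F \<and> (\<forall>x. \<exists>y\<in>F. \<rho> x y < e)" if e: "0 < e" for e
      proof -
        obtain K where K: "finite K" "UNIV \<subseteq> (\<Union>x\<in>K. d.mball x (e/2))" using tbd[of "e/2"] e by auto
        define F where "F = (\<lambda>c. SOME y. d c (Some y) < e/2) ` K"
        have "\<exists>y\<in>F. \<rho> x y < e" for x
        proof -
          obtain c where c: "c \<in> K" "d c (Some x) < e/2" using K(2) by (auto simp: d.in_mball subset_eq)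
          define y where "y = (SOME y. d c (Some y) < e/2)"
          have "d c (Some y) < e/2" unfolding y_def by (rule someI[of _ x]) (rule c(2))
          then have "\<rho> x y < e"
            unfolding \<rho>_def using c d.triangle[of "Some x" c "Some y"] d.commute[of "Some x" c] by auto
          then show ?thesis using c(1) by (auto simp: F_def y_def)
        qed
        then show ?thesis using K(1) by (auto simp: F_def intro!: exI[of _ F])
      qed
      show "set_distance d A B = hausdorff_distance \<rho> A B" if "A \<in> set_states" "B \<in> set_states" for A B
      proof -
        have ne: "Some ` A \<noteq> {}" "Some ` B \<noteq> {}" using that by (auto simp: set_states_eq)
        have "set_distance d A B = hausdorff_distance d (Some ` A) (Some ` B)"
          using that hausdorff_distance_closure[OF m(1) bd ne] by (simp add: set_distance_def False m(2))
        also have "\<dots> = hausdorff_distance \<rho> A B"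
          by (simp add: hausdorff_distance_def \<rho>_def image_comp comp_def)
        finally show ?thesis .
      qed
    qed (auto simp: set_distance_def)
  qed
  moreover have "sets (set_borel d) \<subseteq> sigma_sets set_states {U. openin (Metric_space.mtopology set_states (set_distance d)) U}"
    by (auto simp: set_borel_def sets_measure_of_conv sigma_sets.Empty sigma_sets_top split: if_splits)
  ultimately show "sets (set_borel d) \<subseteq> sets hit_algebra" "space (set_borel d) = set_states"
    by (auto simp: set_borel_def space_measure_of_conv)
qed

section \<open>First meeting times\<close>

definition right_cont :: "(real \<Rightarrow> 'a::topological_space) \<Rightarrow> bool" where
  "right_cont f \<longleftrightarrow> (\<forall>t\<ge>0. (f \<longlongrightarrow> f t) (at_right t))"

lemma cadlag_right_cont: "cadlag f \<Longrightarrow> right_cont f"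
  by (simp add: cadlag_def right_cont_def)

definition first_time :: "(real \<Rightarrow> bool) \<Rightarrow> ereal" where
  "first_time P = Inf {ereal t | t. 0 \<le> t \<and> P t}"

text \<open>
  Closedness under limits from the right, stated for the complement. It is what makes the infimum in
  \<open>first_time\<close> attained, and coincidence of right-continuous paths has it.
\<close>

definition right_closed :: "(real \<Rightarrow> bool) \<Rightarrow> bool" where
  "right_closed P \<longleftrightarrow> (\<forall>t\<ge>0. \<not> P t \<longrightarrow> eventually (\<lambda>u. \<not> P u) (at_right t))"

lemma right_closed_eq:
  fixes a z :: "real \<Rightarrow> 'a::metric_space"
  assumes "right_cont a" "right_cont z"
  shows "right_closed (\<lambda>t. a t = z t)"
  unfolding right_closed_def
proof (intro allI impI)
  fix t :: real assume t: "0 \<le> t" "a t \<noteq> z t"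
  have "((\<lambda>u. dist (a u) (z u)) \<longlongrightarrow> dist (a t) (z t)) (at_right t)"
    using assms t(1) by (intro tendsto_dist) (auto simp: right_cont_def)
  then have "eventually (\<lambda>u. dist (a u) (z u) > 0) (at_right t)"
    using t(2) by (intro order_tendstoD(1)) auto
  then show "eventually (\<lambda>u. a u \<noteq> z u) (at_right t)"
    by eventually_elim auto
qed

lemma right_closed_disj:
  "right_closed P \<Longrightarrow> right_closed Q \<Longrightarrow> right_closed (\<lambda>t. P t \<or> Q t)"
  by (auto simp: right_closed_def eventually_conj_iff)

lemma right_closed_Bex:
  "finite A \<Longrightarrow> (\<And>z. z \<in> A \<Longrightarrow> right_closed (P z)) \<Longrightarrow> right_closed (\<lambda>t. \<exists>z\<in>A. P z t)"
  by (auto simp: right_closed_def intro!: eventually_ball_finite)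

lemma first_time_nonneg: "0 \<le> first_time P"
  unfolding first_time_def by (rule Inf_greatest) auto

lemma first_time_infinity: "(\<And>t. 0 \<le> t \<Longrightarrow> \<not> P t) \<Longrightarrow> first_time P = \<infinity>"
proof -
  assume "\<And>t. 0 \<le> t \<Longrightarrow> \<not> P t"
  then have "{ereal t | t. 0 \<le> t \<and> P t} = {}" by auto
  then show ?thesis unfolding first_time_def by (simp only: Inf_empty top_ereal_def)
qed

lemma first_time_attained:
  assumes P: "right_closed P" and t: "0 \<le> t" "P t"
  obtains s where "first_time P = ereal s" "0 \<le> s" "s \<le> t" "P s" "\<And>u. 0 \<le> u \<Longrightarrow> u < s \<Longrightarrow> \<not> P u"
proof -
  define S where "S = {t. 0 \<le> t \<and> P t}"
  have bd: "bdd_below S" by (auto simp: S_def intro!: bdd_belowI[of _ 0])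
  have ne: "t \<in> S" using t by (simp add: S_def)
  define s where "s = Inf S"
  have s0: "0 \<le> s" unfolding s_def using ne by (intro cInf_greatest) (auto simp: S_def)
  have low: "\<not> P u" if "0 \<le> u" "u < s" for u
    using cInf_lower[of u S] bd that by (auto simp: S_def s_def)
  have "P s"
  proof (rule ccontr)
    assume n: "\<not> P s"
    then have "eventually (\<lambda>u. \<not> P u) (at_right s)"
      using P s0 by (auto simp: right_closed_def)
    then obtain b where b: "s < b" "\<And>u. s < u \<Longrightarrow> u < b \<Longrightarrow> \<not> P u"
      by (auto simp: eventually_at_right_field)
    have "b \<le> s"
      unfolding s_def
    proof (rule cInf_greatest)
      show "S \<noteq> {}" using ne by auto
    next
      fix u assume u: "u \<in> S"
      then have "s \<le> u" unfolding s_def using bd by (intro cInf_lower)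
      moreover have "u \<noteq> s" "P u" using u n by (auto simp: S_def)
      ultimately show "b \<le> u" using b(2)[of u] by force
    qed
    then show False using b(1) by simp
  qed
  moreover have "first_time P = ereal s"
    unfolding first_time_def
  proof (rule antisym)
    show "Inf {ereal t | t. 0 \<le> t \<and> P t} \<le> ereal s"
      using \<open>P s\<close> s0 by (intro Inf_lower) auto
    show "ereal s \<le> Inf {ereal t | t. 0 \<le> t \<and> P t}"
      by (intro Inf_greatest) (auto, metis low not_less)
  qed
  moreover have "s \<le> t" unfolding s_def using ne bd by (intro cInf_lower)
  ultimately show thesis using that s0 low by blast
qed

lemma first_meeting:
  assumes P: "right_closed P" and t: "0 \<le> t" "P t"
  obtains s where "0 \<le> s" "s \<le> t" "P s" "\<And>u. 0 \<le> u \<Longrightarrow> u < s \<Longrightarrow> \<not> P u"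
  using first_time_attained[OF P t] by metis

lemma first_time_le_iff:
  assumes "right_closed P"
  shows "first_time P \<le> ereal t \<longleftrightarrow> (\<exists>s\<in>{0..t}. P s)"
proof
  assume le: "first_time P \<le> ereal t"
  have "\<exists>s\<ge>0. P s"
    using first_time_infinity[of P] le by fastforce
  then obtain s where s: "0 \<le> s" "P s" by blast
  from first_time_attained[OF assms s] le show "\<exists>s\<in>{0..t}. P s"
    by (metis atLeastAtMost_iff ereal_less_eq(3))
next
  assume "\<exists>s\<in>{0..t}. P s"
  then show "first_time P \<le> ereal t"
    unfolding first_time_def by (auto intro!: Inf_lower2)
qed

lemma first_time_eqD:
  assumes "right_closed P" "first_time P = ereal s"
  shows "0 \<le> s" "P s" "\<And>u. 0 \<le> u \<Longrightarrow> u < s \<Longrightarrow> \<not> P u"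
proof -
  have "\<exists>s\<ge>0. P s"
    using first_time_infinity[of P] assms(2) by force
  then obtain r where r: "0 \<le> r" "P r" by blast
  obtain s' where "first_time P = ereal s'" "0 \<le> s'" "s' \<le> r" "P s'"
      "\<And>u. 0 \<le> u \<Longrightarrow> u < s' \<Longrightarrow> \<not> P u"
    using first_time_attained[OF assms(1) r] by blast
  then show "0 \<le> s" "P s" "\<And>u. 0 \<le> u \<Longrightarrow> u < s \<Longrightarrow> \<not> P u"
    using assms(2) by auto
qed

definition meets :: "(real \<Rightarrow> 'a) set \<Rightarrow> (real \<Rightarrow> 'a) \<Rightarrow> real \<Rightarrow> bool" where
  "meets Z a t \<longleftrightarrow> (\<exists>z\<in>Z. a t = z t)"

lemma right_closed_meets:
  fixes a :: "real \<Rightarrow> 'a::metric_space"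
  assumes "finite Z" "\<And>z. z \<in> Z \<Longrightarrow> right_cont z" "right_cont a"
  shows "right_closed (meets Z a)"
  unfolding meets_def[abs_def] using assms by (intro right_closed_Bex right_closed_eq) auto

text \<open>
  The path \<open>b\<close> arises from \<open>a\<close> by joining the set \<open>Z\<close> of paths at the first
  meeting. As a relation this leaves open which of several elements of \<open>Z\<close> that are met at the same
  time is followed, so that the smallest-index rule of the recursion need not be tracked.
\<close>

definition joined :: "(real \<Rightarrow> 'a) set \<Rightarrow> (real \<Rightarrow> 'a) \<Rightarrow> (real \<Rightarrow> 'a) \<Rightarrow> bool" where
  "joined Z a b \<longleftrightarrow>
     (\<forall>t\<ge>0. (\<forall>s\<in>{0..t}. \<not> meets Z a s) \<longrightarrow> b t = a t) \<and>
     (\<forall>s\<ge>0. meets Z a s \<and> (\<forall>u\<in>{0..<s}. \<not> meets Z a u) \<longrightarrow>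
        (\<exists>z\<in>Z. z s = a s \<and> (\<forall>t\<ge>s. b t = z t)))"

text \<open>
  This property makes the choice left open in \<open>joined\<close> immaterial (\<open>joined_unique\<close>), and
  it is inherited when the joined path is added to \<open>Z\<close> (\<open>joined_coalescent\<close>).
\<close>

definition coalescent :: "(real \<Rightarrow> 'a) set \<Rightarrow> bool" where
  "coalescent Z \<longleftrightarrow> (\<forall>z\<in>Z. \<forall>z'\<in>Z. \<forall>s\<ge>0. z s = z' s \<longrightarrow> (\<forall>t\<ge>s. z t = z' t))"

lemma coalescentD:
  "coalescent Z \<Longrightarrow> z \<in> Z \<Longrightarrow> z' \<in> Z \<Longrightarrow> 0 \<le> s \<Longrightarrow> z s = z' s \<Longrightarrow> s \<le> t \<Longrightarrow> z t = z' t"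
  unfolding coalescent_def by blast

lemma joinedD1: "joined Z a b \<Longrightarrow> 0 \<le> t \<Longrightarrow> (\<And>s. 0 \<le> s \<Longrightarrow> s \<le> t \<Longrightarrow> \<not> meets Z a s) \<Longrightarrow> b t = a t"
  by (auto simp: joined_def)

lemma joinedD2:
  assumes "joined Z a b" "0 \<le> s" "meets Z a s" "\<And>u. 0 \<le> u \<Longrightarrow> u < s \<Longrightarrow> \<not> meets Z a u"
  obtains z where "z \<in> Z" "z s = a s" "\<And>t. s \<le> t \<Longrightarrow> b t = z t"
  using assms by (auto simp: joined_def)

lemma joinedI:
  assumes "\<And>t. 0 \<le> t \<Longrightarrow> (\<And>s. 0 \<le> s \<Longrightarrow> s \<le> t \<Longrightarrow> \<not> meets Z a s) \<Longrightarrow> b t = a t"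
    and "\<And>s. 0 \<le> s \<Longrightarrow> meets Z a s \<Longrightarrow> (\<And>u. 0 \<le> u \<Longrightarrow> u < s \<Longrightarrow> \<not> meets Z a u) \<Longrightarrow>
        \<exists>z\<in>Z. z s = a s \<and> (\<forall>t\<ge>s. b t = z t)"
  shows "joined Z a b"
  unfolding joined_def using assms by auto

lemma first_meeting_cases [consumes 2, case_names none first]:
  assumes "right_closed P" "0 \<le> t"
  obtains (none) "\<And>s. 0 \<le> s \<Longrightarrow> s \<le> t \<Longrightarrow> \<not> P s"
  | (first) s where "0 \<le> s" "s \<le> t" "P s" "\<And>u. 0 \<le> u \<Longrightarrow> u < s \<Longrightarrow> \<not> P u"
proof (cases "\<exists>s\<in>{0..t}. P s")
  case True
  then obtain r where r: "0 \<le> r" "r \<le> t" "P r" by auto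
  obtain s where "0 \<le> s" "s \<le> r" "P s" "\<And>u. 0 \<le> u \<Longrightarrow> u < s \<Longrightarrow> \<not> P u"
    using first_meeting[OF assms(1) r(1,3)] by metis
  then show thesis using first[of s] r by auto
next
  case False
  then show thesis using none by auto
qed

lemma joined_after:
  assumes "joined Z a b" "coalescent Z" "0 \<le> s" "z \<in> Z" "z s = a s"
    "\<And>u. 0 \<le> u \<Longrightarrow> u < s \<Longrightarrow> \<not> meets Z a u" "s \<le> t"
  shows "b t = z t"
proof -
  have "meets Z a s" using assms(4,5) unfolding meets_def by metis
  from joinedD2[OF assms(1,3) this assms(6)] obtain z' where
    z': "z' \<in> Z" "z' s = a s" "\<And>t. s \<le> t \<Longrightarrow> b t = z' t" by blast
  then show ?thesis
    using coalescentD[OF assms(2) z'(1) assms(4,3), of t] assms(5,7) by auto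
qed

lemma joined_unique:
  assumes "joined Z a b" "joined Z a b'" "coalescent Z" "right_closed (meets Z a)" "0 \<le> t"
  shows "b t = b' t"
using assms(4,5)
proof (cases rule: first_meeting_cases)
  case none
  then show ?thesis using joinedD1[OF assms(1,5)] joinedD1[OF assms(2,5)] by auto
next
  case (first s)
  then obtain z where "z \<in> Z" "z s = a s" by (auto simp: meets_def)
  then show ?thesis
    using joined_after[OF assms(1,3) first(1) _ _ first(4) first(2)]
      joined_after[OF assms(2,3) first(1) _ _ first(4) first(2)] by auto
qed

text \<open>
  If \<open>b\<close> equals some \<open>z \<in> Z\<close> at time \<open>s\<close>, then \<open>a\<close> has
  met \<open>Z\<close> by then: otherwise \<open>b s = a s\<close>, which would be a meeting. After that
  \<open>b\<close> agrees with an element of \<open>Z\<close>, to which the assumption applies.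
\<close>

lemma joined_coalescent:
  assumes j: "joined Z a b" and c: "coalescent Z" and r: "right_closed (meets Z a)"
  shows "coalescent (insert b Z)"
proof -
  have *: "b t = z t" if z: "z \<in> Z" "0 \<le> s" "b s = z s" "s \<le> t" for z s t
  using r z(2)
  proof (cases rule: first_meeting_cases)
    case none
    then have "b s = a s" using joinedD1[OF j z(2)] by auto
    then show ?thesis using none[of s] z by (auto simp: meets_def)
  next
    case (first s0)
    then obtain z0 where z0: "z0 \<in> Z" "z0 s0 = a s0" by (auto simp: meets_def)
    note b = joined_after[OF j c first(1) z0 first(4)]
    show ?thesis
      using b[of s] b[of t] coalescentD[OF c z0(1) z(1,2) _ z(4)] z first(2) by auto
  qed
  show ?thesis
    unfolding coalescent_def
  proof (intro ballI allI impI)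
    fix z z' s t assume h: "z \<in> insert b Z" "z' \<in> insert b Z" "0 \<le> s" "z s = z' s" "s \<le> (t::real)"
    then consider "z = b" "z' = b" | "z = b" "z' \<in> Z" | "z \<in> Z" "z' = b" | "z \<in> Z" "z' \<in> Z"
      by blast
    then show "z t = z' t"
    proof cases
      case 2
      then show ?thesis using *[of z' s t] h by simp
    next
      case 3
      then show ?thesis using *[of z s t] h by simp
    next
      case 4
      then show ?thesis using coalescentD[OF c 4 h(3-5)] by simp
    qed simp
  qed
qed

lemma tendsto_at_right_cong:
  assumes "\<And>u::real. t < u \<Longrightarrow> u < r \<Longrightarrow> f u = g u" "t < r"
  shows "(f \<longlongrightarrow> l) (at_right t) \<longleftrightarrow> (g \<longlongrightarrow> l) (at_right t)"
  by (rule tendsto_cong) (use assms in \<open>auto simp: eventually_at_right_field\<close>)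

lemma tendsto_at_left_cong:
  assumes "\<And>u::real. r < u \<Longrightarrow> u < t \<Longrightarrow> f u = g u" "r < t"
  shows "(f \<longlongrightarrow> l) (at_left t) \<longleftrightarrow> (g \<longlongrightarrow> l) (at_left t)"
  by (rule tendsto_cong) (use assms in \<open>auto simp: eventually_at_left_field\<close>)

lemma cadlag_paste:
  assumes "cadlag f" "cadlag g"
    and "\<And>t. 0 \<le> t \<Longrightarrow> ereal t < T \<Longrightarrow> h t = f t" "\<And>t. 0 \<le> t \<Longrightarrow> T \<le> ereal t \<Longrightarrow> h t = g t"
  shows "cadlag h"
proof -
  have R: "(h \<longlongrightarrow> h t) (at_right t)" if t: "0 \<le> t" for t
  proof (cases "ereal t < T")
    case True
    then obtain r where r: "ereal t < ereal r" "ereal r < T"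
      using ereal_dense2 by blast
    have "h u = f u" if "t < u" "u < r" for u
    proof (rule assms(3))
      show "0 \<le> u" using t that by simp
      have "ereal u < ereal r" using that by simp
      also have "\<dots> < T" using r by simp
      finally show "ereal u < T" .
    qed
    then show ?thesis
      using tendsto_at_right_cong[of t r h f "h t"] r assms(1,3) t True by (auto simp: cadlag_def)
  next
    case False
    have "h u = g u" if "t < u" "u < t + 1" for u
    proof (rule assms(4))
      show "0 \<le> u" using t that by simp
      have "T \<le> ereal t" using False by simp
      also have "ereal t \<le> ereal u" using that by simp
      finally show "T \<le> ereal u" .
    qed
    then show ?thesis
      using tendsto_at_right_cong[of t "t+1" h g "h t"] assms(2,4) t False by (auto simp: cadlag_def)
  qed
  have L: "\<exists>l. (h \<longlongrightarrow> l) (at_left t)" if t: "0 < t" for t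
  proof (cases "ereal t \<le> T")
    case True
    have "h u = f u" if "0 < u" "u < t" for u
    proof (rule assms(3))
      show "0 \<le> u" using that by simp
      have "ereal u < ereal t" using that by simp
      also have "\<dots> \<le> T" using True by simp
      finally show "ereal u < T" .
    qed
    then show ?thesis
      using tendsto_at_left_cong[of 0 t h f] assms(1) t by (auto simp: cadlag_def)
  next
    case False
    then obtain r where r: "T < ereal r" "ereal r < ereal t"
      using ereal_dense2[of T "ereal t"] by (auto simp: not_le)
    have "h u = g u" if "max 0 r < u" "u < t" for u
    proof (rule assms(4))
      show "0 \<le> u" using that by simp
      have "T \<le> ereal r" using r by simp
      also have "ereal r \<le> ereal u" using that by simp
      finally show "T \<le> ereal u" .
    qed
    then show ?thesis
      using tendsto_at_left_cong[of "max 0 r" t h g] assms(2) t r by (auto simp: cadlag_def)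
  qed
  show ?thesis unfolding cadlag_def using R L by blast
qed

lemma joined_cadlag:
  assumes j: "joined Z a b" and c: "coalescent Z" and r: "right_closed (meets Z a)"
    and "cadlag a" "\<And>z. z \<in> Z \<Longrightarrow> cadlag z"
  shows "cadlag b"
proof (cases "\<exists>t\<ge>0. meets Z a t")
  case False
  then have "b t = a t" if "0 \<le> t" for t using joinedD1[OF j that] by auto
  then show ?thesis using cadlag_paste[of a a "\<infinity>" b] assms(4) by auto
next
  case True
  then obtain t where t: "0 \<le> t" "meets Z a t" by blast
  obtain s where s: "0 \<le> s" "meets Z a s" "\<And>u. 0 \<le> u \<Longrightarrow> u < s \<Longrightarrow> \<not> meets Z a u"
    using first_meeting[OF r t] by metis
  obtain z where z: "z \<in> Z" "z s = a s" "\<And>t. s \<le> t \<Longrightarrow> b t = z t"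
    using joinedD2[OF j s] by blast
  show ?thesis
  proof (rule cadlag_paste[OF assms(4) assms(5)[OF z(1)], of "ereal s"])
    show "b t = a t" if "0 \<le> t" "ereal t < ereal s" for t
      using joinedD1[OF j that(1)] s(3) that by auto
  qed (use z in auto)
qed

lemma joined_initial: "joined Z a b \<Longrightarrow> b 0 = a 0"
  unfolding joined_def by (cases "meets Z a 0") (fastforce, force)

section \<open>The coalescing recursion\<close>

lemma meeting_time_first_time:
  "meeting_time \<xi> \<zeta> i = first_time (meets (\<zeta> ` {1..<i}) (\<xi> i))"
  unfolding meeting_time_def first_time_def meets_def
  by (rule arg_cong[where f = Inf]) (auto, metis atLeastLessThan_iff One_nat_def)

lemma coalesce_before_zero: "t < 0 \<Longrightarrow> coalesce \<xi> i t = \<xi> i t"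
  using first_time_nonneg by (intro coalesce_less)
    (metis ereal_less(2) meeting_time_first_time order_less_le_trans uminus_ereal.simps(1) less_ereal.simps(1) zero_ereal_def)

lemma coalesce_joined_step:
  fixes \<xi> :: "nat \<Rightarrow> real \<Rightarrow> 'a::metric_space"
  assumes r: "right_closed (meets (coalesce \<xi> ` {1..<i}) (\<xi> i))"
  shows "joined (coalesce \<xi> ` {1..<i}) (\<xi> i) (coalesce \<xi> i)"
proof (rule joinedI)
  fix t :: real assume "0 \<le> t" "\<And>s. 0 \<le> s \<Longrightarrow> s \<le> t \<Longrightarrow> \<not> meets (coalesce \<xi> ` {1..<i}) (\<xi> i) s"
  then have "\<not> first_time (meets (coalesce \<xi> ` {1..<i}) (\<xi> i)) \<le> ereal t"
    unfolding first_time_le_iff[OF r] by auto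
  then show "coalesce \<xi> i t = \<xi> i t"
    by (intro coalesce_less) (simp add: meeting_time_first_time not_le)
next
  fix s :: real assume s: "0 \<le> s" "meets (coalesce \<xi> ` {1..<i}) (\<xi> i) s"
    "\<And>u. 0 \<le> u \<Longrightarrow> u < s \<Longrightarrow> \<not> meets (coalesce \<xi> ` {1..<i}) (\<xi> i) u"
  have eq: "meeting_time \<xi> (coalesce \<xi>) i = ereal s"
    unfolding meeting_time_first_time
    using first_time_attained[OF r s(1,2)] s by (metis linorder_cases order_less_le_trans not_less)
  let ?S = "{j \<in> {1..<i}. \<xi> i s = coalesce \<xi> j s}"
  let ?J = "meeting_index \<xi> (coalesce \<xi>) i"
  have ne: "?S \<noteq> {}" using s(2) by (auto simp: meets_def)
  have "?J = Min ?S" by (simp add: meeting_index_def eq)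
  moreover have "Min ?S \<in> ?S" using ne by (intro Min_in) auto
  ultimately have J: "?J \<in> ?S" by simp
  have "\<forall>t\<ge>s. coalesce \<xi> i t = coalesce \<xi> ?J t"
    using coalesce_ge[of \<xi> i] ne by (auto simp: eq)
  then show "\<exists>z\<in>coalesce \<xi> ` {1..<i}. z s = \<xi> i s \<and> (\<forall>t\<ge>s. coalesce \<xi> i t = z t)"
    using J by (intro bexI[of _ "coalesce \<xi> ?J"]) auto
qed

text \<open>
  The four properties support each other and are proved by a simultaneous induction: cadlag paths with smaller
  labels make the set of meeting times closed from the right, this makes the recursion an instance of
  \<open>joined\<close>, and \<open>joined\<close> passes on the cadlag property and coalescence.
\<close>

lemma
  fixes \<xi> :: "nat \<Rightarrow> real \<Rightarrow> 'a::metric_space"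
  assumes "\<And>i. i \<in> {1..n} \<Longrightarrow> cadlag (\<xi> i)"
  shows coalesce_joined: "i \<in> {1..n} \<Longrightarrow> joined (coalesce \<xi> ` {1..<i}) (\<xi> i) (coalesce \<xi> i)"
    and coalesce_cadlag: "i \<in> {1..n} \<Longrightarrow> cadlag (coalesce \<xi> i)"
    and coalesce_coalescent: "i \<le> Suc n \<Longrightarrow> coalescent (coalesce \<xi> ` {1..<i})"
    and coalesce_right_closed: "i \<in> {1..n} \<Longrightarrow> right_closed (meets (coalesce \<xi> ` {1..<i}) (\<xi> i))"
proof -
  have *: "(i \<in> {1..n} \<longrightarrow> cadlag (coalesce \<xi> i) \<and> joined (coalesce \<xi> ` {1..<i}) (\<xi> i) (coalesce \<xi> i) \<and>
       right_closed (meets (coalesce \<xi> ` {1..<i}) (\<xi> i))) \<and>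
     (i \<le> Suc n \<longrightarrow> coalescent (coalesce \<xi> ` {1..<i}))" for i
  proof (induction i rule: less_induct)
    case (less i)
    have cad: "cadlag z" if "z \<in> coalesce \<xi> ` {1..<i}" "i \<le> Suc n" for z
      using less that by auto
    have coal: "coalescent (coalesce \<xi> ` {1..<i})" if "i \<le> Suc n"
    proof (cases "i \<le> 1")
      case True
      then show ?thesis by (auto simp: coalescent_def)
    next
      case False
      then obtain k where k: "i = Suc k" "1 \<le> k" by (cases i) auto
      have "{1..<i} = insert k {1..<k}" using k by auto
      then show ?thesis using less[of k] k that by (auto intro!: joined_coalescent)
    qed
    show ?case
    proof (intro conjI impI coal)
      assume i: "i \<in> {1..n}"
      show r: "right_closed (meets (coalesce \<xi> ` {1..<i}) (\<xi> i))"
        using i assms cad by (intro right_closed_meets) (auto intro!: cadlag_right_cont)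
      show j: "joined (coalesce \<xi> ` {1..<i}) (\<xi> i) (coalesce \<xi> i)"
        by (rule coalesce_joined_step[OF r])
      show "cadlag (coalesce \<xi> i)"
        using i by (intro joined_cadlag[OF j coal r assms[OF i]] cad) auto
    qed
  qed
  show "i \<in> {1..n} \<Longrightarrow> joined (coalesce \<xi> ` {1..<i}) (\<xi> i) (coalesce \<xi> i)"
    "i \<in> {1..n} \<Longrightarrow> cadlag (coalesce \<xi> i)"
    "i \<le> Suc n \<Longrightarrow> coalescent (coalesce \<xi> ` {1..<i})"
    "i \<in> {1..n} \<Longrightarrow> right_closed (meets (coalesce \<xi> ` {1..<i}) (\<xi> i))"
    using * by blast+
qed

lemma joined_cong:
  assumes "\<And>j t. j \<in> I \<Longrightarrow> 0 \<le> t \<Longrightarrow> \<zeta> j t = \<zeta>' j t" "\<And>t. 0 \<le> t \<Longrightarrow> a t = a' t"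
  shows "joined (\<zeta> ` I) a b \<longleftrightarrow> joined (\<zeta>' ` I) a' b"
proof -
  have m: "meets (\<zeta> ` I) a t \<longleftrightarrow> meets (\<zeta>' ` I) a' t" if "0 \<le> t" for t
    using assms that by (auto simp: meets_def)
  have e: "(\<exists>z\<in>\<zeta> ` I. z s = a s \<and> (\<forall>t\<ge>s. b t = z t)) \<longleftrightarrow> (\<exists>z\<in>\<zeta>' ` I. z s = a' s \<and> (\<forall>t\<ge>s. b t = z t))"
    if "0 \<le> s" for s
    using assms that by auto
  show ?thesis
    unfolding joined_def using m e assms(2) by simp
qed

text \<open>
  The relation \<open>joined\<close> sees only nonnegative times, and it determines the coalesced path at these.
\<close>

lemma coalesce_cong:
  fixes \<xi> \<xi>' :: "nat \<Rightarrow> real \<Rightarrow> 'a::metric_space"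
  assumes cad: "\<And>i. i \<in> {1..n} \<Longrightarrow> cadlag (\<xi> i)" and cad': "\<And>i. i \<in> {1..n} \<Longrightarrow> cadlag (\<xi>' i)"
    and eq: "\<And>i t. i \<in> {1..n} \<Longrightarrow> 0 \<le> t \<Longrightarrow> \<xi> i t = \<xi>' i t"
    and i: "i \<in> {1..n}" and t: "0 \<le> t"
  shows "coalesce \<xi> i t = coalesce \<xi>' i t"
  using i t
proof (induction i arbitrary: t rule: less_induct)
  case (less i)
  have "joined (coalesce \<xi>' ` {1..<i}) (\<xi>' i) (coalesce \<xi>' i)"
    using coalesce_joined[of n \<xi>', OF cad'] less.prems(1) by blast
  moreover have "coalesce \<xi> j t = coalesce \<xi>' j t" if "j \<in> {1..<i}" "0 \<le> t" for j t
    using less.IH[of j t] less.prems(1) that by auto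
  ultimately have "joined (coalesce \<xi> ` {1..<i}) (\<xi> i) (coalesce \<xi>' i)"
    using eq[OF less.prems(1)] by (subst joined_cong[of _ _ "coalesce \<xi>'" _ "\<xi>' i"]) auto
  then show ?case
    using joined_unique[OF coalesce_joined[of n \<xi>, OF cad less.prems(1)] _
        coalesce_coalescent[of n \<xi> i, OF cad] coalesce_right_closed[of n \<xi>, OF cad less.prems(1)] less.prems(2)]
      less.prems(1) by auto
qed

section \<open>Exchanging two paths when they meet\<close>

text \<open>
  The strict inequality excludes the case that \<open>a\<close> and \<open>b\<close> meet each other at a point of
  \<open>Z\<close>: then both follow \<open>Z\<close> and no exchange is called for.
\<close>

definition swap_time :: "(real \<Rightarrow> 'a) set \<Rightarrow> (real \<Rightarrow> 'a) \<Rightarrow> (real \<Rightarrow> 'a) \<Rightarrow> ereal" where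
  "swap_time Z a b =
     (if first_time (\<lambda>t. a t = b t) < first_time (\<lambda>t. meets Z a t \<or> meets Z b t)
      then first_time (\<lambda>t. a t = b t) else \<infinity>)"

lemma swap_time_cases [consumes 4, case_names never swap]:
  fixes a b :: "real \<Rightarrow> 'a::metric_space"
  assumes r: "right_closed (meets Z a)" "right_closed (meets Z b)" "right_cont a" "right_cont b"
  obtains (never) "swap_time Z a b = \<infinity>"
      "\<And>s. 0 \<le> s \<Longrightarrow> a s = b s \<Longrightarrow> \<exists>u. 0 \<le> u \<and> u \<le> s \<and> (meets Z a u \<or> meets Z b u)"
  | (swap) T where "swap_time Z a b = ereal T" "0 \<le> T" "a T = b T"
      "\<And>u. 0 \<le> u \<Longrightarrow> u < T \<Longrightarrow> a u \<noteq> b u"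
      "\<And>u. 0 \<le> u \<Longrightarrow> u \<le> T \<Longrightarrow> \<not> meets Z a u" "\<And>u. 0 \<le> u \<Longrightarrow> u \<le> T \<Longrightarrow> \<not> meets Z b u"
proof -
  let ?\<rho> = "first_time (\<lambda>t. a t = b t)" and ?\<sigma> = "first_time (\<lambda>t. meets Z a t \<or> meets Z b t)"
  have r1: "right_closed (\<lambda>t. a t = b t)" using r by (intro right_closed_eq)
  have r2: "right_closed (\<lambda>t. meets Z a t \<or> meets Z b t)" using r by (intro right_closed_disj)
  show thesis
  proof (cases "?\<rho> < ?\<sigma>")
    case True
    then obtain T where T: "?\<rho> = ereal T"
      using first_time_nonneg[of "\<lambda>t. a t = b t"] by (cases ?\<rho>) auto
    have *: "\<not> (meets Z a u \<or> meets Z b u)" if "0 \<le> u" "u \<le> T" for u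
    proof
      assume "meets Z a u \<or> meets Z b u"
      then have "?\<sigma> \<le> ereal u" unfolding first_time_le_iff[OF r2] using that by force
      then show False using True T that by (auto simp: order.strict_iff_not intro: order.trans)
    qed
    show thesis
      using swap[of T] first_time_eqD[OF r1 T] T True * by (auto simp: swap_time_def)
  next
    case False
    have "\<exists>u. 0 \<le> u \<and> u \<le> s \<and> (meets Z a u \<or> meets Z b u)" if s: "0 \<le> s" "a s = b s" for s
    proof -
      have "?\<rho> \<le> ereal s" unfolding first_time_le_iff[OF r1] using s by force
      then have "?\<sigma> \<le> ereal s" using False by (auto simp: not_less)
      then show ?thesis unfolding first_time_le_iff[OF r2] by auto
    qed
    then show thesis using False never by (auto simp: swap_time_def)
  qed
qed

text \<open>
  Let \<open>a'\<close> and \<open>b'\<close> result from coalescing first \<open>a\<close> and then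
  \<open>b\<close> into \<open>Z\<close>. The lemma states that the same two paths result in the opposite order
  from the paths exchanged at the swap time. If there is no swap, then whenever \<open>a\<close> and
  \<open>b\<close> meet, one of them has already met \<open>Z\<close> or does so now; both are then in effect
  joined to \<open>Z\<close> alone, in either order. If they swap at \<open>T\<close>, then
  \<open>a' = b'\<close> follows the original path \<open>a\<close> from \<open>T\<close> until it meets
  \<open>Z\<close>, and this piece of \<open>a\<close> now belongs to \<open>b2\<close>, which goes first.
\<close>

lemma swap_joined:
  fixes a b :: "real \<Rightarrow> 'a::metric_space"
  assumes Z: "coalescent Z" "finite Z" "\<And>z. z \<in> Z \<Longrightarrow> cadlag z" and ab: "cadlag a" "cadlag b"
    and ja: "joined Z a a'" and jb: "joined (insert a' Z) b b'"
    and a2: "\<And>t. 0 \<le> t \<Longrightarrow> a2 t = (if ereal t < swap_time Z a b then a t else b t)"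
    and b2: "\<And>t. 0 \<le> t \<Longrightarrow> b2 t = (if ereal t < swap_time Z a b then b t else a t)"
  shows "joined Z b2 b'" "joined (insert b' Z) a2 a'"
proof -
  have rc: "right_closed (meets Z a)" "right_closed (meets Z b)"
    using Z ab by (auto intro!: right_closed_meets cadlag_right_cont)
  have ca': "coalescent (insert a' Z)" by (rule joined_coalescent[OF ja Z(1) rc(1)])
  have cada': "cadlag a'" by (rule joined_cadlag[OF ja Z(1) rc(1) ab(1) Z(3)])
  have rc2: "right_closed (meets (insert a' Z) b)"
    using Z ab cada' by (intro right_closed_meets) (auto intro!: cadlag_right_cont)
  have cb': "coalescent (insert b' (insert a' Z))" by (rule joined_coalescent[OF jb ca' rc2])
  have meets_ins: "meets (insert c Z) e t \<longleftrightarrow> e t = c t \<or> meets Z e t" for c e :: "real \<Rightarrow> 'a" and t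
    by (auto simp: meets_def)
  have a'_a: "a' t = a t" if "0 \<le> t" "\<And>s. 0 \<le> s \<Longrightarrow> s \<le> t \<Longrightarrow> \<not> meets Z a s" for t
    by (rule joinedD1[OF ja that])
  \<comment> \<open>Once \<open>a\<close> has met \<open>Z\<close>, the path \<open>a'\<close> runs inside \<open>Z\<close>.\<close>
  have a'_meets: "meets Z e s" if m: "0 \<le> u" "u \<le> s" "meets Z a u" "e s = a' s" for e u s
  proof -
    obtain s0 where s0: "0 \<le> s0" "s0 \<le> u" "meets Z a s0" "\<And>v. 0 \<le> v \<Longrightarrow> v < s0 \<Longrightarrow> \<not> meets Z a v"
      using first_meeting[OF rc(1) m(1,3)] by metis
    then obtain z where "z \<in> Z" "\<And>t. s0 \<le> t \<Longrightarrow> a' t = z t"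
      using joinedD2[OF ja s0(1,3,4)] by blast
    then show ?thesis using s0 m by (auto simp: meets_def)
  qed
  have main: "joined Z b2 b' \<and> joined (insert b' Z) a2 a'"
  using rc cadlag_right_cont[OF ab(1)] cadlag_right_cont[OF ab(2)]
  proof (cases rule: swap_time_cases)
    case never
    then have a2a: "a2 t = a t" and b2b: "b2 t = b t" if "0 \<le> t" for t
      using a2[OF that] b2[OF that] by auto
    \<comment> \<open>\<open>b\<close> cannot meet \<open>a'\<close> before it meets \<open>Z\<close>: if \<open>a\<close>
      has already met \<open>Z\<close>, this is a meeting with \<open>Z\<close>, and otherwise it is a
      meeting with \<open>a\<close>, which would be the swap time.\<close>
    have key: False if "0 \<le> s" "b s = a' s" "\<And>u. 0 \<le> u \<Longrightarrow> u \<le> s \<Longrightarrow> \<not> meets Z b u" for s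
    proof (cases "\<exists>u. 0 \<le> u \<and> u \<le> s \<and> meets Z a u")
      case True
      then show False using a'_meets[of _ s b] that by auto
    next
      case False
      then have "a' s = a s" using a'_a[OF that(1)] by auto
      then show False using never(2)[OF that(1)] that False by auto
    qed
    have "joined Z b b'"
    proof (rule joinedI)
      fix t :: real assume t: "0 \<le> t" and n: "\<And>s. 0 \<le> s \<Longrightarrow> s \<le> t \<Longrightarrow> \<not> meets Z b s"
      show "b' t = b t"
      proof (rule joinedD1[OF jb t])
        fix s assume "0 \<le> s" "s \<le> t"
        then show "\<not> meets (insert a' Z) b s"
          using key[of s] n by (auto simp: meets_ins)
      qed
    next
      fix s :: real assume s: "0 \<le> s" "meets Z b s" and n: "\<And>u. 0 \<le> u \<Longrightarrow> u < s \<Longrightarrow> \<not> meets Z b u"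
      have n2: "\<not> meets (insert a' Z) b u" if "0 \<le> u" "u < s" for u
        using key[of u] n that by (auto simp: meets_ins)
      obtain z where z: "z \<in> Z" "z s = b s" using s by (auto simp: meets_def)
      have zi: "z \<in> insert a' Z" using z(1) by simp
      have "\<forall>t\<ge>s. b' t = z t"
        using joined_after[OF jb ca' s(1) zi z(2)] n2 by blast
      then show "\<exists>z\<in>Z. z s = b s \<and> (\<forall>t\<ge>s. b' t = z t)" using z by auto
    qed
    moreover have "joined (insert b' Z) a a'"
    proof (rule joinedI)
      fix t :: real assume t: "0 \<le> t" and n: "\<And>s. 0 \<le> s \<Longrightarrow> s \<le> t \<Longrightarrow> \<not> meets (insert b' Z) a s"
      show "a' t = a t"
        by (rule joinedD1[OF ja t]) (use n in \<open>auto simp: meets_ins\<close>)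
    next
      fix s :: real assume s: "0 \<le> s" "meets (insert b' Z) a s"
        and n: "\<And>u. 0 \<le> u \<Longrightarrow> u < s \<Longrightarrow> \<not> meets (insert b' Z) a u"
      have nZ: "\<not> meets Z a u" if "0 \<le> u" "u < s" for u using n[OF that] by (auto simp: meets_ins)
      show "\<exists>z\<in>insert b' Z. z s = a s \<and> (\<forall>t\<ge>s. a' t = z t)"
      proof (cases "meets Z a s")
        case True
        from joinedD2[OF ja s(1) this nZ] show ?thesis by (metis insertI2)
      next
        case False
        then have eq: "b' s = a s" using s by (auto simp: meets_ins)
        have "a' s = a s"
          using False nZ by (intro a'_a s) (metis less_eq_real_def)
        then have "\<forall>t\<ge>s. a' t = b' t"
          using coalescentD[OF cb', of a' b' s] s eq by auto
        then show ?thesis using eq by auto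
      qed
    qed
    ultimately show ?thesis
      using a2a b2b by (simp add: joined_def meets_def)
  next
    case (swap T)
    have a2a: "a2 t = a t" and b2b: "b2 t = b t" if "0 \<le> t" "t < T" for t
      using a2 b2 swap(1) that by auto
    have a2b: "a2 t = b t" and b2a: "b2 t = a t" if "T \<le> t" for t
      using a2 b2 swap(1,2) that by auto
    have a'a: "a' t = a t" if "0 \<le> t" "t \<le> T" for t
      using swap(5) that by (intro a'_a) auto
    have nb: "\<not> meets (insert a' Z) b u" if "0 \<le> u" "u < T" for u
      using swap(4)[of u] swap(6)[of u] a'a[of u] that by (auto simp: meets_ins)
    have b'b: "b' t = b t" if "0 \<le> t" "t < T" for t
      using joinedD1[OF jb that(1)] nb that by auto
    have b'a': "b' t = a' t" if "T \<le> t" for t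
    proof -
      have i: "a' \<in> insert a' Z" "a' T = b T" using a'a[of T] swap(2,3) by auto
      show ?thesis using joined_after[OF jb ca' swap(2) i] nb that by blast
    qed
    have nb2: "\<not> meets Z b2 u" if "0 \<le> u" "u \<le> T" for u
      using swap(5,6)[OF that] b2b[of u] b2a[of u] that by (cases "u < T") (auto simp: meets_def)
    have b2_meets: "meets Z b2 u \<longleftrightarrow> meets Z a u" if "0 \<le> u" for u
      using nb2[of u] swap(5)[of u] b2a[of u] that by (cases "u \<le> T") (auto simp: meets_def)
    have "joined Z b2 b'"
    proof (rule joinedI)
      fix t :: real assume t: "0 \<le> t" and n: "\<And>s. 0 \<le> s \<Longrightarrow> s \<le> t \<Longrightarrow> \<not> meets Z b2 s"
      show "b' t = b2 t"
      proof (cases "t < T")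
        case True then show ?thesis using b'b b2b t by auto
      next
        case False
        then show ?thesis using b'a'[of t] b2a[of t] a'_a[OF t] n b2_meets by auto
      qed
    next
      fix s :: real assume s: "0 \<le> s" "meets Z b2 s" and n: "\<And>u. 0 \<le> u \<Longrightarrow> u < s \<Longrightarrow> \<not> meets Z b2 u"
      have Ts: "T < s" using nb2[of s] s by (cases "T < s") auto
      have "meets Z a s" using s b2_meets by auto
      moreover have "\<And>u. 0 \<le> u \<Longrightarrow> u < s \<Longrightarrow> \<not> meets Z a u" using n b2_meets by auto
      ultimately obtain z where "z \<in> Z" "z s = a s" "\<And>t. s \<le> t \<Longrightarrow> a' t = z t"
        using joinedD2[OF ja s(1)] by blast
      then show "\<exists>z\<in>Z. z s = b2 s \<and> (\<forall>t\<ge>s. b' t = z t)"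
        using b2a b'a' Ts by (intro bexI[of _ z]) auto
    qed
    moreover have "joined (insert b' Z) a2 a'"
    proof -
      have nn: "\<not> meets (insert b' Z) a2 u" if "0 \<le> u" "u < T" for u
        using a2a[OF that] b'b[OF that] swap(4)[OF that] swap(5)[of u] that
        by (auto simp: meets_def)
      have mT: "a2 T = b' T" using a2b[of T] b'a'[of T] a'a[of T] swap(2,3) by auto
      show ?thesis
      proof (rule joinedI)
        fix t :: real assume t: "0 \<le> t" and n: "\<And>s. 0 \<le> s \<Longrightarrow> s \<le> t \<Longrightarrow> \<not> meets (insert b' Z) a2 s"
        have "t < T"
        proof (rule ccontr)
          assume "\<not> t < T"
          then have "\<not> meets (insert b' Z) a2 T" using n[of T] swap(2) by simp
          then show False using mT by (simp add: meets_def)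
        qed
        then show "a' t = a2 t" using a2a a'a t by auto
      next
        fix s :: real assume s: "0 \<le> s" "meets (insert b' Z) a2 s"
          and n: "\<And>u. 0 \<le> u \<Longrightarrow> u < s \<Longrightarrow> \<not> meets (insert b' Z) a2 u"
        have "s = T"
          using nn[of s] n[of T] s swap(2) mT by (cases s T rule: linorder_cases) (auto simp: meets_def)
        then show "\<exists>z\<in>insert b' Z. z s = a2 s \<and> (\<forall>t\<ge>s. a' t = z t)"
          using mT b'a' by (intro bexI[of _ b']) auto
      qed
    qed
    ultimately show ?thesis by blast
  qed
  then show "joined Z b2 b'" "joined (insert b' Z) a2 a'" by auto
qed

text \<open>
  Labels below \<open>k\<close> are not affected by the exchange, \<open>swap_joined\<close> treats
  \<open>k\<close> and \<open>Suc k\<close>, and a path with a later label joins the same set of paths as before.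
  The hypothesis \<open>neg\<close> covers negative times, at which the recursion returns the original paths.
\<close>

lemma coalesce_swap:
  fixes \<omega> :: "nat \<Rightarrow> real \<Rightarrow> 'a::metric_space"
  assumes cad: "\<And>i. i \<in> {1..n} \<Longrightarrow> cadlag (\<omega> i)" and k: "1 \<le> k" "Suc k \<le> n"
    and T: "T = swap_time (coalesce \<omega> ` {1..<k}) (\<omega> k) (\<omega> (Suc k))"
    and \<pi>: "\<pi> = Transposition.transpose k (Suc k)"
    and cad': "\<And>i. i \<in> {1..n} \<Longrightarrow> cadlag (\<eta> i)"
    and \<eta>: "\<And>i t. i \<in> {1..n} \<Longrightarrow> 0 \<le> t \<Longrightarrow>
          \<eta> i t = (if ereal t < T then \<omega> (\<pi> i) t else \<omega> i t)"
    and neg: "\<And>i t. i \<in> {1..n} \<Longrightarrow> t < 0 \<Longrightarrow> \<omega> i t = c t \<and> \<eta> i t = c t"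
    and i: "i \<in> {1..n}"
  shows "coalesce \<eta> i = coalesce \<omega> (\<pi> i)"
  using i
proof (induction i rule: less_induct)
  case (less i)
  let ?\<zeta> = "coalesce \<omega>" and ?Z = "coalesce \<omega> ` {1..<k}"
  note J = coalesce_joined[of n \<omega>, OF cad] and C = coalesce_coalescent[of n \<omega>, OF cad]
    and D = coalesce_cadlag[of n \<omega>, OF cad]
  have IH: "coalesce \<eta> ` {1..<i} = (\<lambda>j. ?\<zeta> (\<pi> j)) ` {1..<i}"
    using less by (intro image_cong) auto
  have \<pi>i: "\<pi> i \<in> {1..n}" using less.prems k by (auto simp: \<pi> Transposition.transpose_def)
  have ins: "?\<zeta> ` {1..<Suc k} = insert (?\<zeta> k) ?Z"
  proof -
    have "{1..<Suc k} = insert k {1..<k}" using k by auto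
    then show ?thesis by simp
  qed
  have Zc: "cadlag z" if "z \<in> ?Z" for z using D k that by auto
  have sw: "joined ?Z b2 (?\<zeta> (Suc k))" "joined (insert (?\<zeta> (Suc k)) ?Z) a2 (?\<zeta> k)"
    if "\<And>t. 0 \<le> t \<Longrightarrow> a2 t = (if ereal t < T then \<omega> k t else \<omega> (Suc k) t)"
       "\<And>t. 0 \<le> t \<Longrightarrow> b2 t = (if ereal t < T then \<omega> (Suc k) t else \<omega> k t)" for a2 b2
    using swap_joined[of ?Z "\<omega> k" "\<omega> (Suc k)" "?\<zeta> k" "?\<zeta> (Suc k)" a2 b2] that Zc
      C[of k] D J[of k] J[of "Suc k"] cad[of k] cad[of "Suc k"] k ins
    unfolding T by auto
  have j2: "joined ((\<lambda>j. ?\<zeta> (\<pi> j)) ` {1..<i}) (\<eta> i) (?\<zeta> (\<pi> i))"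
  proof -
    consider "i < k" | "i = k" | "i = Suc k" | "Suc k < i" by linarith
    then show ?thesis
    proof cases
      case 1
      then have "(\<lambda>j. ?\<zeta> (\<pi> j)) ` {1..<i} = ?\<zeta> ` {1..<i}" "\<pi> i = i"
        by (auto simp: \<pi> Transposition.transpose_def intro!: image_cong)
      moreover have "joined (?\<zeta> ` {1..<i}) (\<eta> i) (?\<zeta> i)"
        using J[of i] less.prems \<eta>[of i] 1 by (simp add: joined_def meets_def \<open>\<pi> i = i\<close>)
      ultimately show ?thesis by simp
    next
      case 2
      then have e: "(\<lambda>j. ?\<zeta> (\<pi> j)) ` {1..<i} = ?Z" "\<pi> i = Suc k"
        by (auto simp: \<pi> Transposition.transpose_def intro!: image_cong)
      show ?thesis unfolding e
        by (rule sw(1)[of "\<lambda>t. if ereal t < T then \<omega> k t else \<omega> (Suc k) t"])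
          (use \<eta>[of i] less.prems e 2 in auto)
    next
      case 3
      have "{1..<i} = insert k {1..<k}" using 3 k by auto
      moreover have "(\<lambda>j. ?\<zeta> (\<pi> j)) ` {1..<k} = ?Z"
        by (auto simp: \<pi> Transposition.transpose_def intro!: image_cong)
      ultimately have e: "(\<lambda>j. ?\<zeta> (\<pi> j)) ` {1..<i} = insert (?\<zeta> (Suc k)) ?Z" "\<pi> i = k"
        using 3 by (auto simp: \<pi>)
      show ?thesis unfolding e
        by (rule sw(2)[of _ "\<lambda>t. if ereal t < T then \<omega> (Suc k) t else \<omega> k t"])
          (use \<eta>[of i] less.prems e 3 in auto)
    next
      case 4
      have "\<pi> ` {1..<i} = {1..<i}"
        unfolding \<pi> using 4 k by (intro transpose_image_eq) auto
      then have "(\<lambda>j. ?\<zeta> (\<pi> j)) ` {1..<i} = ?\<zeta> ` {1..<i}" "\<pi> i = i"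
        using 4 image_image[of ?\<zeta> \<pi> "{1..<i}"] by (auto simp: \<pi> Transposition.transpose_def)
      moreover have "joined (?\<zeta> ` {1..<i}) (\<eta> i) (?\<zeta> i)"
        using J[of i] less.prems \<eta>[of i] 4 by (simp add: joined_def meets_def \<open>\<pi> i = i\<close>)
      ultimately show ?thesis by simp
    qed
  qed
  have j1: "joined ((\<lambda>j. ?\<zeta> (\<pi> j)) ` {1..<i}) (\<eta> i) (coalesce \<eta> i)"
    using coalesce_joined[of n \<eta>, OF cad' less.prems] IH by simp
  have r1: "right_closed (meets ((\<lambda>j. ?\<zeta> (\<pi> j)) ` {1..<i}) (\<eta> i))"
    using coalesce_right_closed[of n \<eta>, OF cad' less.prems] IH by simp
  have c1: "coalescent ((\<lambda>j. ?\<zeta> (\<pi> j)) ` {1..<i})"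
    using coalesce_coalescent[of n \<eta> i, OF cad'] less.prems IH by simp
  show ?case
  proof
    fix t :: real
    show "coalesce \<eta> i t = ?\<zeta> (\<pi> i) t"
    proof (cases "0 \<le> t")
      case True
      then show ?thesis using joined_unique[OF j1 j2 c1 r1] by simp
    next
      case False
      then show ?thesis using neg[of i t] neg[of "\<pi> i" t] less.prems \<pi>i by (simp add: coalesce_before_zero)
    qed
  qed
qed

section \<open>The space of cadlag paths\<close>

definition paths :: "(real \<Rightarrow> 'a::topological_space) set" where
  "paths = {w \<in> extensional {0..}. cadlag w}"

text \<open>
  The cadlag functions are in general not a measurable subset of the product space
  \<^term>\<open>path_algebra\<close>, whose events depend on countably many times only. They are therefore taken
  as a sample space in their own right. For \<open>T = {0..s}\<close> this is the
  \<open>\<sigma>\<close>-algebra of the past at time \<open>s\<close>.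
\<close>

definition path_sigma :: "real set \<Rightarrow> (real \<Rightarrow> 'a::topological_space) measure" where
  "path_sigma T = sigma paths {{w \<in> paths. w t \<in> G} | t G. t \<in> T \<and> open G}"

lemma path_sigma_gen: "{{w \<in> paths. w t \<in> G} | t G. t \<in> T \<and> open G} \<subseteq> Pow paths"
  by auto

lemma space_path_sigma [simp]: "space (path_sigma T) = paths"
  unfolding path_sigma_def by (rule space_measure_of[OF path_sigma_gen])

lemma sets_path_sigma: "sets (path_sigma T) = sigma_sets paths {{w \<in> paths. w t \<in> G} | t G. t \<in> T \<and> open G}"
  unfolding path_sigma_def by (rule sets_measure_of[OF path_sigma_gen])

lemma measurable_path_sigma_component: "t \<in> T \<Longrightarrow> (\<lambda>w. w t) \<in> borel_measurable (path_sigma T)"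
proof (rule borel_measurableI)
  fix G :: "'a set" assume "t \<in> T" "open G"
  then have "{w \<in> paths. w t \<in> G} \<in> sets (path_sigma T)" unfolding sets_path_sigma by blast
  moreover have "(\<lambda>w. w t) -` G \<inter> space (path_sigma T) = {w \<in> paths. w t \<in> G}" by auto
  ultimately show "(\<lambda>w. w t) -` G \<inter> space (path_sigma T) \<in> sets (path_sigma T)" by simp
qed

lemma measurable_path_sigma:
  fixes f :: "'b \<Rightarrow> real \<Rightarrow> 'a::topological_space"
  assumes "f \<in> space M \<rightarrow> paths" "\<And>t. t \<in> T \<Longrightarrow> (\<lambda>\<omega>. f \<omega> t) \<in> borel_measurable M"
  shows "f \<in> M \<rightarrow>\<^sub>M path_sigma T"
  unfolding path_sigma_def
proof (rule measurable_measure_of[OF path_sigma_gen assms(1)])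
  fix y :: "(real \<Rightarrow> 'a) set" assume "y \<in> {{w \<in> paths. w t \<in> G} | t G. t \<in> T \<and> open G}"
  then obtain t G where y: "y = {w \<in> paths. w t \<in> G}" "t \<in> T" "open G" by blast
  have "f -` y \<inter> space M = (\<lambda>\<omega>. f \<omega> t) -` G \<inter> space M" using assms(1) y(1) by auto
  then show "f -` y \<inter> space M \<in> sets M" using measurable_sets[OF assms(2)[OF y(2)], of G] y(3) by simp
qed

lemma sets_path_sigma_mono: "S \<subseteq> T \<Longrightarrow> sets (path_sigma S) \<subseteq> sets (path_sigma T)"
  unfolding sets_path_sigma by (rule sigma_sets_mono) (auto intro!: sigma_sets.Basic)

text \<open>
  This relates laws on the cadlag path space to laws on the product space, where the distribution of the copies is
  prescribed.
\<close>

lemma path_sigma_trace: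
  assumes "A \<in> sets (path_sigma {0..})"
  shows "\<exists>B\<in>sets path_algebra. A = B \<inter> paths"
  using assms unfolding sets_path_sigma
proof (induction rule: sigma_sets.induct)
  case (Basic a)
  then obtain t G where *: "a = {w \<in> paths. w t \<in> G}" "t \<in> {0..}" "open G" by blast
  have "{w \<in> space path_algebra. w t \<in> G} \<in> sets path_algebra"
    using measurable_sets[OF measurable_component_singleton[OF *(2), of "\<lambda>_. borel"], of G] *(3)
    by (simp add: vimage_def Int_def conj_commute)
  moreover have "a = {w \<in> space path_algebra. w t \<in> G} \<inter> paths"
    using * by (auto simp: paths_def space_PiM PiE_def)
  ultimately show ?case by blast
next
  case (Compl a)
  then obtain B where "B \<in> sets path_algebra" "a = B \<inter> paths" by blast
  moreover then have "paths - a = (space path_algebra - B) \<inter> paths"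
    by (auto simp: paths_def space_PiM PiE_def)
  ultimately show ?case by blast
next
  case (Union a)
  then obtain B where "\<And>i. B i \<in> sets path_algebra" "\<And>i. a i = B i \<inter> paths" by metis
  then show ?case by (intro bexI[of _ "\<Union>i. B i"]) auto
qed (auto intro!: bexI[of _ "{}"])

lemma sample_path_in_paths: "cadlag (\<lambda>t. X t \<omega>) \<Longrightarrow> sample_path X \<omega> \<in> paths"
proof -
  assume c: "cadlag (\<lambda>t. X t \<omega>)"
  have "(sample_path X \<omega> \<longlongrightarrow> sample_path X \<omega> t) (at_right t)" if "0 \<le> t" for t
  proof -
    have 1: "((\<lambda>t. X t \<omega>) \<longlongrightarrow> X t \<omega>) (at_right t)" using c that by (auto simp: cadlag_def)
    have 2: "eventually (\<lambda>u. X u \<omega> = sample_path X \<omega> u) (at_right t)"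
      using that by (auto simp: eventually_at_right_field sample_path_def intro!: exI[of _ "t+1"])
    have 3: "sample_path X \<omega> t = X t \<omega>" using that by (simp add: sample_path_def)
    show ?thesis unfolding 3 by (rule iffD1[OF tendsto_cong[OF 2] 1])
  qed
  moreover have "\<exists>l. (sample_path X \<omega> \<longlongrightarrow> l) (at_left t)" if t0: "0 < t" for t
  proof -
    obtain l where 1: "((\<lambda>t. X t \<omega>) \<longlongrightarrow> l) (at_left t)" using c t0 by (auto simp: cadlag_def)
    have 2: "eventually (\<lambda>u. X u \<omega> = sample_path X \<omega> u) (at_left t)"
      using t0 by (auto simp: eventually_at_left_field sample_path_def intro!: exI[of _ 0])
    show ?thesis by (rule exI[of _ l], rule iffD1[OF tendsto_cong[OF 2] 1])
  qed
  ultimately show ?thesis by (auto simp: paths_def cadlag_def sample_path_def)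
qed

section \<open>Feller semigroups\<close>

lemma C0_continuous: "f \<in> C0 \<Longrightarrow> continuous_on UNIV f"
  by (simp add: C0_def)

lemma C0_measurable: "f \<in> C0 \<Longrightarrow> f \<in> borel_measurable borel"
  using C0_continuous borel_measurable_continuous_onI by blast

lemma C0_bounded:
  assumes "f \<in> C0"
  obtains c where "0 \<le> c" "\<And>x. \<bar>f x\<bar> \<le> c"
proof -
  obtain K where K: "compact K" "\<And>x. x \<notin> K \<Longrightarrow> \<bar>f x\<bar> < 1"
    using assms zero_less_one unfolding C0_def by blast
  have "compact (f ` K)"
    using K(1) C0_continuous[OF assms] continuous_on_subset by (intro compact_continuous_image) auto
  then obtain b where b: "\<And>x. x \<in> K \<Longrightarrow> \<bar>f x\<bar> \<le> b"
    using compact_imp_bounded bounded_iff by (metis imageI real_norm_def)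
  have "\<bar>f x\<bar> \<le> max 1 b" for x
    using K(2)[of x] b[of x] by (cases "x \<in> K") auto
  then show thesis using that[of "max 1 b"] by auto
qed

lemma C0_mult_bounded:
  assumes f: "f \<in> C0" and g: "continuous_on UNIV g" "\<And>x. \<bar>g x\<bar> \<le> c"
  shows "(\<lambda>x. f x * g x) \<in> C0"
  unfolding C0_def
proof (safe)
  show "continuous_on UNIV (\<lambda>x. f x * g x)"
    using C0_continuous[OF f] g(1) by (rule continuous_on_mult)
  fix e :: real assume e: "0 < e"
  define c' where "c' = max c 1"
  have c': "0 < c'" "\<And>x. \<bar>g x\<bar> \<le> c'" using g(2) by (auto simp: c'_def le_max_iff_disj)
  obtain K where K: "compact K" "\<And>x. x \<notin> K \<Longrightarrow> \<bar>f x\<bar> < e / c'"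
    using f divide_pos_pos[OF e c'(1)] unfolding C0_def by blast
  have "\<bar>f x * g x\<bar> < e" if "x \<notin> K" for x
  proof -
    have "\<bar>f x * g x\<bar> \<le> \<bar>f x\<bar> * c'" unfolding abs_mult using c' by (intro mult_left_mono) auto
    also have "\<dots> < e" using K(2)[OF that] c'(1) by (simp add: pos_less_divide_eq)
    finally show ?thesis .
  qed
  then show "\<exists>K. compact K \<and> (\<forall>x. x \<notin> K \<longrightarrow> \<bar>f x * g x\<bar> < e)" using K(1) by blast
qed

text \<open>
  The open set \<open>G\<close> is exhausted by open sets \<open>O' n\<close> that are contained in compact sets,
  by local compactness and second countability. The functions
  \<open>min 1 (n * infdist x (- O' n))\<close> vanish outside \<open>O' n\<close> and increase to the
  indicator of \<open>G\<close>; the case that \<open>O' n\<close> is the whole space is separate because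
  \<open>infdist\<close> to the empty set is 0.
\<close>

lemma C0_approximates_open:
  fixes G :: "'a::{metric_space, second_countable_topology} set"
  assumes lc: "locally compact (UNIV :: 'a set)" and G: "open G"
  shows "\<exists>f::nat \<Rightarrow> 'a \<Rightarrow> real. (\<forall>n. f n \<in> C0) \<and> (\<forall>n x. 0 \<le> f n x \<and> f n x \<le> 1) \<and>
           (\<forall>x. (\<lambda>n. f n x) \<longlonglongrightarrow> indicator G x)"
proof -
  obtain B :: "'a set set" where B: "countable B" "topological_basis B"
    using ex_countable_basis by blast
  define B' where "B' = insert {} {b \<in> B. compact (closure b)}"
  have "countable B'" "B' \<noteq> {}" using B(1) by (auto simp: B'_def)
  then obtain b :: "nat \<Rightarrow> 'a set" where b: "range b = B'" using range_from_nat_into by metis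
  have bo: "open (b n)" "compact (closure (b n))" for n
  proof -
    have "b n \<in> B'" using b by auto
    then show "open (b n)" "compact (closure (b n))"
      using topological_basis_open[OF B(2)] by (auto simp: B'_def)
  qed
  have cov: "\<exists>n. x \<in> b n" for x
  proof -
    obtain u v where uv: "open u" "compact v" "x \<in> u" "u \<subseteq> v"
      using lc unfolding locally_def by (metis UNIV_I open_openin openin_subtopology_self open_UNIV subtopology_UNIV)
    obtain c where c: "c \<in> B" "x \<in> c" "c \<subseteq> u" using topological_basisE[OF B(2) uv(1,3)] by blast
    have "closure c \<subseteq> v" using c uv by (intro closure_minimal compact_imp_closed) auto
    then have "compact (closure c)" using uv(2) by (metis closed_closure compact_Int_closed inf.absorb_iff2)
    then have "c \<in> B'" using c by (auto simp: B'_def)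
    then show ?thesis using b c by auto
  qed
  define O' where "O' n = G \<inter> (\<Union>i<n. b i)" for n
  have Oo: "open (O' n)" for n unfolding O'_def using G bo by auto
  have Oc: "compact (\<Union>i<n. closure (b i))" for n
    using bo by (intro compact_UN) auto
  define f where "f n x = (if O' n = UNIV then 1 else min 1 (real n * infdist x (- O' n)))" for n x
  have f0: "f n x = 0" if "x \<notin> O' n" for n x
    using that infdist_zero[of x "- O' n"] by (auto simp: f_def)
  have fr: "0 \<le> f n x \<and> f n x \<le> 1" for n x
    by (auto simp: f_def infdist_nonneg)
  have "f n \<in> C0" for n
    unfolding C0_def
  proof (safe)
    show "continuous_on UNIV (f n)"
      unfolding f_def by (cases "O' n = UNIV") (auto intro!: continuous_intros)
    fix e :: real assume e: "0 < e"
    have "\<bar>f n x\<bar> < e" if "x \<notin> (\<Union>i<n. closure (b i))" for x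
    proof -
      have "x \<notin> O' n" using that closure_subset unfolding O'_def by fastforce
      then show ?thesis using f0 e by simp
    qed
    then show "\<exists>K. compact K \<and> (\<forall>x. x \<notin> K \<longrightarrow> \<bar>f n x\<bar> < e)" using Oc by blast
  qed
  moreover have "(\<lambda>n. f n x) \<longlonglongrightarrow> indicator G x" for x
  proof (cases "x \<in> G")
    case False
    then have "f n x = 0" for n using f0[of x n] by (auto simp: O'_def)
    then show ?thesis using False by simp
  next
    case True
    obtain m where m: "x \<in> b m" using cov by blast
    have xO: "x \<in> O' n" if "m < n" for n using m True that by (auto simp: O'_def)
    have mono: "O' n \<subseteq> O' k" if "n \<le> k" for n k using that by (force simp: O'_def)
    have "\<exists>n0. \<forall>n\<ge>n0. f n x = 1"
    proof (cases "\<exists>n. O' n = UNIV")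
      case True
      then obtain n0 where "O' n0 = UNIV" by blast
      then have "O' n = UNIV" if "n0 \<le> n" for n using mono[OF that] by auto
      then show ?thesis by (auto simp: f_def)
    next
      case False
      define \<delta> where "\<delta> = infdist x (- O' (Suc m))"
      have ne: "- O' n \<noteq> {}" for n using False by auto
      have "\<delta> > 0"
        unfolding \<delta>_def using xO[of "Suc m"] Oo ne[of "Suc m"]
        by (intro infdist_pos_not_in_closed) auto
      then obtain n1 :: nat where n1: "1 < real n1 * \<delta>" using ex_less_of_nat_mult by blast
      have "f n x = 1" if n: "max n1 (Suc m) \<le> n" for n
      proof -
        have "\<delta> \<le> infdist x (- O' n)"
          unfolding \<delta>_def using mono[of "Suc m" n] n ne[of n] by (intro infdist_mono) auto
        then have "real n1 * \<delta> \<le> real n * infdist x (- O' n)"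
          using n \<open>\<delta> > 0\<close> by (intro mult_mono) auto
        then show ?thesis using n1 False by (auto simp: f_def)
      qed
      then show ?thesis by blast
    qed
    then obtain n0 where "\<And>n. n0 \<le> n \<Longrightarrow> f n x = 1" by blast
    then have "eventually (\<lambda>n. f n x = indicator G x) sequentially"
      using True by (auto simp: eventually_sequentially)
    then show ?thesis by (rule tendsto_eventually)
  qed
  ultimately show ?thesis using fr by blast
qed

locale feller =
  fixes p :: "real \<Rightarrow> 'a::{metric_space, second_countable_topology} \<Rightarrow> 'a measure"
  assumes semigroup: "feller_semigroup p"
begin

definition Pt :: "real \<Rightarrow> ('a \<Rightarrow> real) \<Rightarrow> 'a \<Rightarrow> real" where
  "Pt t f x = (\<integral>y. f y \<partial>p t x)"

lemma kernel: "0 \<le> t \<Longrightarrow> p t \<in> borel \<rightarrow>\<^sub>M prob_algebra borel"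
  using semigroup by (auto simp: feller_semigroup_def)

lemma prob_p: "0 \<le> t \<Longrightarrow> prob_space (p t x)" and sets_p: "0 \<le> t \<Longrightarrow> sets (p t x) = sets borel"
  using measurable_space[OF kernel, of t x] by (auto simp: space_prob_algebra)

lemma C0_integrable:
  assumes "0 \<le> t" "f \<in> C0"
  shows "integrable (p t x) f"
proof -
  interpret prob_space "p t x" by (rule prob_p[OF assms(1)])
  obtain c where "\<And>x. \<bar>f x\<bar> \<le> c" using C0_bounded[OF assms(2)] by blast
  moreover have "f \<in> borel_measurable (p t x)"
    using C0_measurable[OF assms(2)] sets_p[OF assms(1)] by (simp cong: measurable_cong_sets)
  ultimately show ?thesis by (intro integrable_const_bound[of _ c]) auto
qed

lemma Pt_C0: "0 \<le> t \<Longrightarrow> f \<in> C0 \<Longrightarrow> Pt t f \<in> C0"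
  using semigroup by (auto simp: feller_semigroup_def Pt_def[abs_def])

lemma Pt_0: "f \<in> C0 \<Longrightarrow> Pt 0 f = f"
proof
  fix x assume "f \<in> C0"
  have "p 0 x = return borel x" using semigroup by (auto simp: feller_semigroup_def)
  then show "Pt 0 f x = f x" unfolding Pt_def using C0_measurable[OF \<open>f \<in> C0\<close>] by (simp add: integral_return)
qed

lemma Pt_nonneg: "(\<And>x. 0 \<le> f x) \<Longrightarrow> 0 \<le> Pt t f x"
  unfolding Pt_def by (rule integral_nonneg_AE) auto

lemma Pt_ennreal:
  "0 \<le> t \<Longrightarrow> f \<in> C0 \<Longrightarrow> (\<And>x. 0 \<le> f x) \<Longrightarrow> (\<integral>\<^sup>+y. ennreal (f y) \<partial>p t x) = ennreal (Pt t f x)"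
  unfolding Pt_def by (rule nn_integral_eq_integral[OF C0_integrable]) auto

lemma Pt_le:
  assumes "0 \<le> t" "f \<in> C0" "\<And>x. f x \<le> c"
  shows "Pt t f x \<le> c"
proof -
  interpret prob_space "p t x" by (rule prob_p[OF assms(1)])
  have "Pt t f x \<le> (\<integral>y. c \<partial>p t x)"
    unfolding Pt_def using assms C0_integrable by (intro integral_mono) auto
  then show ?thesis by (simp add: prob_space)
qed

lemma Pt_diff_le:
  assumes "0 \<le> t" "f \<in> C0" "g \<in> C0" "\<And>x. \<bar>f x - g x\<bar> \<le> c"
  shows "\<bar>Pt t f x - Pt t g x\<bar> \<le> c"
proof -
  interpret prob_space "p t x" by (rule prob_p[OF assms(1)])
  have i: "integrable (p t x) f" "integrable (p t x) g" using assms C0_integrable by auto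
  have "\<bar>Pt t f x - Pt t g x\<bar> = \<bar>\<integral>y. f y - g y \<partial>p t x\<bar>"
    unfolding Pt_def using i by simp
  also have "\<dots> \<le> (\<integral>y. \<bar>f y - g y\<bar> \<partial>p t x)" by (rule integral_abs_bound)
  also have "\<dots> \<le> (\<integral>y. c \<partial>p t x)" using i assms by (intro integral_mono) auto
  finally show ?thesis by (simp add: prob_space)
qed

lemma Pt_add:
  assumes st: "0 \<le> s" "0 \<le> t" and f: "f \<in> C0" "\<And>x. 0 \<le> f x"
  shows "Pt (s + t) f x = Pt s (Pt t f) x"
proof -
  have b: "p (s + t) x = p s x \<bind> p t" using semigroup st by (auto simp: feller_semigroup_def)
  have "p t \<in> p s x \<rightarrow>\<^sub>M subprob_algebra borel"
    using measurable_prob_algebraD[OF kernel[OF st(2)]] sets_p[OF st(1)] by (simp cong: measurable_cong_sets)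
  then have "(\<integral>\<^sup>+y. ennreal (f y) \<partial>p (s + t) x) = (\<integral>\<^sup>+y. \<integral>\<^sup>+z. ennreal (f z) \<partial>p t y \<partial>p s x)"
    unfolding b using C0_measurable[OF f(1)] by (intro nn_integral_bind[of _ borel]) auto
  also have "\<dots> = (\<integral>\<^sup>+y. ennreal (Pt t f y) \<partial>p s x)"
    using Pt_ennreal[OF st(2) f] by (intro nn_integral_cong) auto
  also have "\<dots> = ennreal (Pt s (Pt t f) x)"
    using Pt_C0 st f Pt_nonneg by (intro Pt_ennreal) auto
  finally show ?thesis
    using Pt_ennreal[of "s + t" f x] st f Pt_nonneg by (simp add: Pt_nonneg)
qed

lemma Pt_uniform:
  assumes "f \<in> C0" "0 < e"
  shows "\<exists>\<delta>>0. \<forall>r. 0 \<le> r \<and> r < \<delta> \<longrightarrow> (\<forall>x. \<bar>Pt r f x - f x\<bar> < e)"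
proof -
  have "uniform_limit UNIV (\<lambda>t x. Pt t f x) f (at_right 0)"
    using semigroup assms(1) by (auto simp: feller_semigroup_def Pt_def)
  then have "\<forall>\<^sub>F t in at_right 0. \<forall>x. \<bar>Pt t f x - f x\<bar> < e"
    using assms(2) by (auto simp: uniform_limit_iff dist_real_def)
  then obtain \<delta> where \<delta>: "0 < \<delta>" "\<And>r. 0 < r \<Longrightarrow> r < \<delta> \<Longrightarrow> \<forall>x. \<bar>Pt r f x - f x\<bar> < e"
    by (auto simp: eventually_at_right_field)
  have "\<bar>Pt r f x - f x\<bar> < e" if "0 \<le> r" "r < \<delta>" for r x
    using \<delta>(2)[of r] Pt_0[OF assms(1)] assms(2) that by (cases "r = 0") auto
  then show ?thesis using \<delta>(1) by blast
qed

text \<open>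
  Joint continuity in time and space: by the semigroup property \<open>Pt (t - s) f\<close> and
  \<open>Pt (t - q) f\<close> differ at most by the supremum of \<open>Pt (q - s) f - f\<close>, and
  \<open>Pt (t - s) f\<close> is continuous.
\<close>

lemma Pt_tendsto:
  assumes f: "f \<in> C0" "\<And>x. 0 \<le> f x" and q: "q \<longlonglongrightarrow> s" "\<And>n. s \<le> q n" "\<And>n. q n \<le> t" and x: "x \<longlonglongrightarrow> y"
  shows "(\<lambda>n. Pt (t - q n) f (x n)) \<longlonglongrightarrow> Pt (t - s) f y"
proof -
  have st: "s \<le> t" using q(2,3) order.trans by blast
  have "(\<lambda>n. Pt (t - q n) f (x n) - Pt (t - s) f (x n)) \<longlonglongrightarrow> 0"
  proof (rule LIMSEQ_I)
    fix e :: real assume e: "0 < e"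
    obtain \<delta> where \<delta>: "0 < \<delta>" "\<And>r x. 0 \<le> r \<Longrightarrow> r < \<delta> \<Longrightarrow> \<bar>Pt r f x - f x\<bar> < e / 2"
      using Pt_uniform[OF f(1), of "e/2"] e by auto
    have "eventually (\<lambda>n. q n < s + \<delta>) sequentially" using q(1) \<delta>(1) by (intro order_tendstoD) auto
    then obtain n0 where n0: "\<And>n. n0 \<le> n \<Longrightarrow> q n < s + \<delta>" by (auto simp: eventually_sequentially)
    have "\<bar>Pt (t - q n) f (x n) - Pt (t - s) f (x n)\<bar> < e" if "n0 \<le> n" for n
    proof -
      have "Pt (t - s) f (x n) = Pt (t - q n) (Pt (q n - s) f) (x n)"
        using Pt_add[of "t - q n" "q n - s" f] q f by simp
      moreover have "\<bar>Pt (t - q n) f (x n) - Pt (t - q n) (Pt (q n - s) f) (x n)\<bar> \<le> e / 2"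
      proof (rule Pt_diff_le)
        show "Pt (q n - s) f \<in> C0" using q f by (intro Pt_C0) auto
        show "\<bar>f z - Pt (q n - s) f z\<bar> \<le> e / 2" for z
          using \<delta>(2)[of "q n - s" z] n0[OF that] q(2)[of n] by (auto simp: abs_minus_commute)
      qed (use q f in auto)
      ultimately show ?thesis using e by auto
    qed
    then show "\<exists>no. \<forall>n\<ge>no. norm (Pt (t - q n) f (x n) - Pt (t - s) f (x n) - 0) < e" by auto
  qed
  moreover have "(\<lambda>n. Pt (t - s) f (x n)) \<longlonglongrightarrow> Pt (t - s) f y"
    using C0_continuous[OF Pt_C0[OF _ f(1), of "t - s"]] st x
    by (intro continuous_on_tendsto_compose[of UNIV "Pt (t - s) f"]) auto
  ultimately show ?thesis
    using tendsto_add[of "\<lambda>n. Pt (t - q n) f (x n) - Pt (t - s) f (x n)" 0 sequentially "\<lambda>n. Pt (t - s) f (x n)"]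
    by auto
qed

text \<open>
  For observation times \<open>q \<le> t1 \<le> t2 \<le> \<dots>\<close> this is the expectation of
  \<open>f1 (X t1) * f2 (X t2) * \<dots>\<close> given that \<open>X q = x\<close>, written as iterated
  transition operators; see \<open>markov_path_prod\<close>.
\<close>

fun cond_prod :: "real \<Rightarrow> (real \<times> ('a \<Rightarrow> real)) list \<Rightarrow> 'a \<Rightarrow> real" where
  "cond_prod q [] x = 1"
| "cond_prod q ((t, f) # L) x = Pt (t - q) (\<lambda>y. f y * cond_prod t L y) x"

end

fun timed_C0 :: "real \<Rightarrow> (real \<times> ('a::topological_space \<Rightarrow> real)) list \<Rightarrow> bool" where
  "timed_C0 q [] \<longleftrightarrow> True"
| "timed_C0 q ((t, f) # L) \<longleftrightarrow> q \<le> t \<and> f \<in> C0 \<and> (\<forall>x. 0 \<le> f x \<and> f x \<le> 1) \<and> timed_C0 t L"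

definition path_prod :: "(real \<times> ('a \<Rightarrow> real)) list \<Rightarrow> (real \<Rightarrow> 'a) \<Rightarrow> real" where
  "path_prod L w = (\<Prod>(t, f)\<leftarrow>L. f (w t))"

lemma path_prod_Nil [simp]: "path_prod [] w = 1"
  and path_prod_Cons [simp]: "path_prod ((t, f) # L) w = f (w t) * path_prod L w"
  by (auto simp: path_prod_def)

lemma timed_C0_mono: "timed_C0 q L \<Longrightarrow> r \<le> q \<Longrightarrow> timed_C0 r L"
  by (cases L) auto

lemma path_prod_range: "timed_C0 q L \<Longrightarrow> 0 \<le> path_prod L w \<and> path_prod L w \<le> 1"
  by (induction q L rule: timed_C0.induct) (auto intro: mult_le_one)

lemma path_prod_measurable:
  assumes "timed_C0 q L" "\<And>t f. (t, f) \<in> set L \<Longrightarrow> t \<in> T"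
  shows "path_prod L \<in> borel_measurable (path_sigma T)"
  using assms
proof (induction q L rule: timed_C0.induct)
  case (1 q)
  then show ?case by (simp add: path_prod_def[abs_def])
next
  case (2 q t f L)
  have "(\<lambda>w. f (w t)) \<in> borel_measurable (path_sigma T)"
    using 2 by (intro measurable_compose[OF measurable_path_sigma_component C0_measurable]) auto
  moreover have "path_prod L \<in> borel_measurable (path_sigma T)" using 2 by auto
  ultimately have "(\<lambda>w. f (w t) * path_prod L w) \<in> borel_measurable (path_sigma T)" by (intro borel_measurable_times)
  then show ?case by (simp add: path_prod_def[abs_def])
qed

context feller begin

lemma cond_prod_props:
  assumes "timed_C0 q L"
  shows "continuous_on UNIV (cond_prod q L)" "0 \<le> cond_prod q L x" "cond_prod q L x \<le> 1"
    and "L = (t, f) # L' \<Longrightarrow> (\<lambda>y. f y * cond_prod t L' y) \<in> C0"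
proof -
  have "continuous_on UNIV (cond_prod q L) \<and> (\<forall>x. 0 \<le> cond_prod q L x \<and> cond_prod q L x \<le> 1) \<and>
      (\<forall>t f L'. L = (t, f) # L' \<longrightarrow> (\<lambda>y. f y * cond_prod t L' y) \<in> C0)"
    using assms
  proof (induction q L rule: timed_C0.induct)
    case (1 q)
    have "cond_prod q [] = (\<lambda>_. 1)" by auto
    then show ?case by simp
  next
    case (2 q t f L)
    then have IH: "continuous_on UNIV (cond_prod t L)" "\<And>x. 0 \<le> cond_prod t L x" "\<And>x. cond_prod t L x \<le> 1"
      and f: "f \<in> C0" "\<And>x. 0 \<le> f x" "\<And>x. f x \<le> 1" "q \<le> t" by auto
    have F: "(\<lambda>y. f y * cond_prod t L y) \<in> C0"
      using IH by (intro C0_mult_bounded[OF f(1), of _ 1]) (auto simp: abs_le_iff intro: order.trans[of _ 0])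
    have F1: "f y * cond_prod t L y \<le> 1" for y using f IH by (intro mult_le_one) auto
    have e: "cond_prod q ((t, f) # L) = Pt (t - q) (\<lambda>y. f y * cond_prod t L y)" by auto
    show ?case
      unfolding e
      using F C0_continuous[OF Pt_C0[OF _ F, of "t - q"]] f IH
        Pt_nonneg[of "\<lambda>y. f y * cond_prod t L y"] Pt_le[OF _ F, of "t - q" 1]
      F1 by auto
  qed
  then show "continuous_on UNIV (cond_prod q L)" "0 \<le> cond_prod q L x" "cond_prod q L x \<le> 1"
    "L = (t, f) # L' \<Longrightarrow> (\<lambda>y. f y * cond_prod t L' y) \<in> C0" by auto
qed

lemma cond_prod_measurable: "timed_C0 q L \<Longrightarrow> cond_prod q L \<in> borel_measurable borel"
  using cond_prod_props(1) borel_measurable_continuous_onI by blast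

text \<open>
  The continuity on which the strong Markov property rests: the conditional expectation given the position at
  \<open>q\<close> converges when \<open>q\<close> decreases to \<open>s\<close> and the positions converge.
\<close>

lemma cond_prod_tendsto:
  assumes "\<And>n. timed_C0 (q n) L" and q: "q \<longlonglongrightarrow> s" "\<And>n. s \<le> q n" and x: "x \<longlonglongrightarrow> y"
  shows "(\<lambda>n. cond_prod (q n) L (x n)) \<longlonglongrightarrow> cond_prod s L y"
proof (cases L)
  case Nil
  then show ?thesis by simp
next
  case (Cons a L')
  obtain t f where a: "a = (t, f)" by (cases a)
  have *: "q n \<le> t" "timed_C0 t L'" "\<And>x. 0 \<le> f x" for n using assms(1)[of n] Cons a by auto
  have "(\<lambda>y. f y * cond_prod t L' y) \<in> C0" using cond_prod_props(4)[OF assms(1)] Cons a by auto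
  then show ?thesis
    unfolding Cons a cond_prod.simps using * q x cond_prod_props(2)[OF *(2)] by (intro Pt_tendsto) auto
qed

end

section \<open>The Markov property\<close>

text \<open>
  The laws \<open>Q x\<close> of a Feller process on the space of cadlag paths. The Markov property is stated for
  single events of the past, which is the form closest to the one by conditional expectations.
\<close>

locale feller_paths = feller p
  for p :: "real \<Rightarrow> 'a::{metric_space, second_countable_topology} \<Rightarrow> 'a measure" +
  fixes Q :: "'a \<Rightarrow> (real \<Rightarrow> 'a) measure"
  assumes prob_Q: "prob_space (Q x)"
    and sets_Q: "sets (Q x) = sets (path_sigma {0..})"
    and start_Q: "AE w in Q x. w 0 = x"
    and markov_event: "0 \<le> s \<Longrightarrow> s \<le> t \<Longrightarrow> A \<in> sets (path_sigma {0..s}) \<Longrightarrow> B \<in> sets borel \<Longrightarrow>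
       emeasure (Q x) {w \<in> A. w t \<in> B} = (\<integral>\<^sup>+w. indicator A w * emeasure (p (t - s) (w s)) B \<partial>Q x)"
begin

lemma space_Q: "space (Q x) = paths"
  using sets_eq_imp_space_eq[OF sets_Q, of x] by simp

lemma measurable_Q: "f \<in> path_sigma {0..} \<rightarrow>\<^sub>M N \<Longrightarrow> f \<in> Q x \<rightarrow>\<^sub>M N"
  using sets_Q by (simp cong: measurable_cong_sets)

lemma measurable_path_sigma_mono:
  "f \<in> path_sigma S \<rightarrow>\<^sub>M N \<Longrightarrow> S \<subseteq> T \<Longrightarrow> f \<in> path_sigma T \<rightarrow>\<^sub>M N"
  using sets_path_sigma_mono[of S T] unfolding measurable_def by auto

lemma component_Q: "0 \<le> t \<Longrightarrow> (\<lambda>w. w t) \<in> borel_measurable (Q x)"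
  by (intro measurable_Q measurable_path_sigma_component) auto

text \<open>
  For fixed \<open>A\<close> both sides are integrals of \<open>\<phi>\<close> with respect to measures on the
  state space, namely the law of the position at \<open>t\<close> under the restriction of \<open>Q x\<close> to
  \<open>A\<close> and the image of that restriction under the transition kernel. The Markov property says that
  these measures are equal.
\<close>

lemma markov_set:
  assumes st: "0 \<le> s" "s \<le> t" and A: "A \<in> sets (path_sigma {0..s})" and \<phi>: "\<phi> \<in> borel_measurable borel"
  shows "(\<integral>\<^sup>+w. indicator A w * \<phi> (w t) \<partial>Q x) = (\<integral>\<^sup>+w. indicator A w * (\<integral>\<^sup>+y. \<phi> y \<partial>p (t - s) (w s)) \<partial>Q x)"
proof -
  have AQ: "A \<in> sets (Q x)" using A sets_path_sigma_mono[of "{0..s}" "{0..}"] sets_Q by auto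
  have t0: "0 \<le> t" "0 \<le> t - s" using st by auto
  let ?M = "density (Q x) (indicator A)"
  have cM: "(\<lambda>w. w r) \<in> borel_measurable ?M" if "0 \<le> r" for r using component_Q[OF that] by simp
  have kM: "(\<lambda>w. p (t - s) (w s)) \<in> ?M \<rightarrow>\<^sub>M subprob_algebra borel"
    using measurable_compose[OF cM[OF st(1)] measurable_prob_algebraD[OF kernel[OF t0(2)]]] .
  have ne: "space ?M \<noteq> {}" using prob_space.not_empty[OF prob_Q[of x]] by simp
  have eq: "distr ?M borel (\<lambda>w. w t) = ?M \<bind> (\<lambda>w. p (t - s) (w s))"
  proof (rule measure_eqI)
    show "sets (distr ?M borel (\<lambda>w. w t)) = sets (?M \<bind> (\<lambda>w. p (t - s) (w s)))"
      using sets_bind[of ?M "\<lambda>w. p (t - s) (w s)" borel] sets_p[OF t0(2)] ne by simp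
    fix B :: "'a set" assume "B \<in> sets (distr ?M borel (\<lambda>w. w t))"
    then have B: "B \<in> sets borel" by simp
    have BM: "(\<lambda>w. w t) -` B \<inter> space (Q x) \<in> sets (Q x)" using measurable_sets[OF component_Q[OF t0(1)] B] .
    have "emeasure (distr ?M borel (\<lambda>w. w t)) B = emeasure ?M ((\<lambda>w. w t) -` B \<inter> space (Q x))"
      using emeasure_distr[OF cM[OF t0(1)] B] by simp
    also have "\<dots> = emeasure (Q x) (A \<inter> ((\<lambda>w. w t) -` B \<inter> space (Q x)))"
      using AQ BM by (subst emeasure_restricted) auto
    also have "A \<inter> ((\<lambda>w. w t) -` B \<inter> space (Q x)) = {w \<in> A. w t \<in> B}"
      using sets.sets_into_space[OF AQ] by auto
    also have "emeasure (Q x) {w \<in> A. w t \<in> B} = (\<integral>\<^sup>+w. indicator A w * emeasure (p (t - s) (w s)) B \<partial>Q x)"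
      by (rule markov_event[OF st A B])
    also have "\<dots> = (\<integral>\<^sup>+w. emeasure (p (t - s) (w s)) B \<partial>?M)"
      using AQ kM B by (subst nn_integral_density) (auto intro: measurable_emeasure_kernel)
    also have "\<dots> = emeasure (?M \<bind> (\<lambda>w. p (t - s) (w s))) B"
      by (rule emeasure_bind[OF ne kM B, symmetric])
    finally show "emeasure (distr ?M borel (\<lambda>w. w t)) B = emeasure (?M \<bind> (\<lambda>w. p (t - s) (w s))) B" .
  qed
  have nm: "(\<lambda>w. \<integral>\<^sup>+y. \<phi> y \<partial>p (t - s) (w s)) \<in> borel_measurable (Q x)"
    using measurable_compose[OF kM nn_integral_measurable_subprob_algebra[OF \<phi>]] by simp
  have "(\<integral>\<^sup>+w. indicator A w * \<phi> (w t) \<partial>Q x) = (\<integral>\<^sup>+w. \<phi> (w t) \<partial>?M)"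
    using AQ measurable_compose[OF component_Q[OF t0(1)] \<phi>] by (subst nn_integral_density) auto
  also have "\<dots> = (\<integral>\<^sup>+y. \<phi> y \<partial>distr ?M borel (\<lambda>w. w t))"
    using cM[OF t0(1)] \<phi> by (subst nn_integral_distr) auto
  also have "\<dots> = (\<integral>\<^sup>+w. (\<integral>\<^sup>+y. \<phi> y \<partial>p (t - s) (w s)) \<partial>?M)"
    unfolding eq by (rule nn_integral_bind[OF \<phi> kM])
  also have "\<dots> = (\<integral>\<^sup>+w. indicator A w * (\<integral>\<^sup>+y. \<phi> y \<partial>p (t - s) (w s)) \<partial>Q x)"
    using AQ nm by (subst nn_integral_density) auto
  finally show ?thesis .
qed

lemma markov_fun:
  assumes st: "0 \<le> s" "s \<le> t" and Y: "Y \<in> borel_measurable (path_sigma {0..s})" and \<phi>: "\<phi> \<in> borel_measurable borel"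
  shows "(\<integral>\<^sup>+w. Y w * \<phi> (w t) \<partial>Q x) = (\<integral>\<^sup>+w. Y w * (\<integral>\<^sup>+y. \<phi> y \<partial>p (t - s) (w s)) \<partial>Q x)"
proof -
  have t0: "0 \<le> t" "0 \<le> t - s" using st by auto
  have m1 [measurable]: "(\<lambda>w. \<phi> (w t)) \<in> borel_measurable (Q x)"
    using measurable_compose[OF component_Q[OF t0(1)] \<phi>] .
  have m2 [measurable]: "(\<lambda>w. \<integral>\<^sup>+y. \<phi> y \<partial>p (t - s) (w s)) \<in> borel_measurable (Q x)"
    using measurable_compose[OF component_Q[OF st(1)]
        measurable_compose[OF measurable_prob_algebraD[OF kernel[OF t0(2)]] nn_integral_measurable_subprob_algebra[OF \<phi>]]] .
  have up: "U \<in> borel_measurable (Q x)" if "U \<in> borel_measurable (path_sigma {0..s})" for U :: "_ \<Rightarrow> ennreal"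
    by (intro measurable_Q measurable_path_sigma_mono[OF that]) auto
  show ?thesis
    using Y
  proof (induction rule: borel_measurable_induct)
    case (cong f g)
    have "(\<integral>\<^sup>+w. g w * h w \<partial>Q x) = (\<integral>\<^sup>+w. f w * h w \<partial>Q x)" for h
      using cong(3) by (intro nn_integral_cong) (simp add: space_Q)
    then show ?case using cong(4) by simp
  next
    case (set A)
    then show ?case using markov_set[OF st _ \<phi>] by simp
  next
    case (mult u c)
    have [measurable]: "u \<in> borel_measurable (Q x)" by (rule up) fact
    show ?case using mult by (simp add: mult.assoc nn_integral_cmult)
  next
    case (add u v)
    have [measurable]: "u \<in> borel_measurable (Q x)" "v \<in> borel_measurable (Q x)" by (rule up, fact)+
    show ?case using add by (simp add: distrib_right nn_integral_add)
  next
    case (seq U)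
    have [measurable]: "U i \<in> borel_measurable (Q x)" for i by (rule up) fact
    have inc: "incseq (\<lambda>i w. U i w * h w)" for h :: "_ \<Rightarrow> ennreal"
      using \<open>incseq U\<close> by (auto simp: incseq_def le_fun_def intro!: mult_right_mono)
    have sup: "(\<integral>\<^sup>+w. (SUP i. U i) w * h w \<partial>Q x) = (SUP i. \<integral>\<^sup>+w. U i w * h w \<partial>Q x)"
      if [measurable]: "h \<in> borel_measurable (Q x)" for h
    proof -
      have "(\<integral>\<^sup>+w. (SUP i. U i) w * h w \<partial>Q x) = (\<integral>\<^sup>+w. (SUP i. U i w * h w) \<partial>Q x)"
        by (simp add: SUP_mult_right_ennreal image_comp)
      also have "\<dots> = (SUP i. \<integral>\<^sup>+w. U i w * h w \<partial>Q x)"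
        by (rule nn_integral_monotone_convergence_SUP[OF inc]) measurable
      finally show ?thesis .
    qed
    show ?case unfolding sup[OF m1] sup[OF m2] using seq by simp
  qed
qed

text \<open>
  The Markov property is applied at the times of the observations, the last one first; every observation that is
  not the last becomes part of the factor \<open>Y\<close>, which depends on the past only.
\<close>

lemma markov_path_prod:
  assumes "timed_C0 q L" "0 \<le> q" "Y \<in> borel_measurable (path_sigma {0..q})"
  shows "(\<integral>\<^sup>+w. Y w * ennreal (path_prod L w) \<partial>Q x) = (\<integral>\<^sup>+w. Y w * ennreal (cond_prod q L (w q)) \<partial>Q x)"
  using assms
proof (induction q L arbitrary: Y rule: timed_C0.induct)
  case (1 q)
  then show ?case by simp
next
  case (2 q t f L)
  let ?F = "\<lambda>y. f y * cond_prod t L y"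
  have f: "q \<le> t" "f \<in> C0" "\<And>x. 0 \<le> f x" "timed_C0 t L" using 2 by auto
  have F: "?F \<in> C0" using cond_prod_props(4)[OF 2(2)] by auto
  have F0: "0 \<le> ?F y" for y using f cond_prod_props(2)[OF f(4)] by auto
  have Ym: "(\<lambda>w. Y w * ennreal (f (w t))) \<in> borel_measurable (path_sigma {0..t})"
    using measurable_path_sigma_mono[OF 2(4), of "{0..t}"] f 2(3)
      measurable_compose[OF measurable_path_sigma_component[of t "{0..t}"] C0_measurable[OF f(2)]]
    by (intro borel_measurable_times_ennreal measurable_compose[OF _ measurable_ennreal]) auto
  have "(\<integral>\<^sup>+w. Y w * ennreal (path_prod ((t, f) # L) w) \<partial>Q x) =
      (\<integral>\<^sup>+w. (Y w * ennreal (f (w t))) * ennreal (path_prod L w) \<partial>Q x)"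
    using f path_prod_range[OF f(4)] by (simp add: ennreal_mult mult.assoc)
  also have "\<dots> = (\<integral>\<^sup>+w. (Y w * ennreal (f (w t))) * ennreal (cond_prod t L (w t)) \<partial>Q x)"
    using 2(3) f by (intro 2(1)[OF f(4)] Ym) auto
  also have "\<dots> = (\<integral>\<^sup>+w. Y w * ennreal (?F (w t)) \<partial>Q x)"
    using f cond_prod_props(2)[OF f(4)] by (simp add: ennreal_mult mult.assoc)
  also have "\<dots> = (\<integral>\<^sup>+w. Y w * (\<integral>\<^sup>+y. ennreal (?F y) \<partial>p (t - q) (w q)) \<partial>Q x)"
    using markov_fun[OF 2(3) f(1) 2(4), of "\<lambda>y. ennreal (?F y)"] C0_measurable[OF F] by simp
  also have "\<dots> = (\<integral>\<^sup>+w. Y w * ennreal (cond_prod q ((t, f) # L) (w q)) \<partial>Q x)"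
    using Pt_ennreal[of "t - q" ?F] F F0 f by simp
  finally show ?case .
qed

end

definition path_law :: "('a::topological_space \<Rightarrow> 'w measure) \<Rightarrow> (real \<Rightarrow> 'w \<Rightarrow> 'a) \<Rightarrow> 'a \<Rightarrow> (real \<Rightarrow> 'a) measure" where
  "path_law P X x = distr (P x) (path_sigma {0..}) (sample_path X)"

lemma feller_process_paths:
  fixes P :: "'a::{metric_space, second_countable_topology} \<Rightarrow> 'w measure"
  assumes "feller_markov_process P X"
  shows "\<exists>p. feller_paths p (path_law P X)" "sample_path X \<in> P x \<rightarrow>\<^sub>M path_sigma {0..}"
proof -
  have P: "\<And>x. prob_space (P x)" "\<And>x t. 0 \<le> t \<Longrightarrow> X t \<in> borel_measurable (P x)"
    "\<And>x \<omega>. \<omega> \<in> space (P x) \<Longrightarrow> cadlag (\<lambda>t. X t \<omega>)" "\<And>x. AE \<omega> in P x. X 0 \<omega> = x"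
    using assms by (auto simp: feller_markov_process_def)
  obtain p where p: "feller_semigroup p" and M:
      "\<And>x s t B. 0 \<le> s \<Longrightarrow> 0 \<le> t \<Longrightarrow> B \<in> sets borel \<Longrightarrow>
           AE \<omega> in P x. real_cond_exp (P x) (past (P x) X s) (\<lambda>\<eta>. indicator B (X (s + t) \<eta>)) \<omega>
                        = measure (p t (X s \<omega>)) B"
    using assms unfolding feller_markov_process_def by blast
  interpret feller p by unfold_locales fact
  have inp: "sample_path X \<in> space (P x) \<rightarrow> paths" for x
    using P(3) by (auto intro!: sample_path_in_paths)
  have sp: "sample_path X \<in> P x \<rightarrow>\<^sub>M path_sigma {0..}" for x
    using P(2) by (intro measurable_path_sigma[OF inp]) (simp add: sample_path_def)
  then show "sample_path X \<in> P x \<rightarrow>\<^sub>M path_sigma {0..}" .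
  have gen: "{X u -` B \<inter> space (P x) | u B. 0 \<le> u \<and> u \<le> s \<and> B \<in> sets borel} \<subseteq> Pow (space (P x))" for x s
    by auto
  have past_space: "space (past (P x) X s) = space (P x)" for x s
    unfolding past_def by (rule space_measure_of[OF gen])
  have past_sets: "sets (past (P x) X s) = sigma_sets (space (P x)) {X u -` B \<inter> space (P x) | u B. 0 \<le> u \<and> u \<le> s \<and> B \<in> sets borel}" for x s
    unfolding past_def by (rule sets_measure_of[OF gen])
  have sub: "subalgebra (P x) (past (P x) X s)" for x s
    unfolding subalgebra_def past_space past_sets
    using measurable_sets[OF P(2)] by (auto intro!: sets.sigma_sets_subset)
  have comp: "X u \<in> borel_measurable (past (P x) X s)" if "0 \<le> u" "u \<le> s" for x u s
  proof (rule measurableI)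
    fix B :: "'a set" assume "B \<in> sets borel"
    then show "X u -` B \<inter> space (past (P x) X s) \<in> sets (past (P x) X s)"
      unfolding past_space past_sets using that by blast
  qed simp
  have spp: "sample_path X \<in> past (P x) X s \<rightarrow>\<^sub>M path_sigma {0..s}" if "0 \<le> s" for x s
    using inp[of x] comp that by (intro measurable_path_sigma) (auto simp: past_space sample_path_def)
  have "feller_paths p (path_law P X)"
  proof (rule feller_paths.intro[OF feller_axioms], rule feller_paths_axioms.intro)
    fix x
    interpret Px: prob_space "P x" by (rule P)
    show "prob_space (path_law P X x)" unfolding path_law_def by (rule Px.prob_space_distr[OF sp])
    show "sets (path_law P X x) = sets (path_sigma {0..})" by (simp add: path_law_def)
    have "{w \<in> space (path_sigma {0..}). w 0 = x} \<in> sets (path_sigma {0..})"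
      using measurable_sets[OF measurable_path_sigma_component[of 0 "{0..}"], of "{x}"]
      by (simp add: vimage_def Int_def conj_commute)
    then show "AE w in path_law P X x. w 0 = x"
      unfolding path_law_def using P(4)[of x] by (subst AE_distr_iff[OF sp]) (auto simp: sample_path_def)
    fix s t :: real and A :: "(real \<Rightarrow> 'a) set" and B :: "'a set"
    assume st: "0 \<le> s" "s \<le> t" and A: "A \<in> sets (path_sigma {0..s})" and B: "B \<in> sets borel"
    have t0: "0 \<le> t" "0 \<le> t - s" using st by auto
    interpret finite_measure_subalgebra "P x" "past (P x) X s"
      by unfold_locales (rule sub)
    define A' where "A' = sample_path X -` A \<inter> space (P x)"
    have A'F: "A' \<in> sets (past (P x) X s)"
      using measurable_sets[OF spp[OF st(1)] A, of x] by (simp add: A'_def past_space)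
    then have A'P: "A' \<in> sets (P x)" using sub[of x s] by (auto simp: subalgebra_def)
    have AD: "A \<in> sets (path_sigma {0..})" using A sets_path_sigma_mono[of "{0..s}" "{0..}"] by auto
    have BX: "X t -` B \<inter> space (P x) \<in> sets (P x)" by (rule measurable_sets[OF P(2)[OF t0(1)] B])
    have AB: "{w \<in> A. w t \<in> B} \<in> sets (path_sigma {0..})"
    proof -
      have "{w \<in> A. w t \<in> B} = A \<inter> ((\<lambda>w. w t) -` B \<inter> space (path_sigma {0..}))"
        using sets.sets_into_space[OF AD] by auto
      then show ?thesis
        using AD measurable_sets[OF measurable_path_sigma_component[of t "{0..}"] B] t0 by auto
    qed
    let ?g = "\<lambda>\<eta>. indicator B (X t \<eta>) :: real"
    let ?k = "\<lambda>\<omega>. measure (p (t - s) (X s \<omega>)) B"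
    have gm: "?g \<in> borel_measurable (P x)"
      using measurable_compose[OF P(2)[OF t0(1)] borel_measurable_indicator[OF B]] .
    have km: "?k \<in> borel_measurable (P x)"
      using measurable_compose[OF P(2)[OF st(1)] measurable_compose[OF kernel[OF t0(2)] measurable_measure_prob_algebra[OF B]]] .
    have int: "integrable (P x) (\<lambda>\<omega>. indicator A' \<omega> * ?g \<omega>)"
      using A'P gm by (intro Px.integrable_const_bound[of _ 1]) (auto split: split_indicator)
    have intk: "integrable (P x) (\<lambda>\<omega>. indicator A' \<omega> * ?k \<omega>)"
      using A'P km prob_space.prob_le_1[OF prob_p[OF t0(2)]]
      by (intro Px.integrable_const_bound[of _ 1]) (auto split: split_indicator)
    have "emeasure (path_law P X x) {w \<in> A. w t \<in> B} = emeasure (P x) (A' \<inter> (X t -` B \<inter> space (P x)))"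
      unfolding path_law_def using t0
      by (subst emeasure_distr[OF sp AB]) (auto simp: A'_def sample_path_def intro!: arg_cong2[where f=emeasure])
    also have "\<dots> = ennreal (\<integral>\<omega>. indicator A' \<omega> * ?g \<omega> \<partial>P x)"
    proof -
      have "(\<integral>\<omega>. indicator A' \<omega> * ?g \<omega> \<partial>P x) = (\<integral>\<omega>. indicator (A' \<inter> (X t -` B \<inter> space (P x))) \<omega> \<partial>P x)"
        by (intro Bochner_Integration.integral_cong) (auto split: split_indicator)
      also have "\<dots> = measure (P x) (A' \<inter> (X t -` B \<inter> space (P x)))"
        using A'P BX by (simp add: Int_absorb2 sets.sets_into_space le_infI1)
      finally show ?thesis by (simp add: Px.emeasure_eq_measure)
    qed
    also have "(\<integral>\<omega>. indicator A' \<omega> * ?g \<omega> \<partial>P x) =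
        (\<integral>\<omega>. indicator A' \<omega> * real_cond_exp (P x) (past (P x) X s) ?g \<omega> \<partial>P x)"
      using real_cond_exp_intg(2)[OF int _ gm] A'F by simp
    also have "\<dots> = (\<integral>\<omega>. indicator A' \<omega> * ?k \<omega> \<partial>P x)"
    proof (rule integral_cong_AE)
      show "AE \<omega> in P x. indicator A' \<omega> * real_cond_exp (P x) (past (P x) X s) ?g \<omega> = indicator A' \<omega> * ?k \<omega>"
      proof -
        have "AE \<omega> in P x. real_cond_exp (P x) (past (P x) X s) ?g \<omega> = ?k \<omega>"
          using M[OF st(1) t0(2) B, of x] by simp
        then show ?thesis by eventually_elim simp
      qed
      show "(\<lambda>\<omega>. indicator A' \<omega> * ?k \<omega>) \<in> borel_measurable (P x)" using intk by auto
      show "(\<lambda>\<omega>. indicator A' \<omega> * real_cond_exp (P x) (past (P x) X s) ?g \<omega>) \<in> borel_measurable (P x)"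
        using A'P by (intro borel_measurable_times borel_measurable_cond_exp2) auto
    qed
    also have "ennreal \<dots> = (\<integral>\<^sup>+\<omega>. ennreal (indicator A' \<omega> * ?k \<omega>) \<partial>P x)"
      by (intro nn_integral_eq_integral[symmetric] intk) auto
    also have "\<dots> = (\<integral>\<^sup>+\<omega>. indicator A (sample_path X \<omega>) * emeasure (p (t - s) (sample_path X \<omega> s)) B \<partial>P x)"
      using st finite_measure.emeasure_eq_measure[OF prob_space.finite_measure[OF prob_p[OF t0(2)]]]
      by (intro nn_integral_cong) (auto simp: A'_def sample_path_def split: split_indicator)
    also have "\<dots> = (\<integral>\<^sup>+w. indicator A w * emeasure (p (t - s) (w s)) B \<partial>path_law P X x)"
      unfolding path_law_def
    proof (rule nn_integral_distr[OF sp, symmetric])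
      have "(\<lambda>w. emeasure (p (t - s) (w s)) B) \<in> borel_measurable (path_sigma {0..})"
        using measurable_compose[OF measurable_path_sigma_component[of s "{0..}"]
            measurable_emeasure_kernel[OF measurable_prob_algebraD[OF kernel[OF t0(2)]] B]] st by auto
      then have "(\<lambda>w. indicator A w * emeasure (p (t - s) (w s)) B) \<in> borel_measurable (path_sigma {0..})"
        using AD by (intro borel_measurable_times_ennreal) auto
      then show "(\<lambda>w. indicator A w * emeasure (p (t - s) (w s)) B)
          \<in> borel_measurable (distr (P x) (path_sigma {0..}) (sample_path X))" by simp
    qed
    finally show "emeasure (path_law P X x) {w \<in> A. w t \<in> B} =
        (\<integral>\<^sup>+w. indicator A w * emeasure (p (t - s) (w s)) B \<partial>path_law P X x)" .
  qed
  then show "\<exists>p. feller_paths p (path_law P X)" by blast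
qed

section \<open>Completions and measure-preserving maps\<close>

text \<open>
  Events involving meeting times are measurable only for the completion. This transfers their probabilities from
  one system of particles to another along a measure-preserving map.
\<close>

lemma completion_pullback:
  assumes f: "f \<in> completion M \<rightarrow>\<^sub>M N" and d: "distr (completion M) N f = N" and E: "E \<in> sets (completion N)"
  shows "f -` E \<inter> space M \<in> sets (completion M)"
    and "emeasure (completion M) (f -` E \<inter> space M) = emeasure (completion N) E"
proof -
  have fc: "f \<in> completion M \<rightarrow>\<^sub>M completion N"
    by (rule completion.measurable_completion2[OF f]) (simp add: d)
  then show "f -` E \<inter> space M \<in> sets (completion M)"
    using measurable_sets[OF fc E] by simp
  have "distr (completion M) (completion N) f = completion N"
    using completion.completion_distr_eq[OF f] d by simp
  then show "emeasure (completion M) (f -` E \<inter> space M) = emeasure (completion N) E"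
    using emeasure_distr[OF fc E] by simp
qed

lemma completion_pullback_measurable:
  assumes f: "f \<in> M \<rightarrow>\<^sub>M N" and d: "distr M N f = N" and E: "E \<in> sets (completion N)"
  shows "f -` E \<inter> space M \<in> sets (completion M)"
    and "emeasure (completion M) (f -` E \<inter> space M) = emeasure (completion N) E"
  using completion_pullback[OF measurable_completion[OF f] _ E] d distr_completion[OF f] by auto

text \<open>
  Up to a null set, an event of the completed sub-\<open>\<sigma>\<close>-algebra is an event of the
  sub-\<open>\<sigma>\<close>-algebra itself, so identities between integrals over events of the latter extend to
  the former.
\<close>

lemma sets_completion_sub:
  assumes sub: "subalgebra M F" and A: "A \<in> sets (completion (restr_to_subalg M F))"
  shows "A \<in> sets (completion M)" "\<exists>B\<in>sets F. AE \<omega> in M. \<omega> \<in> A \<longleftrightarrow> \<omega> \<in> B"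
proof -
  obtain S N N' where *: "A = S \<union> N" "N \<subseteq> N'" "N' \<in> null_sets (restr_to_subalg M F)" "S \<in> sets (restr_to_subalg M F)"
    using A by (elim sets_completionE) blast
  have N': "N' \<in> null_sets M" and S: "S \<in> sets F"
    using *(3,4) null_sets_restr_to_subalg[OF sub] sets_restr_to_subalg[OF sub] by auto
  have "S \<in> sets M" using S sub by (auto simp: subalgebra_def)
  then show "A \<in> sets (completion M)" using * N' by (intro sets_completionI[of A S N N']) auto
  have "AE \<omega> in M. \<omega> \<notin> N'" by (rule AE_not_in[OF N'])
  then have "AE \<omega> in M. \<omega> \<in> A \<longleftrightarrow> \<omega> \<in> S"
    by eventually_elim (use * in auto)
  then show "\<exists>B\<in>sets F. AE \<omega> in M. \<omega> \<in> A \<longleftrightarrow> \<omega> \<in> B" using S by blast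
qed

lemma sets_completion_restr_mono:
  assumes sub: "subalgebra M F" "subalgebra M G" and FG: "sets F \<subseteq> sets G"
  shows "sets (completion (restr_to_subalg M F)) \<subseteq> sets (completion (restr_to_subalg M G))"
proof
  fix A assume "A \<in> sets (completion (restr_to_subalg M F))"
  then obtain S N N' where *: "A = S \<union> N" "N \<subseteq> N'" "N' \<in> null_sets (restr_to_subalg M F)" "S \<in> sets (restr_to_subalg M F)"
    by (elim sets_completionE) blast
  then show "A \<in> sets (completion (restr_to_subalg M G))"
    using FG null_sets_restr_to_subalg[OF sub(1)] null_sets_restr_to_subalg[OF sub(2)]
      sets_restr_to_subalg[OF sub(1)] sets_restr_to_subalg[OF sub(2)]
    by (intro sets_completionI[of A S N N']) auto
qed

section \<open>Systems of independent particles\<close>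

definition cylinder :: "nat set \<Rightarrow> (nat \<Rightarrow> (real \<times> 'a::topological_space set) list) \<Rightarrow> (nat \<Rightarrow> real \<Rightarrow> 'a) set" where
  "cylinder I L = {\<omega> \<in> PiE I (\<lambda>_. paths). \<forall>i\<in>I. \<forall>x\<in>set (L i). \<omega> i (fst x) \<in> snd x}"

definition timed_open :: "(real \<times> 'a::topological_space set) list \<Rightarrow> bool" where
  "timed_open L \<longleftrightarrow> (\<forall>x\<in>set L. 0 \<le> fst x \<and> open (snd x))"

lemma timed_open_append: "timed_open (L @ L') \<longleftrightarrow> timed_open L \<and> timed_open L'"
  by (auto simp: timed_open_def ball_Un)

lemma sets_PiM_path_sigma:
  "sets (PiM I (\<lambda>_. path_sigma {0..} :: (real \<Rightarrow> 'a::topological_space) measure)) =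
     sigma_sets (PiE I (\<lambda>_. paths)) {cylinder I L | L. \<forall>i\<in>I. timed_open (L i)}" if I: "finite I"
proof -
  let ?\<Omega> = "PiE I (\<lambda>_. paths :: (real \<Rightarrow> 'a) set)"
  let ?C = "{cylinder I L | L. \<forall>i\<in>I. timed_open (L i)} :: (nat \<Rightarrow> real \<Rightarrow> 'a) set set"
  let ?N = "sigma ?\<Omega> ?C"
  have CP: "?C \<subseteq> Pow ?\<Omega>" by (auto simp: cylinder_def)
  have sN: "space ?N = ?\<Omega>" "sets ?N = sigma_sets ?\<Omega> ?C" using CP by (auto simp: space_measure_of sets_measure_of)
  have "sets (PiM I (\<lambda>_. path_sigma {0..} :: (real \<Rightarrow> 'a) measure)) \<subseteq> sets ?N"
  proof (rule sets_PiM_in_sets)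
    show "space ?N = (\<Pi>\<^sub>E i\<in>I. space (path_sigma {0..} :: (real \<Rightarrow> 'a) measure))" using sN by simp
    fix i and A :: "(real \<Rightarrow> 'a) set" assume i: "i \<in> I" and A: "A \<in> sets (path_sigma {0..})"
    have "(\<lambda>\<omega>. \<omega> i) \<in> ?N \<rightarrow>\<^sub>M path_sigma {0..}"
    proof (rule measurable_path_sigma)
      show "(\<lambda>\<omega>. \<omega> i) \<in> space ?N \<rightarrow> paths" using i sN by (auto simp: PiE_def Pi_def)
      fix t :: real assume t: "t \<in> {0..}"
      show "(\<lambda>\<omega>. \<omega> i t) \<in> borel_measurable ?N"
      proof (rule borel_measurableI)
        fix G :: "'a set" assume G: "open G"
        have "(\<lambda>\<omega>. \<omega> i t) -` G \<inter> space ?N = cylinder I (\<lambda>j. if j = i then [(t, G)] else [])"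
          unfolding sN(1) using i by (auto simp: cylinder_def)
        also have "\<dots> \<in> ?C" using t G by (force simp: timed_open_def)
        finally show "(\<lambda>\<omega>. \<omega> i t) -` G \<inter> space ?N \<in> sets ?N" unfolding sN by (rule sigma_sets.Basic)
      qed
    qed
    from measurable_sets[OF this A] show "{x \<in> space ?N. x i \<in> A} \<in> sets ?N"
      by (simp add: vimage_def Int_def conj_commute)
  qed
  moreover have "sigma_sets ?\<Omega> ?C \<subseteq> sets (PiM I (\<lambda>_. path_sigma {0..} :: (real \<Rightarrow> 'a) measure))"
  proof -
    have "sigma_sets (space (PiM I (\<lambda>_. path_sigma {0..} :: (real \<Rightarrow> 'a) measure))) ?C
        \<subseteq> sets (PiM I (\<lambda>_. path_sigma {0..} :: (real \<Rightarrow> 'a) measure))"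
    proof (rule sets.sigma_sets_subset, safe)
      fix L :: "nat \<Rightarrow> (real \<times> 'a set) list" assume L: "\<forall>i\<in>I. timed_open (L i)"
      have "cylinder I L = PiE I (\<lambda>i. {w \<in> paths. \<forall>x\<in>set (L i). w (fst x) \<in> snd x})"
        by (auto simp: cylinder_def PiE_def Pi_def)
      also have "\<dots> \<in> sets (PiM I (\<lambda>_. path_sigma {0..}))"
      proof (rule sets_PiM_I_finite[OF I])
        fix i assume i: "i \<in> I"
        have "{w \<in> space (path_sigma {0..}). \<forall>x\<in>set (L i). w (fst x) \<in> snd x} \<in> sets (path_sigma {0..} :: (real \<Rightarrow> 'a) measure)"
        proof (rule sets.sets_Collect_finite_All)
          fix x assume x: "x \<in> set (L i)"
          have "(\<lambda>w. w (fst x)) -` snd x \<inter> space (path_sigma {0..}) \<in> sets (path_sigma {0..} :: (real \<Rightarrow> 'a) measure)"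
            using x L i by (intro measurable_sets[OF measurable_path_sigma_component]) (auto simp: timed_open_def)
          then show "{w \<in> space (path_sigma {0..}). w (fst x) \<in> snd x} \<in> sets (path_sigma {0..} :: (real \<Rightarrow> 'a) measure)"
            by (simp add: vimage_def Int_def conj_commute)
        qed simp
        then show "{w \<in> paths. \<forall>x\<in>set (L i). w (fst x) \<in> snd x} \<in> sets (path_sigma {0..})" by simp
      qed
      finally show "cylinder I L \<in> sets (PiM I (\<lambda>_. path_sigma {0..}))" .
    qed
    then show ?thesis by (simp add: space_PiM)
  qed
  ultimately show ?thesis unfolding sN by blast
qed

lemma cylinder_Int: "cylinder I L \<inter> cylinder I L' = cylinder I (\<lambda>i. L i @ L' i)"
  by (auto simp: cylinder_def)

lemma cylinder_sort: "cylinder I L = cylinder I (\<lambda>i. sort_key fst (L i))"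
  by (simp add: cylinder_def)

text \<open>
  Cylinders form an intersection-stable generator. Sorting the times costs nothing, and it is what the iterated
  conditional expectations require.
\<close>

lemma measure_eqI_cylinder:
  fixes M N :: "(nat \<Rightarrow> real \<Rightarrow> 'a::topological_space) measure"
  assumes I: "finite I"
    and s: "sets M = sets (PiM I (\<lambda>_. path_sigma {0..}))" "sets N = sets (PiM I (\<lambda>_. path_sigma {0..}))"
    and fin: "finite_measure M"
    and eq: "\<And>L. (\<And>i. i \<in> I \<Longrightarrow> timed_open (L i) \<and> sorted (map fst (L i))) \<Longrightarrow>
       emeasure M (cylinder I L) = emeasure N (cylinder I L)"
  shows "M = N"
proof (rule measure_eqI_generator_eq)
  let ?\<Omega> = "PiE I (\<lambda>_. paths :: (real \<Rightarrow> 'a) set)"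
  let ?C = "{cylinder I L | L. \<forall>i\<in>I. timed_open (L i)} :: (nat \<Rightarrow> real \<Rightarrow> 'a) set set"
  show "Int_stable ?C"
  proof (rule Int_stableI, elim CollectE exE conjE)
    fix a b :: "(nat \<Rightarrow> real \<Rightarrow> 'a) set" and L L' assume "a = cylinder I L" "b = cylinder I L'" "\<forall>i\<in>I. timed_open (L i)" "\<forall>i\<in>I. timed_open (L' i)"
    then have "a \<inter> b = cylinder I (\<lambda>i. L i @ L' i)" "\<forall>i\<in>I. timed_open (L i @ L' i)"
      by (simp_all add: cylinder_Int timed_open_append)
    then show "a \<inter> b \<in> ?C" by blast
  qed
  show "?C \<subseteq> Pow ?\<Omega>" by (auto simp: cylinder_def)
  show "sets M = sigma_sets ?\<Omega> ?C" "sets N = sigma_sets ?\<Omega> ?C"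
    unfolding s sets_PiM_path_sigma[OF I] by simp_all
  fix X assume "X \<in> ?C"
  then obtain L where L: "X = cylinder I L" "\<forall>i\<in>I. timed_open (L i)" by blast
  show "emeasure M X = emeasure N X"
    unfolding L(1) cylinder_sort[of I L] using L(2) by (intro eq) (auto simp: timed_open_def)
next
  show "range (\<lambda>_::nat. cylinder I (\<lambda>_. [])) \<subseteq> {cylinder I L | L. \<forall>i\<in>I. timed_open (L i)}"
    by (auto simp: timed_open_def intro!: exI[of _ "\<lambda>_. []"])
  show "(\<Union>i::nat. cylinder I (\<lambda>_. [])) = PiE I (\<lambda>_. paths)" by (auto simp: cylinder_def)
  show "emeasure M (cylinder I (\<lambda>_. [])) \<noteq> \<infinity>" for i :: nat
    using finite_measure.emeasure_finite[OF fin] by simp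
qed

context feller_paths begin

definition particles :: "nat \<Rightarrow> (nat \<Rightarrow> 'a) \<Rightarrow> (nat \<Rightarrow> real \<Rightarrow> 'a) measure" where
  "particles n y = PiM {1..n} (\<lambda>i. Q (y i))"

definition raw_past :: "nat \<Rightarrow> real \<Rightarrow> (nat \<Rightarrow> real \<Rightarrow> 'a) measure" where
  "raw_past n q = PiM {1..n} (\<lambda>_. path_sigma {0..q})"

text \<open>
  The measure is restricted to the past before it is completed, so that only subsets of null sets of the past are
  added and every event remains almost surely equal to one of the past. This suffices to make meeting times
  stopping times.
\<close>

definition completed_past :: "nat \<Rightarrow> (nat \<Rightarrow> 'a) \<Rightarrow> real \<Rightarrow> (nat \<Rightarrow> real \<Rightarrow> 'a) measure" where
  "completed_past n y q = completion (restr_to_subalg (particles n y) (raw_past n q))"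

lemma sets_particles: "sets (particles n y) = sets (PiM {1..n} (\<lambda>_. path_sigma {0..}))"
  unfolding particles_def by (intro sets_PiM_cong refl sets_Q)

lemma space_particles: "space (particles n y) = PiE {1..n} (\<lambda>_. paths)"
  unfolding particles_def space_PiM by (simp add: space_Q)

lemma prob_particles: "prob_space (particles n y)"
  unfolding particles_def by (intro prob_space_PiM prob_Q)

lemma space_raw: "space (raw_past n q) = PiE {1..n} (\<lambda>_. paths)"
  by (simp add: raw_past_def space_PiM)

lemma sets_raw_mono: "q \<le> r \<Longrightarrow> sets (raw_past n q) \<subseteq> sets (raw_past n r)"
  unfolding raw_past_def
proof (rule sets_PiM_in_sets)
  assume qr: "q \<le> r"
  fix i and A :: "(real \<Rightarrow> 'a) set" assume i: "i \<in> {1..n}" and A: "A \<in> sets (path_sigma {0..q})"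
  have "A \<in> sets (path_sigma {0..r})" using A sets_path_sigma_mono[of "{0..q}" "{0..r}"] qr by auto
  from measurable_sets[OF measurable_component_singleton[OF i, of "\<lambda>_. path_sigma {0..r}"] this]
  show "{x \<in> space (PiM {1..n} (\<lambda>_. path_sigma {0..r})). x i \<in> A} \<in> sets (PiM {1..n} (\<lambda>_. path_sigma {0..r}))"
    by (simp add: vimage_def Int_def conj_commute)
qed (simp add: space_PiM)

lemma raw_subalgebra: "subalgebra (particles n y) (raw_past n q)"
  unfolding subalgebra_def
proof
  show "space (raw_past n q) = space (particles n y)" by (simp add: space_raw space_particles)
  show "sets (raw_past n q) \<subseteq> sets (particles n y)"
    unfolding raw_past_def sets_particles
  proof (rule sets_PiM_in_sets)
    fix i and A :: "(real \<Rightarrow> 'a) set" assume i: "i \<in> {1..n}" and A: "A \<in> sets (path_sigma {0..q})"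
    have "A \<in> sets (path_sigma {0..})" using A sets_path_sigma_mono[of "{0..q}" "{0..}"] by auto
    from measurable_sets[OF measurable_component_singleton[OF i, of "\<lambda>_. path_sigma {0..}"] this]
    show "{x \<in> space (PiM {1..n} (\<lambda>_. path_sigma {0..})). x i \<in> A} \<in> sets (PiM {1..n} (\<lambda>_. path_sigma {0..}))"
      by (simp add: vimage_def Int_def conj_commute)
  qed (simp add: space_PiM)
qed

lemma space_completed_past [simp]: "space (completed_past n y q) = PiE {1..n} (\<lambda>_. paths)"
  by (simp add: completed_past_def space_restr_to_subalg space_particles)

lemma completed_past_complete: "complete_measure (completed_past n y q)" and completed_past_finite: "finite_measure (completed_past n y q)"
proof -
  show "complete_measure (completed_past n y q)" unfolding completed_past_def by (rule completion.complete_measure_axioms)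
  have "finite_measure (restr_to_subalg (particles n y) (raw_past n q))"
    using finite_measure_restr_to_subalg[OF raw_subalgebra] prob_particles by (simp add: prob_space_def)
  then show "finite_measure (completed_past n y q)"
    unfolding completed_past_def by (intro finite_measureI) (simp add: finite_measure.emeasure_finite)
qed

lemma completed_past_mono: "q \<le> r \<Longrightarrow> sets (completed_past n y q) \<subseteq> sets (completed_past n y r)"
  unfolding completed_past_def by (intro sets_completion_restr_mono raw_subalgebra sets_raw_mono)

lemma completed_past_sets: "A \<in> sets (completed_past n y q) \<Longrightarrow> A \<in> sets (completion (particles n y))"
  unfolding completed_past_def by (rule sets_completion_sub(1)[OF raw_subalgebra])

lemma completed_past_measurable_mono: "f \<in> completed_past n y q \<rightarrow>\<^sub>M N \<Longrightarrow> q \<le> r \<Longrightarrow> f \<in> completed_past n y r \<rightarrow>\<^sub>M N"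
  using completed_past_mono[of q r n y] unfolding measurable_def by auto

lemma completed_past_measurable_completion: "f \<in> completed_past n y q \<rightarrow>\<^sub>M N \<Longrightarrow> f \<in> completion (particles n y) \<rightarrow>\<^sub>M N"
proof (rule measurableI)
  assume f: "f \<in> completed_past n y q \<rightarrow>\<^sub>M N"
  show "f x \<in> space N" if "x \<in> space (completion (particles n y))" for x
    using measurable_space[OF f, of x] that by (simp add: space_particles)
  show "f -` A \<inter> space (completion (particles n y)) \<in> sets (completion (particles n y))" if "A \<in> sets N" for A
    using completed_past_sets[OF measurable_sets[OF f that]] by (simp add: space_particles)
qed

lemma particle_completed_past:
  assumes "i \<in> {1..n}" "0 \<le> t" "t \<le> q"
  shows "(\<lambda>\<omega>. \<omega> i t) \<in> borel_measurable (completed_past n y q)"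
proof -
  have "(\<lambda>\<omega>. \<omega> i t) \<in> borel_measurable (raw_past n q)"
    unfolding raw_past_def
    by (rule measurable_compose[OF measurable_component_singleton[OF assms(1)] measurable_path_sigma_component])
      (use assms in auto)
  then have "(\<lambda>\<omega>. \<omega> i t) \<in> borel_measurable (restr_to_subalg (particles n y) (raw_past n q))"
    using sets_restr_to_subalg[OF raw_subalgebra[of n y q]] by (simp cong: measurable_cong_sets)
  then show ?thesis unfolding completed_past_def by (rule measurable_completion)
qed

lemma particle_paths: "\<omega> \<in> PiE {1..n} (\<lambda>_. paths) \<Longrightarrow> i \<in> {1..n} \<Longrightarrow> \<omega> i \<in> paths"
  by (rule PiE_mem)

lemma particle_cadlag: "\<omega> \<in> PiE {1..n} (\<lambda>_. paths) \<Longrightarrow> i \<in> {1..n} \<Longrightarrow> cadlag (\<omega> i)"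
  using particle_paths by (auto simp: paths_def)

section \<open>Stopping times\<close>

definition stopping :: "nat \<Rightarrow> (nat \<Rightarrow> 'a) \<Rightarrow> ((nat \<Rightarrow> real \<Rightarrow> 'a) \<Rightarrow> ereal) \<Rightarrow> bool" where
  "stopping n y T \<longleftrightarrow> (\<forall>\<omega>. 0 \<le> T \<omega>) \<and>
     (\<forall>t\<ge>0. {\<omega> \<in> PiE {1..n} (\<lambda>_. paths). T \<omega> \<le> ereal t} \<in> sets (completed_past n y t))"

lemma stopping_le: "stopping n y T \<Longrightarrow> 0 \<le> t \<Longrightarrow> t \<le> q \<Longrightarrow>
    {\<omega> \<in> PiE {1..n} (\<lambda>_. paths). T \<omega> \<le> ereal t} \<in> sets (completed_past n y q)"
  using completed_past_mono unfolding stopping_def by blast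

lemma stopping_less_const:
  assumes T: "stopping n y T" and q: "0 \<le> q"
  shows "{\<omega> \<in> PiE {1..n} (\<lambda>_. paths). T \<omega> < ereal q} \<in> sets (completed_past n y q)"
proof -
  let ?\<Omega> = "PiE {1..n} (\<lambda>_. paths :: (real \<Rightarrow> 'a) set)"
  have "{\<omega> \<in> ?\<Omega>. T \<omega> < ereal q} = (\<Union>r\<in>\<rat> \<inter> {0..<q}. {\<omega> \<in> ?\<Omega>. T \<omega> \<le> ereal r})"
  proof (intro equalityI subsetI)
    fix \<omega> assume \<omega>: "\<omega> \<in> {\<omega> \<in> ?\<Omega>. T \<omega> < ereal q}"
    have "0 \<le> T \<omega>" using T by (simp add: stopping_def)
    then obtain s where s: "T \<omega> = ereal s" "0 \<le> s" "s < q"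
      using \<omega> by (cases "T \<omega>") auto
    obtain r where "r \<in> \<rat>" "s < r" "r < q" using Rats_dense_in_real[OF s(3)] by blast
    then show "\<omega> \<in> (\<Union>r\<in>\<rat> \<inter> {0..<q}. {\<omega> \<in> ?\<Omega>. T \<omega> \<le> ereal r})"
      using \<omega> s by (auto intro!: bexI[of _ r])
  next
    fix \<omega> assume "\<omega> \<in> (\<Union>r\<in>\<rat> \<inter> {0..<q}. {\<omega> \<in> ?\<Omega>. T \<omega> \<le> ereal r})"
    then obtain r where r: "r \<in> \<rat>" "0 \<le> r" "r < q" "\<omega> \<in> ?\<Omega>" "T \<omega> \<le> ereal r" by auto
    have "T \<omega> < ereal q" using r(5,3) by (meson ereal_less_eq(3) le_less_trans less_ereal.simps(1))
    then show "\<omega> \<in> {\<omega> \<in> ?\<Omega>. T \<omega> < ereal q}" using r by simp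
  qed
  also have "\<dots> \<in> sets (completed_past n y q)"
  proof (rule sets.countable_UN'')
    show "countable (\<rat> \<inter> {0..<q})" using countable_rat by (rule countable_subset[rotated]) auto
    fix r assume "r \<in> \<rat> \<inter> {0..<q}"
    then show "{\<omega> \<in> ?\<Omega>. T \<omega> \<le> ereal r} \<in> sets (completed_past n y q)" by (intro stopping_le[OF T]) auto
  qed
  finally show ?thesis .
qed

lemma stopping_less:
  assumes S: "stopping n y S" and T: "stopping n y T" and t: "0 \<le> t"
  shows "{\<omega> \<in> PiE {1..n} (\<lambda>_. paths). S \<omega> \<le> ereal t \<and> S \<omega> < T \<omega>} \<in> sets (completed_past n y t)"
proof -
  let ?\<Omega> = "PiE {1..n} (\<lambda>_. paths :: (real \<Rightarrow> 'a) set)"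
  let ?le = "\<lambda>T r. {\<omega> \<in> ?\<Omega>. T \<omega> \<le> ereal r}"
  have "{\<omega> \<in> ?\<Omega>. S \<omega> \<le> ereal t \<and> S \<omega> < T \<omega>} =
      (?le S t - ?le T t) \<union> (\<Union>r\<in>\<rat> \<inter> {0..t}. ?le T t \<inter> (?le S r - ?le T r))"
  proof (intro equalityI subsetI)
    fix \<omega> assume \<omega>: "\<omega> \<in> {\<omega> \<in> ?\<Omega>. S \<omega> \<le> ereal t \<and> S \<omega> < T \<omega>}"
    show "\<omega> \<in> (?le S t - ?le T t) \<union> (\<Union>r\<in>\<rat> \<inter> {0..t}. ?le T t \<inter> (?le S r - ?le T r))"
    proof (cases "T \<omega> \<le> ereal t")
      case False then show ?thesis using \<omega> by auto
    next
      case True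
      have "0 \<le> S \<omega>" using S by (simp add: stopping_def)
      then obtain s where s: "S \<omega> = ereal s" "0 \<le> s" using \<omega> by (cases "S \<omega>") auto
      obtain u where u: "T \<omega> = ereal u" "s < u" "u \<le> t" using \<omega> True s by (cases "T \<omega>") auto
      obtain r where "r \<in> \<rat>" "s < r" "r < u" using Rats_dense_in_real[OF u(2)] by blast
      then show ?thesis using \<omega> s u by (auto intro!: bexI[of _ r])
    qed
  next
    fix \<omega> assume "\<omega> \<in> (?le S t - ?le T t) \<union> (\<Union>r\<in>\<rat> \<inter> {0..t}. ?le T t \<inter> (?le S r - ?le T r))"
    then show "\<omega> \<in> {\<omega> \<in> ?\<Omega>. S \<omega> \<le> ereal t \<and> S \<omega> < T \<omega>}"
      by (auto simp: not_le intro: le_less_trans order.trans less_le_trans)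
  qed
  also have "\<dots> \<in> sets (completed_past n y t)"
  proof (rule sets.Un)
    show "?le S t - ?le T t \<in> sets (completed_past n y t)"
      by (intro sets.Diff stopping_le[OF S] stopping_le[OF T] t order_refl)
    show "(\<Union>r\<in>\<rat> \<inter> {0..t}. ?le T t \<inter> (?le S r - ?le T r)) \<in> sets (completed_past n y t)"
    proof (rule sets.countable_UN'')
      show "countable (\<rat> \<inter> {0..t})" using countable_rat by (rule countable_subset[rotated]) auto
      fix r assume "r \<in> \<rat> \<inter> {0..t}"
      then show "?le T t \<inter> (?le S r - ?le T r) \<in> sets (completed_past n y t)"
        using t by (intro sets.Int sets.Diff stopping_le[OF S] stopping_le[OF T]) auto
    qed
  qed
  finally show ?thesis .
qed

lemma stopping_leq:
  assumes S: "stopping n y S" and T: "stopping n y T" and t: "0 \<le> t"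
  shows "{\<omega> \<in> PiE {1..n} (\<lambda>_. paths). S \<omega> \<le> ereal t \<and> S \<omega> \<le> T \<omega>} \<in> sets (completed_past n y t)"
proof -
  let ?\<Omega> = "PiE {1..n} (\<lambda>_. paths :: (real \<Rightarrow> 'a) set)"
  have "{\<omega> \<in> ?\<Omega>. S \<omega> \<le> ereal t \<and> S \<omega> \<le> T \<omega>} =
     {\<omega> \<in> ?\<Omega>. S \<omega> \<le> ereal t} - {\<omega> \<in> ?\<Omega>. T \<omega> \<le> ereal t \<and> T \<omega> < S \<omega>}"
    by (auto simp: not_less intro: order.trans)
  then show ?thesis using stopping_le[OF S t order_refl] stopping_less[OF T S t] by auto
qed

text \<open>
  The meeting by time \<open>t\<close> involves positions up to \<open>t\<close> only, so
  \<open>meeting_event_measurable\<close> applies within the completed past at \<open>t\<close>, which is a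
  complete measure space.
\<close>

lemma stopping_first_meeting:
  fixes a b :: "real \<Rightarrow> (nat \<Rightarrow> real \<Rightarrow> 'a) \<Rightarrow> 'a"
  assumes m: "\<And>t. 0 \<le> t \<Longrightarrow> a t \<in> borel_measurable (completed_past n y t)" "\<And>t. 0 \<le> t \<Longrightarrow> b t \<in> borel_measurable (completed_past n y t)"
    and c: "\<And>\<omega>. \<omega> \<in> PiE {1..n} (\<lambda>_. paths) \<Longrightarrow> cadlag (\<lambda>t. a t \<omega>)" "\<And>\<omega>. \<omega> \<in> PiE {1..n} (\<lambda>_. paths) \<Longrightarrow> cadlag (\<lambda>t. b t \<omega>)"
  shows "stopping n y (\<lambda>\<omega>. first_time (\<lambda>t. a t \<omega> = b t \<omega>))"
  unfolding stopping_def
proof (intro conjI allI impI first_time_nonneg)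
  fix t :: real assume t: "0 \<le> t"
  have "{\<omega> \<in> space (completed_past n y t). \<exists>s\<in>{0..t}. a s \<omega> = b s \<omega>} \<in> sets (completed_past n y t)"
    by (rule meeting_event_measurable[OF completed_past_complete completed_past_finite])
      (use m c in \<open>auto intro: completed_past_measurable_mono simp: cadlag_def\<close>)
  moreover have "{\<omega> \<in> space (completed_past n y t). \<exists>s\<in>{0..t}. a s \<omega> = b s \<omega>} =
      {\<omega> \<in> PiE {1..n} (\<lambda>_. paths). first_time (\<lambda>t. a t \<omega> = b t \<omega>) \<le> ereal t}"
  proof (unfold space_completed_past, rule Collect_cong, rule conj_cong[OF refl])
    fix \<omega> assume \<omega>: "\<omega> \<in> PiE {1..n} (\<lambda>_. paths :: (real \<Rightarrow> 'a) set)"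
    show "(\<exists>s\<in>{0..t}. a s \<omega> = b s \<omega>) \<longleftrightarrow> first_time (\<lambda>t. a t \<omega> = b t \<omega>) \<le> ereal t"
      using first_time_le_iff[OF right_closed_eq[OF cadlag_right_cont[OF c(1)[OF \<omega>]] cadlag_right_cont[OF c(2)[OF \<omega>]]]]
      by blast
  qed
  ultimately show "{\<omega> \<in> PiE {1..n} (\<lambda>_. paths). first_time (\<lambda>t. a t \<omega> = b t \<omega>) \<le> ereal t} \<in> sets (completed_past n y t)"
    by simp
qed

section \<open>Measurability of the coalescing system\<close>

abbreviation "pspace n \<equiv> PiE {1..n} (\<lambda>_. paths :: (real \<Rightarrow> 'a) set)"

lemma
  assumes \<omega>: "\<omega> \<in> pspace n"
  shows pspace_joined: "i \<in> {1..n} \<Longrightarrow> joined (coalesce \<omega> ` {1..<i}) (\<omega> i) (coalesce \<omega> i)"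
    and pspace_cadlag: "i \<in> {1..n} \<Longrightarrow> cadlag (coalesce \<omega> i)"
    and pspace_coalescent: "i \<le> Suc n \<Longrightarrow> coalescent (coalesce \<omega> ` {1..<i})"
    and pspace_right_closed: "i \<in> {1..n} \<Longrightarrow> right_closed (meets (coalesce \<omega> ` {1..<i}) (\<omega> i))"
  using coalesce_joined[of n \<omega>] coalesce_cadlag[of n \<omega>] coalesce_coalescent[of n \<omega>] coalesce_right_closed[of n \<omega>]
    particle_cadlag[OF \<omega>] by blast+

text \<open>
  Whether particle \<open>i\<close> has met particle \<open>j\<close> by time \<open>t\<close>, and which of the
  earlier particles it has met first, can be read off from the stopping times \<open>\<tau> j\<close>. The event
  that its position is in \<open>G\<close> is then decomposed according to the particle \<open>j\<close> that it
  follows; if several are met at the same time, all of them lead to the same position.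
\<close>

lemma coalesce_adapted:
  assumes "i \<in> {1..n}" "0 \<le> t"
  shows "(\<lambda>\<omega>. coalesce \<omega> i t) \<in> borel_measurable (completed_past n y t)"
  using assms
proof (induction i arbitrary: t rule: less_induct)
  case (less i)
  define \<tau> where "\<tau> j \<omega> = first_time (\<lambda>s. \<omega> i s = coalesce \<omega> j s)" for j and \<omega> :: "nat \<Rightarrow> real \<Rightarrow> 'a"
  have st: "stopping n y (\<tau> j)" if "j \<in> {1..<i}" for j
    unfolding \<tau>_def using that less.prems(1)
    by (intro stopping_first_meeting particle_completed_past less.IH pspace_cadlag particle_cadlag) auto
  show ?case
  proof (rule borel_measurableI)
    fix G :: "'a set" assume G: "open G"
    let ?X = "{\<omega> \<in> pspace n. \<forall>j\<in>{1..<i}. \<not> \<tau> j \<omega> \<le> ereal t} \<inter> {\<omega> \<in> pspace n. \<omega> i t \<in> G}"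
    let ?Y = "\<lambda>j. {\<omega> \<in> pspace n. \<tau> j \<omega> \<le> ereal t} \<inter>
       (\<Inter>j'\<in>{1..<i}. {\<omega> \<in> pspace n. \<tau> j \<omega> \<le> ereal t \<and> \<tau> j \<omega> \<le> \<tau> j' \<omega>}) \<inter>
       {\<omega> \<in> pspace n. coalesce \<omega> j t \<in> G}"
    have key: "coalesce \<omega> i t \<in> G \<longleftrightarrow> \<omega> \<in> ?X \<union> (\<Union>j\<in>{1..<i}. ?Y j)" if \<omega>: "\<omega> \<in> pspace n" for \<omega>
    proof -
      let ?Z = "coalesce \<omega> ` {1..<i}"
      have rc: "right_closed (\<lambda>s. \<omega> i s = coalesce \<omega> j s)" if "j \<in> {1..<i}" for j
        using that less.prems(1) \<omega>
        by (intro right_closed_eq cadlag_right_cont particle_cadlag[OF \<omega>] pspace_cadlag[OF \<omega>]) auto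
      show ?thesis
        using pspace_right_closed[OF \<omega> less.prems(1)] less.prems(2)
      proof (cases rule: first_meeting_cases)
        case none
        have "\<not> \<tau> j \<omega> \<le> ereal t" if "j \<in> {1..<i}" for j
          unfolding \<tau>_def first_time_le_iff[OF rc[OF that]] using none that by (auto simp: meets_def)
        moreover have "coalesce \<omega> i t = \<omega> i t"
          using joinedD1[OF pspace_joined[OF \<omega> less.prems(1)] less.prems(2)] none by auto
        ultimately show ?thesis using \<omega> by auto
      next
        case (first s)
        have att: "coalesce \<omega> i t = coalesce \<omega> j t" if "j \<in> {1..<i}" "\<omega> i s = coalesce \<omega> j s" for j
        proof (rule joined_after[OF pspace_joined[OF \<omega> less.prems(1)] _ first(1)])
          show "coalescent ?Z" using less.prems(1) by (intro pspace_coalescent[OF \<omega>]) auto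
        qed (use that first in auto)
        have \<tau>s: "\<tau> j \<omega> = ereal s" if j: "j \<in> {1..<i}" "\<omega> i s = coalesce \<omega> j s" for j
        proof -
          obtain s' where s': "\<tau> j \<omega> = ereal s'" "0 \<le> s'" "s' \<le> s" "\<omega> i s' = coalesce \<omega> j s'"
            using first_time_attained[OF rc[OF j(1)] first(1) j(2)] unfolding \<tau>_def by metis
          then have "meets ?Z (\<omega> i) s'" using j(1) by (auto simp: meets_def)
          then have "\<not> s' < s" using first(4)[of s'] s'(2) by blast
          then show ?thesis using s' by simp
        qed
        have s\<tau>: "ereal s \<le> \<tau> j \<omega>" if "j \<in> {1..<i}" for j
        proof (rule ccontr)
          assume "\<not> ereal s \<le> \<tau> j \<omega>"
          then obtain u where u: "\<tau> j \<omega> = ereal u" "u < s"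
            using first_time_nonneg[of "\<lambda>s. \<omega> i s = coalesce \<omega> j s"] unfolding \<tau>_def
            by (cases "first_time (\<lambda>s. \<omega> i s = coalesce \<omega> j s)") auto
          have "0 \<le> u" "\<omega> i u = coalesce \<omega> j u"
            using first_time_eqD[OF rc[OF that]] u(1) unfolding \<tau>_def by blast+
          then have "meets ?Z (\<omega> i) u" using that by (auto simp: meets_def)
          then show False using first(4)[of u] u \<open>0 \<le> u\<close> by blast
        qed
        obtain j0 where j0: "j0 \<in> {1..<i}" "\<omega> i s = coalesce \<omega> j0 s"
          using first(3) by (auto simp: meets_def)
        have \<tau>0: "\<tau> j0 \<omega> = ereal s" by (rule \<tau>s[OF j0])
        have "\<exists>j\<in>{1..<i}. \<tau> j \<omega> \<le> ereal t"
          using j0(1) \<tau>0 first(2) by (intro bexI[of _ j0]) auto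
        then have nX: "\<omega> \<notin> ?X" by blast
        have Y: "\<omega> \<in> ?Y j \<longleftrightarrow> \<omega> i s = coalesce \<omega> j s \<and> coalesce \<omega> j t \<in> G" if j: "j \<in> {1..<i}" for j
        proof
          assume Yj: "\<omega> \<in> ?Y j"
          then have "\<tau> j \<omega> \<le> \<tau> j0 \<omega>" using j0(1) by auto
          then have "\<tau> j \<omega> = ereal s" using s\<tau>[OF j] \<tau>0 by simp
          then have "\<omega> i s = coalesce \<omega> j s"
            using first_time_eqD(2)[OF rc[OF j]] unfolding \<tau>_def by blast
          then show "\<omega> i s = coalesce \<omega> j s \<and> coalesce \<omega> j t \<in> G" using Yj by auto
        next
          assume a: "\<omega> i s = coalesce \<omega> j s \<and> coalesce \<omega> j t \<in> G"
          then have "\<tau> j \<omega> = ereal s" using \<tau>s[OF j] by blast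
          then show "\<omega> \<in> ?Y j" using a \<omega> s\<tau> first(2) by auto
        qed
        have "(\<omega> \<in> (\<Union>j\<in>{1..<i}. ?Y j)) \<longleftrightarrow> coalesce \<omega> i t \<in> G"
        proof
          assume "\<omega> \<in> (\<Union>j\<in>{1..<i}. ?Y j)"
          then obtain j where "j \<in> {1..<i}" "\<omega> \<in> ?Y j" by blast
          then show "coalesce \<omega> i t \<in> G" using Y[of j] att[of j] by simp
        next
          assume "coalesce \<omega> i t \<in> G"
          then have "\<omega> \<in> ?Y j0" using Y[OF j0(1)] att[OF j0] j0(2) by simp
          then show "\<omega> \<in> (\<Union>j\<in>{1..<i}. ?Y j)" using j0(1) by blast
        qed
        then show ?thesis using nX by blast
      qed
    qed
    have "(\<lambda>\<omega>. coalesce \<omega> i t) -` G \<inter> space (completed_past n y t) = ?X \<union> (\<Union>j\<in>{1..<i}. ?Y j)"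
    proof (intro equalityI subsetI)
      fix \<omega> assume "\<omega> \<in> (\<lambda>\<omega>. coalesce \<omega> i t) -` G \<inter> space (completed_past n y t)"
      then show "\<omega> \<in> ?X \<union> (\<Union>j\<in>{1..<i}. ?Y j)" using key[of \<omega>] by simp
    next
      fix \<omega> assume a: "\<omega> \<in> ?X \<union> (\<Union>j\<in>{1..<i}. ?Y j)"
      then have "\<omega> \<in> pspace n" by blast
      then show "\<omega> \<in> (\<lambda>\<omega>. coalesce \<omega> i t) -` G \<inter> space (completed_past n y t)" using key[of \<omega>] a by simp
    qed
    also have "\<dots> \<in> sets (completed_past n y t)"
    proof (rule sets.Un)
      have "{\<omega> \<in> space (completed_past n y t). \<forall>j\<in>{1..<i}. \<not> \<tau> j \<omega> \<le> ereal t} \<in> sets (completed_past n y t)"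
      proof (rule sets.sets_Collect_finite_All)
        fix j assume "j \<in> {1..<i}"
        from stopping_le[OF st[OF this] less.prems(2) order_refl]
        show "{\<omega> \<in> space (completed_past n y t). \<not> \<tau> j \<omega> \<le> ereal t} \<in> sets (completed_past n y t)"
          by (intro sets.sets_Collect_neg) simp
      qed simp
      moreover have "{\<omega> \<in> pspace n. \<omega> i t \<in> G} \<in> sets (completed_past n y t)"
        using measurable_sets[OF particle_completed_past[OF less.prems order_refl], of G] G
        by (simp add: vimage_def Int_def conj_commute)
      ultimately show "?X \<in> sets (completed_past n y t)" by (intro sets.Int) simp_all
      show "(\<Union>j\<in>{1..<i}. ?Y j) \<in> sets (completed_past n y t)"
      proof (rule sets.finite_UN)
        fix j assume j: "j \<in> {1..<i}"
        have "{\<omega> \<in> pspace n. coalesce \<omega> j t \<in> G} \<in> sets (completed_past n y t)"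
          using measurable_sets[OF less.IH[of j t], of G] G j less.prems
          by (simp add: vimage_def Int_def conj_commute)
        then show "?Y j \<in> sets (completed_past n y t)"
          using stopping_le[OF st[OF j] less.prems(2) order_refl] stopping_leq[OF st[OF j] st less.prems(2)] j
          by (intro sets.Int sets.finite_INT) auto
      qed simp
    qed
    finally show "(\<lambda>\<omega>. coalesce \<omega> i t) -` G \<inter> space (completed_past n y t) \<in> sets (completed_past n y t)" .
  qed
qed

lemma swap_time_stopping:
  assumes k: "1 \<le> k" "Suc k \<le> n"
  shows "stopping n y (\<lambda>\<omega>. swap_time (coalesce \<omega> ` {1..<k}) (\<omega> k) (\<omega> (Suc k)))" (is "stopping n y ?T")
proof -
  let ?\<rho> = "\<lambda>\<omega>::nat \<Rightarrow> real \<Rightarrow> 'a. first_time (\<lambda>t. \<omega> k t = \<omega> (Suc k) t)"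
  let ?\<sigma> = "\<lambda>\<omega>. first_time (\<lambda>t. meets (coalesce \<omega> ` {1..<k}) (\<omega> k) t \<or> meets (coalesce \<omega> ` {1..<k}) (\<omega> (Suc k)) t)"
  have \<rho>: "stopping n y ?\<rho>"
  proof (rule stopping_first_meeting[of "\<lambda>t \<omega>. \<omega> k t" n y "\<lambda>t \<omega>. \<omega> (Suc k) t"])
    have i: "k \<in> {1..n}" "Suc k \<in> {1..n}" using k by auto
    show "(\<lambda>\<omega>. \<omega> k t) \<in> borel_measurable (completed_past n y t)" "(\<lambda>\<omega>. \<omega> (Suc k) t) \<in> borel_measurable (completed_past n y t)" if "0 \<le> t" for t
      using particle_completed_past[OF i(1) that order_refl] particle_completed_past[OF i(2) that order_refl] by auto
    show "cadlag (\<lambda>t. \<omega> k t)" "cadlag (\<lambda>t. \<omega> (Suc k) t)" if "\<omega> \<in> pspace n" for \<omega>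
      using particle_cadlag[OF that i(1)] particle_cadlag[OF that i(2)] by simp_all
  qed
  have st: "stopping n y (\<lambda>\<omega>. first_time (\<lambda>t. \<omega> i t = coalesce \<omega> j t))" if "i \<in> {k, Suc k}" "j \<in> {1..<k}" for i j
  proof (rule stopping_first_meeting[of "\<lambda>t \<omega>. \<omega> i t" n y "\<lambda>t \<omega>. coalesce \<omega> j t"])
    have i: "i \<in> {1..n}" "j \<in> {1..n}" using k that by auto
    show "(\<lambda>\<omega>. \<omega> i t) \<in> borel_measurable (completed_past n y t)" "(\<lambda>\<omega>. coalesce \<omega> j t) \<in> borel_measurable (completed_past n y t)" if "0 \<le> t" for t
      using particle_completed_past[OF i(1) that order_refl] coalesce_adapted[OF i(2) that] by auto
    show "cadlag (\<lambda>t. \<omega> i t)" "cadlag (\<lambda>t. coalesce \<omega> j t)" if "\<omega> \<in> pspace n" for \<omega>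
      using particle_cadlag[OF that i(1)] pspace_cadlag[OF that i(2)] by simp_all
  qed
  have \<sigma>: "stopping n y ?\<sigma>"
    unfolding stopping_def
  proof (intro conjI allI impI first_time_nonneg)
    fix t :: real assume t: "0 \<le> t"
    have "{\<omega> \<in> pspace n. ?\<sigma> \<omega> \<le> ereal t} =
        {\<omega> \<in> pspace n. \<exists>i\<in>{k, Suc k}. \<exists>j\<in>{1..<k}. first_time (\<lambda>t. \<omega> i t = coalesce \<omega> j t) \<le> ereal t}"
    proof (rule Collect_cong, rule conj_cong[OF refl])
      fix \<omega> assume \<omega>: "\<omega> \<in> pspace n"
      have c1: "right_cont (\<omega> i)" if "i \<in> {k, Suc k}" for i
        using k that by (intro cadlag_right_cont particle_cadlag[OF \<omega>]) auto
      have c2: "right_cont (coalesce \<omega> j)" if "j \<in> {1..<k}" for j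
        using k that by (intro cadlag_right_cont pspace_cadlag[OF \<omega>]) auto
      have eq: "first_time (\<lambda>t. \<omega> i t = coalesce \<omega> j t) \<le> ereal t \<longleftrightarrow> (\<exists>s\<in>{0..t}. \<omega> i s = coalesce \<omega> j s)"
        if "i \<in> {k, Suc k}" "j \<in> {1..<k}" for i j
        by (rule first_time_le_iff[OF right_closed_eq[OF c1[OF that(1)] c2[OF that(2)]]])
      have "right_closed (meets (coalesce \<omega> ` {1..<k}) (\<omega> i))" if "i \<in> {k, Suc k}" for i
        using c2 by (intro right_closed_meets c1[OF that]) auto
      then have "?\<sigma> \<omega> \<le> ereal t \<longleftrightarrow> (\<exists>s\<in>{0..t}. meets (coalesce \<omega> ` {1..<k}) (\<omega> k) s \<or> meets (coalesce \<omega> ` {1..<k}) (\<omega> (Suc k)) s)"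
        by (intro first_time_le_iff right_closed_disj) auto
      also have "\<dots> \<longleftrightarrow> (\<exists>i\<in>{k, Suc k}. \<exists>j\<in>{1..<k}. \<exists>s\<in>{0..t}. \<omega> i s = coalesce \<omega> j s)"
        by (auto simp: meets_def)
      also have "\<dots> \<longleftrightarrow> (\<exists>i\<in>{k, Suc k}. \<exists>j\<in>{1..<k}. first_time (\<lambda>t. \<omega> i t = coalesce \<omega> j t) \<le> ereal t)"
        using eq by blast
      finally show "?\<sigma> \<omega> \<le> ereal t \<longleftrightarrow> (\<exists>i\<in>{k, Suc k}. \<exists>j\<in>{1..<k}. first_time (\<lambda>t. \<omega> i t = coalesce \<omega> j t) \<le> ereal t)" .
    qed
    also have "\<dots> \<in> sets (completed_past n y t)"
    proof -
      have "{\<omega> \<in> space (completed_past n y t). \<exists>i\<in>{k, Suc k}. \<exists>j\<in>{1..<k}. first_time (\<lambda>t. \<omega> i t = coalesce \<omega> j t) \<le> ereal t} \<in> sets (completed_past n y t)"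
        using stopping_le[OF st t order_refl] by (intro sets.sets_Collect_finite_Ex) simp_all
      then show ?thesis by simp
    qed
    finally show "{\<omega> \<in> pspace n. ?\<sigma> \<omega> \<le> ereal t} \<in> sets (completed_past n y t)" .
  qed
  have "{\<omega> \<in> pspace n. ?T \<omega> \<le> ereal t} = {\<omega> \<in> pspace n. ?\<rho> \<omega> \<le> ereal t \<and> ?\<rho> \<omega> < ?\<sigma> \<omega>}" for t
    by (auto simp: swap_time_def)
  moreover have "0 \<le> ?T \<omega>" for \<omega>
    unfolding swap_time_def using first_time_nonneg by auto
  ultimately show ?thesis using stopping_less[OF \<rho> \<sigma>] by (simp add: stopping_def)
qed

end

section \<open>The strong Markov property for exchanged paths\<close>

lemma prod_le_1_ennreal:
  fixes f :: "'i \<Rightarrow> ennreal"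
  assumes "finite I" "\<And>i. i \<in> I \<Longrightarrow> f i \<le> 1"
  shows "prod f I \<le> 1"
  using assms
proof (induction I rule: finite_induct)
  case (insert i I)
  then have "f i * prod f I \<le> 1 * 1" by (intro mult_mono) auto
  then show ?case using insert.hyps by simp
qed simp

lemma path_prod_split:
  assumes "\<And>t f. (t, f) \<in> set L \<Longrightarrow> (t < q \<longrightarrow> w t = u t) \<and> (q \<le> t \<longrightarrow> w t = v t)"
  shows "path_prod L w = path_prod (filter (\<lambda>x. fst x < q) L) u * path_prod (filter (\<lambda>x. q \<le> fst x) L) v"
  using assms
proof (induction L)
  case (Cons a L)
  obtain t f where a: "a = (t, f)" by (cases a)
  have IH: "path_prod L w = path_prod (filter (\<lambda>x. fst x < q) L) u * path_prod (filter (\<lambda>x. q \<le> fst x) L) v"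
    using Cons.prems by (intro Cons.IH) auto
  show ?case
    using Cons.prems[of t f] IH by (cases "t < q") (auto simp: a not_less)
qed simp

lemma timed_C0_filter:
  assumes "timed_C0 r L"
  shows "timed_C0 r (filter P L)"
  using assms
proof (induction r L rule: timed_C0.induct)
  case (2 q t f L)
  then show ?case using timed_C0_mono[of t "filter P L" q] by auto
qed simp

lemma timed_C0_later:
  assumes "timed_C0 r L" "\<And>x. x \<in> set L \<Longrightarrow> q \<le> fst x"
  shows "timed_C0 q L"
proof (cases L)
  case (Cons x L')
  then show ?thesis using assms(1) assms(2)[of x] by (cases x) auto
qed simp

lemma timed_C0_times: "timed_C0 r L \<Longrightarrow> x \<in> set L \<Longrightarrow> r \<le> fst x"
  by (induction r L rule: timed_C0.induct) (auto intro: order.trans)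

lemma timed_C0_filter_later: "timed_C0 r L \<Longrightarrow> timed_C0 q (filter (\<lambda>x. q \<le> fst x) L)"
  by (rule timed_C0_later[OF timed_C0_filter]) auto

context feller_paths begin

lemma particles_integral_prod:
  assumes "\<And>i. i \<in> {1..n} \<Longrightarrow> g i \<in> borel_measurable (path_sigma {0..})"
  shows "(\<integral>\<^sup>+\<omega>. (\<Prod>i\<in>{1..n}. g i (\<omega> i)) \<partial>particles n y) = (\<Prod>i\<in>{1..n}. \<integral>\<^sup>+w. g i w \<partial>Q (y i))"
proof -
  interpret prob_space "Q x" for x by (rule prob_Q)
  interpret product_sigma_finite "\<lambda>i. Q (y i)" by unfold_locales
  show ?thesis
    unfolding particles_def using assms by (intro product_nn_integral_prod) (auto intro: measurable_Q)
qed

text \<open>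
  Both sides, as functions of \<open>A\<close>, are measures on the past. On rectangles they factor over the
  particles because these are independent, so the Markov property of a single path shows that they are equal
  there, and rectangles generate the past.
\<close>

lemma particles_markov:
  assumes q: "0 \<le> q" and A: "A \<in> sets (raw_past n q)"
    and L1: "\<And>i. i \<in> {1..n} \<Longrightarrow> timed_C0 0 (L1 i)" "\<And>i x. i \<in> {1..n} \<Longrightarrow> x \<in> set (L1 i) \<Longrightarrow> fst x \<le> q"
    and L2: "\<And>i. i \<in> {1..n} \<Longrightarrow> timed_C0 q (L2 i)"
  shows "(\<integral>\<^sup>+\<omega>. indicator A \<omega> * (\<Prod>i\<in>{1..n}. ennreal (path_prod (L1 i) (\<omega> i) * path_prod (L2 i) (\<omega> i))) \<partial>particles n y) =
    (\<integral>\<^sup>+\<omega>. indicator A \<omega> * (\<Prod>i\<in>{1..n}. ennreal (path_prod (L1 i) (\<omega> i) * cond_prod q (L2 i) (\<omega> i q))) \<partial>particles n y)"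
proof -
  let ?M = "particles n y"
  interpret M: prob_space ?M by (rule prob_particles)
  define g1 where "g1 i w = ennreal (path_prod (L1 i) w * path_prod (L2 i) w)" for i w
  define g2 where "g2 i w = ennreal (path_prod (L1 i) w * cond_prod q (L2 i) (w q))" for i w
  have m1q: "path_prod (L1 i) \<in> borel_measurable (path_sigma {0..q})" if "i \<in> {1..n}" for i
    using L1(1)[OF that] L1(2)[OF that] timed_C0_times[OF L1(1)[OF that]]
    by (intro path_prod_measurable[of 0]) force+
  have m1: "path_prod (L1 i) \<in> borel_measurable (path_sigma {0..})" if "i \<in> {1..n}" for i
    by (rule measurable_path_sigma_mono[OF m1q[OF that]]) auto
  have m2: "path_prod (L2 i) \<in> borel_measurable (path_sigma {0..})" if "i \<in> {1..n}" for i
    using timed_C0_times[OF L2[OF that]] q by (intro path_prod_measurable[OF L2[OF that]]) force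
  have m3: "(\<lambda>w. cond_prod q (L2 i) (w q)) \<in> borel_measurable (path_sigma {0..})" if "i \<in> {1..n}" for i
    by (rule measurable_compose[OF measurable_path_sigma_component cond_prod_measurable[OF L2[OF that]]]) (use q in auto)
  have g1m: "g1 i \<in> borel_measurable (path_sigma {0..})" if "i \<in> {1..n}" for i
    unfolding g1_def using m1[OF that] m2[OF that] by measurable
  have g2m: "g2 i \<in> borel_measurable (path_sigma {0..})" if "i \<in> {1..n}" for i
    unfolding g2_def using m1[OF that] m3[OF that] by measurable
  have comp: "(\<lambda>\<omega>. \<omega> i) \<in> ?M \<rightarrow>\<^sub>M path_sigma {0..}" if "i \<in> {1..n}" for i
    using measurable_component_singleton[OF that, of "\<lambda>_. path_sigma {0..}"] sets_particles[of n y]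
    by (simp cong: measurable_cong_sets)
  have G1: "(\<lambda>\<omega>. \<Prod>i\<in>{1..n}. g1 i (\<omega> i)) \<in> borel_measurable ?M"
    using measurable_compose[OF comp g1m] by (intro borel_measurable_prod_ennreal) auto
  have G2: "(\<lambda>\<omega>. \<Prod>i\<in>{1..n}. g2 i (\<omega> i)) \<in> borel_measurable ?M"
    using measurable_compose[OF comp g2m] by (intro borel_measurable_prod_ennreal) auto
  let ?N = "\<lambda>g. density ?M (\<lambda>\<omega>. \<Prod>i\<in>{1..n}. g i (\<omega> i))"
  let ?R = "\<lambda>g. restr_to_subalg (?N g) (raw_past n q)"
  have sub: "subalgebra (?N g) (raw_past n q)" for g :: "nat \<Rightarrow> (real \<Rightarrow> 'a) \<Rightarrow> ennreal"
    using raw_subalgebra[of n y q] by (simp add: subalgebra_def)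
  have rect: "emeasure (?R g) (PiE {1..n} A) = (\<Prod>i\<in>{1..n}. \<integral>\<^sup>+w. indicator (A i) w * g i w \<partial>Q (y i))"
    if g: "\<And>i. i \<in> {1..n} \<Longrightarrow> g i \<in> borel_measurable (path_sigma {0..})"
      "(\<lambda>\<omega>. \<Prod>i\<in>{1..n}. g i (\<omega> i)) \<in> borel_measurable ?M"
      and A: "\<And>i. i \<in> {1..n} \<Longrightarrow> A i \<in> sets (path_sigma {0..q})" for g A
  proof -
    have Ar: "PiE {1..n} A \<in> sets (raw_past n q)"
      unfolding raw_past_def using A by (intro sets_PiM_I_finite) auto
    then have AM: "PiE {1..n} A \<in> sets ?M" using raw_subalgebra[of n y q] by (auto simp: subalgebra_def)
    have Ai: "A i \<in> sets (path_sigma {0..})" if "i \<in> {1..n}" for i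
      using A[OF that] sets_path_sigma_mono[of "{0..q}" "{0..}"] by auto
    have "emeasure (?R g) (PiE {1..n} A) = emeasure (?N g) (PiE {1..n} A)"
      by (rule emeasure_restr_to_subalg[OF sub Ar])
    also have "\<dots> = (\<integral>\<^sup>+\<omega>. (\<Prod>i\<in>{1..n}. g i (\<omega> i)) * indicator (PiE {1..n} A) \<omega> \<partial>?M)"
      by (rule emeasure_density[OF g(2) AM])
    also have "\<dots> = (\<integral>\<^sup>+\<omega>. (\<Prod>i\<in>{1..n}. indicator (A i) (\<omega> i) * g i (\<omega> i)) \<partial>?M)"
    proof (rule nn_integral_cong)
      fix \<omega> assume "\<omega> \<in> space ?M"
      then have ext: "\<omega> \<in> extensional {1..n}" by (auto simp: space_particles PiE_def)
      have "indicator (PiE {1..n} A) \<omega> = (\<Prod>i\<in>{1..n}. indicator (A i) (\<omega> i) :: ennreal)"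
      proof (cases "\<forall>i\<in>{1..n}. \<omega> i \<in> A i")
        case True
        then show ?thesis using ext by (simp add: PiE_def Pi_def)
      next
        case False
        then obtain i where i: "i \<in> {1..n}" "\<omega> i \<notin> A i" by blast
        then have "(\<Prod>i\<in>{1..n}. indicator (A i) (\<omega> i) :: ennreal) = 0" by (intro prod_zero bexI[of _ i]) auto
        moreover have "\<omega> \<notin> PiE {1..n} A" using i by (auto simp: PiE_def Pi_def)
        ultimately show ?thesis by simp
      qed
      then show "(\<Prod>i\<in>{1..n}. g i (\<omega> i)) * indicator (PiE {1..n} A) \<omega> =
          (\<Prod>i\<in>{1..n}. indicator (A i) (\<omega> i) * g i (\<omega> i))"
        by (simp add: prod.distrib mult.commute)
    qed
    also have "\<dots> = (\<Prod>i\<in>{1..n}. \<integral>\<^sup>+w. indicator (A i) w * g i w \<partial>Q (y i))"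
      using g(1) Ai
      by (intro particles_integral_prod borel_measurable_times_ennreal borel_measurable_indicator) auto
    finally show ?thesis .
  qed
  have one: "(\<integral>\<^sup>+w. indicator B w * g1 i w \<partial>Q x) = (\<integral>\<^sup>+w. indicator B w * g2 i w \<partial>Q x)"
    if i: "i \<in> {1..n}" and B: "B \<in> sets (path_sigma {0..q})" for i B x
  proof -
    have r1: "0 \<le> path_prod (L1 i) w" for w using path_prod_range[OF L1(1)[OF i]] by blast
    have Y: "(\<lambda>w. indicator B w * ennreal (path_prod (L1 i) w)) \<in> borel_measurable (path_sigma {0..q})"
      using m1q[OF i] B by measurable
    show ?thesis
      using markov_path_prod[OF L2[OF i] q Y, of x] r1 by (simp add: g1_def g2_def ennreal_mult' mult.assoc)
  qed
  have "?R g1 = ?R g2"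
  proof (rule measure_eqI_PiM_finite[of "{1..n}" _ "\<lambda>_. path_sigma {0..q}" _ "\<lambda>_. PiE {1..n} (\<lambda>_. paths)"])
    show "sets (?R g1) = sets (PiM {1..n} (\<lambda>_. path_sigma {0..q}))" "sets (?R g2) = sets (PiM {1..n} (\<lambda>_. path_sigma {0..q}))"
      unfolding sets_restr_to_subalg[OF sub] by (simp_all add: raw_past_def)
    show "emeasure (?R g1) (PiE {1..n} A) = emeasure (?R g2) (PiE {1..n} A)"
      if A: "\<And>i. i \<in> {1..n} \<Longrightarrow> A i \<in> sets (path_sigma {0..q})" for A
    proof -
      have "emeasure (?R g1) (PiE {1..n} A) = (\<Prod>i\<in>{1..n}. \<integral>\<^sup>+w. indicator (A i) w * g1 i w \<partial>Q (y i))"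
        by (rule rect[OF g1m G1 A])
      also have "\<dots> = (\<Prod>i\<in>{1..n}. \<integral>\<^sup>+w. indicator (A i) w * g2 i w \<partial>Q (y i))"
        by (intro prod.cong refl one A)
      also have "\<dots> = emeasure (?R g2) (PiE {1..n} A)"
        by (rule rect[OF g2m G2 A, symmetric])
      finally show ?thesis .
    qed
    show "range (\<lambda>_::nat. PiE {1..n} (\<lambda>_. paths)) \<subseteq> prod_algebra {1..n} (\<lambda>_. path_sigma {0..q} :: (real \<Rightarrow> 'a) measure)"
      using prod_algebraI_finite[of "{1..n}" "\<lambda>_. paths" "\<lambda>_. path_sigma {0..q} :: (real \<Rightarrow> 'a) measure"]
        sets.top[of "path_sigma {0..q} :: (real \<Rightarrow> 'a) measure"] by auto
    show "(\<Union>i::nat. PiE {1..n} (\<lambda>_. paths)) = space (PiM {1..n} (\<lambda>_. path_sigma {0..q} :: (real \<Rightarrow> 'a) measure))"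
      by (simp add: space_PiM)
    fix i :: nat
    have "emeasure (?R g1) (PiE {1..n} (\<lambda>_. paths)) \<le> 1"
    proof -
      have p: "paths \<in> sets (path_sigma {0..q} :: (real \<Rightarrow> 'a) measure)"
        using sets.top[of "path_sigma {0..q} :: (real \<Rightarrow> 'a) measure"] by simp
      have "(\<integral>\<^sup>+w. indicator paths w * g1 i w \<partial>Q (y i)) \<le> 1" if i: "i \<in> {1..n}" for i
      proof -
        interpret Q: prob_space "Q x" for x by (rule prob_Q)
        have "(\<integral>\<^sup>+w. indicator paths w * g1 i w \<partial>Q (y i)) \<le> (\<integral>\<^sup>+w. 1 \<partial>Q (y i))"
          using path_prod_range[OF L1(1)[OF i]] path_prod_range[OF L2[OF i]]
          by (intro nn_integral_mono) (auto simp: g1_def mult_le_one split: split_indicator)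
        then show ?thesis by (simp add: Q.emeasure_space_1)
      qed
      then have "(\<Prod>i\<in>{1..n}. \<integral>\<^sup>+w. indicator paths w * g1 i w \<partial>Q (y i)) \<le> 1"
        by (intro prod_le_1_ennreal) auto
      moreover have "emeasure (?R g1) (PiE {1..n} (\<lambda>_. paths)) = (\<Prod>i\<in>{1..n}. \<integral>\<^sup>+w. indicator paths w * g1 i w \<partial>Q (y i))"
        by (rule rect[OF g1m G1 p])
      ultimately show ?thesis by simp
    qed
    then show "emeasure (?R g1) (PiE {1..n} (\<lambda>_. paths)) \<noteq> \<infinity>"
      by (auto simp: top_unique)
  qed simp
  then have "emeasure (?R g1) A = emeasure (?R g2) A" by simp
  then have "emeasure (?N g1) A = emeasure (?N g2) A"
    by (simp only: emeasure_restr_to_subalg[OF sub A])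
  moreover have "A \<in> sets ?M" using A raw_subalgebra[of n y q] by (auto simp: subalgebra_def)
  ultimately have "(\<integral>\<^sup>+\<omega>. (\<Prod>i\<in>{1..n}. g1 i (\<omega> i)) * indicator A \<omega> \<partial>?M) = (\<integral>\<^sup>+\<omega>. (\<Prod>i\<in>{1..n}. g2 i (\<omega> i)) * indicator A \<omega> \<partial>?M)"
    by (simp only: emeasure_density[OF G1] emeasure_density[OF G2])
  then show ?thesis by (simp only: g1_def g2_def mult.commute)
qed

text \<open>
  \<open>A\<close> may be replaced by an almost surely equal event of the uncompleted past.
\<close>

lemma particles_markov_completed:
  assumes q: "0 \<le> q" and A: "A \<in> sets (completed_past n y q)"
    and L1: "\<And>i. i \<in> {1..n} \<Longrightarrow> timed_C0 0 (L1 i)" "\<And>i x. i \<in> {1..n} \<Longrightarrow> x \<in> set (L1 i) \<Longrightarrow> fst x \<le> q"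
    and L2: "\<And>i. i \<in> {1..n} \<Longrightarrow> timed_C0 q (L2 i)"
  defines "F1 \<equiv> \<lambda>\<omega>. indicator A \<omega> * ((\<Prod>i\<in>{1..n}. path_prod (L1 i) (\<omega> i)) * (\<Prod>i\<in>{1..n}. path_prod (L2 i) (\<omega> i)))"
    and "F2 \<equiv> \<lambda>\<omega>. indicator A \<omega> * ((\<Prod>i\<in>{1..n}. path_prod (L1 i) (\<omega> i)) * (\<Prod>i\<in>{1..n}. cond_prod q (L2 i) (\<omega> i q)))"
  shows "integrable (completion (particles n y)) F1" "integrable (completion (particles n y)) F2"
    "(\<integral>\<omega>. F1 \<omega> \<partial>completion (particles n y)) = (\<integral>\<omega>. F2 \<omega> \<partial>completion (particles n y))"
proof -
  let ?M = "particles n y" and ?N = "completion (particles n y)"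
  interpret M: prob_space ?M by (rule prob_particles)
  interpret N: prob_space ?N by (rule M.prob_space_completion)
  have comp: "(\<lambda>\<omega>. \<omega> i) \<in> ?M \<rightarrow>\<^sub>M path_sigma {0..}" if "i \<in> {1..n}" for i
    using measurable_component_singleton[OF that, of "\<lambda>_. path_sigma {0..}"] sets_particles[of n y]
    by (simp cong: measurable_cong_sets)
  have compN: "(\<lambda>\<omega>. \<omega> i) \<in> ?N \<rightarrow>\<^sub>M path_sigma {0..}" if "i \<in> {1..n}" for i
    using comp[OF that] by (rule measurable_completion)
  have AN: "A \<in> sets ?N" using A by (rule completed_past_sets)
  have m1: "(\<lambda>\<omega>. path_prod (L1 i) (\<omega> i)) \<in> borel_measurable ?N" if "i \<in> {1..n}" for i
    using timed_C0_times[OF L1(1)[OF that]]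
    by (intro measurable_compose[OF compN[OF that]] path_prod_measurable[OF L1(1)[OF that]]) force
  have m2: "(\<lambda>\<omega>. path_prod (L2 i) (\<omega> i)) \<in> borel_measurable ?N" if "i \<in> {1..n}" for i
    using timed_C0_times[OF L2[OF that]] q
    by (intro measurable_compose[OF compN[OF that]] path_prod_measurable[OF L2[OF that]]) force
  have m3: "(\<lambda>\<omega>. cond_prod q (L2 i) (\<omega> i q)) \<in> borel_measurable ?N" if "i \<in> {1..n}" for i
    using q by (intro measurable_compose[OF measurable_compose[OF compN[OF that] measurable_path_sigma_component] cond_prod_measurable[OF L2[OF that]]]) auto
  have r1: "0 \<le> path_prod (L1 i) w" "path_prod (L1 i) w \<le> 1" if "i \<in> {1..n}" for i w
    using path_prod_range[OF L1(1)[OF that]] by auto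
  have r2: "0 \<le> path_prod (L2 i) w" "path_prod (L2 i) w \<le> 1" if "i \<in> {1..n}" for i w
    using path_prod_range[OF L2[OF that]] by auto
  have r3: "0 \<le> cond_prod q (L2 i) x" "cond_prod q (L2 i) x \<le> 1" if "i \<in> {1..n}" for i x
    using cond_prod_props(2,3)[OF L2[OF that]] by auto
  have P1: "0 \<le> (\<Prod>i\<in>{1..n}. path_prod (L1 i) (\<omega> i)) \<and> (\<Prod>i\<in>{1..n}. path_prod (L1 i) (\<omega> i)) \<le> 1" for \<omega>
    using r1 by (auto intro!: prod_nonneg prod_le_1)
  have P2: "0 \<le> (\<Prod>i\<in>{1..n}. path_prod (L2 i) (\<omega> i)) \<and> (\<Prod>i\<in>{1..n}. path_prod (L2 i) (\<omega> i)) \<le> 1" for \<omega>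
    using r2 by (auto intro!: prod_nonneg prod_le_1)
  have P3: "0 \<le> (\<Prod>i\<in>{1..n}. cond_prod q (L2 i) (\<omega> i q)) \<and> (\<Prod>i\<in>{1..n}. cond_prod q (L2 i) (\<omega> i q)) \<le> 1" for \<omega> :: "nat \<Rightarrow> real \<Rightarrow> 'a"
    using r3 by (auto intro!: prod_nonneg prod_le_1)
  have b1: "0 \<le> F1 \<omega> \<and> F1 \<omega> \<le> 1" for \<omega>
    unfolding F1_def using P1[of \<omega>] P2[of \<omega>] by (auto intro!: mult_le_one mult_nonneg_nonneg split: split_indicator)
  have b2: "0 \<le> F2 \<omega> \<and> F2 \<omega> \<le> 1" for \<omega>
    unfolding F2_def using P1[of \<omega>] P3[of \<omega>] by (auto intro!: mult_le_one mult_nonneg_nonneg split: split_indicator)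
  have F1m: "F1 \<in> borel_measurable ?N"
    unfolding F1_def using AN m1 m2 by (intro borel_measurable_times borel_measurable_prod borel_measurable_indicator) auto
  have F2m: "F2 \<in> borel_measurable ?N"
    unfolding F2_def using AN m1 m3 by (intro borel_measurable_times borel_measurable_prod borel_measurable_indicator) auto
  show i1: "integrable ?N F1" using F1m b1 by (intro N.integrable_const_bound[of _ 1]) auto
  show i2: "integrable ?N F2" using F2m b2 by (intro N.integrable_const_bound[of _ 1]) auto
  obtain B where B: "B \<in> sets (raw_past n q)" "AE \<omega> in ?M. \<omega> \<in> A \<longleftrightarrow> \<omega> \<in> B"
    using sets_completion_sub(2)[OF raw_subalgebra A[unfolded completed_past_def]] by blast
  have "(\<integral>\<^sup>+\<omega>. ennreal (F1 \<omega>) \<partial>?N) =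
      (\<integral>\<^sup>+\<omega>. indicator B \<omega> * (\<Prod>i\<in>{1..n}. ennreal (path_prod (L1 i) (\<omega> i) * path_prod (L2 i) (\<omega> i))) \<partial>?M)"
    unfolding nn_integral_completion
  proof (rule nn_integral_cong_AE)
    show "AE \<omega> in ?M. ennreal (F1 \<omega>) = indicator B \<omega> * (\<Prod>i\<in>{1..n}. ennreal (path_prod (L1 i) (\<omega> i) * path_prod (L2 i) (\<omega> i)))"
      using B(2)
    proof eventually_elim
      case (elim \<omega>)
      have "(\<Prod>i\<in>{1..n}. ennreal (path_prod (L1 i) (\<omega> i) * path_prod (L2 i) (\<omega> i))) =
          ennreal ((\<Prod>i\<in>{1..n}. path_prod (L1 i) (\<omega> i)) * (\<Prod>i\<in>{1..n}. path_prod (L2 i) (\<omega> i)))"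
        using r1 r2 by (subst prod_ennreal) (auto simp: prod.distrib)
      then show ?case using elim by (auto simp: F1_def split: split_indicator)
    qed
  qed
  also have "\<dots> = (\<integral>\<^sup>+\<omega>. indicator B \<omega> * (\<Prod>i\<in>{1..n}. ennreal (path_prod (L1 i) (\<omega> i) * cond_prod q (L2 i) (\<omega> i q))) \<partial>?M)"
    by (rule particles_markov[OF q B(1) L1 L2])
  also have "\<dots> = (\<integral>\<^sup>+\<omega>. ennreal (F2 \<omega>) \<partial>?N)"
    unfolding nn_integral_completion
  proof (rule nn_integral_cong_AE)
    show "AE \<omega> in ?M. indicator B \<omega> * (\<Prod>i\<in>{1..n}. ennreal (path_prod (L1 i) (\<omega> i) * cond_prod q (L2 i) (\<omega> i q))) = ennreal (F2 \<omega>)"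
      using B(2)
    proof eventually_elim
      case (elim \<omega>)
      have "(\<Prod>i\<in>{1..n}. ennreal (path_prod (L1 i) (\<omega> i) * cond_prod q (L2 i) (\<omega> i q))) =
          ennreal ((\<Prod>i\<in>{1..n}. path_prod (L1 i) (\<omega> i)) * (\<Prod>i\<in>{1..n}. cond_prod q (L2 i) (\<omega> i q)))"
        using r1 r3 by (subst prod_ennreal) (auto simp: prod.distrib)
      then show ?case using elim by (auto simp: F2_def split: split_indicator)
    qed
  qed
  finally have "(\<integral>\<^sup>+\<omega>. ennreal (F1 \<omega>) \<partial>?N) = (\<integral>\<^sup>+\<omega>. ennreal (F2 \<omega>) \<partial>?N)" .
  then show "(\<integral>\<omega>. F1 \<omega> \<partial>?N) = (\<integral>\<omega>. F2 \<omega> \<partial>?N)"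
    using nn_integral_eq_integral[OF i1] nn_integral_eq_integral[OF i2] b1 b2
    by (simp add: integral_nonneg_AE)
qed

definition swapped :: "nat \<Rightarrow> (nat \<Rightarrow> nat) \<Rightarrow> ((nat \<Rightarrow> real \<Rightarrow> 'a) \<Rightarrow> ereal) \<Rightarrow> (nat \<Rightarrow> real \<Rightarrow> 'a) \<Rightarrow> (nat \<Rightarrow> real \<Rightarrow> 'a)" where
  "swapped n \<pi> T \<omega> = (\<lambda>i\<in>{1..n}. \<lambda>t\<in>{0..}. if ereal t < T \<omega> then \<omega> i t else \<omega> (\<pi> i) t)"

lemma swapped_space:
  assumes \<omega>: "\<omega> \<in> pspace n" and \<pi>: "\<And>i. i \<in> {1..n} \<Longrightarrow> \<pi> i \<in> {1..n}"
  shows "swapped n \<pi> T \<omega> \<in> pspace n"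
proof (rule PiE_I)
  fix i assume i: "i \<in> {1..n}"
  have "cadlag (swapped n \<pi> T \<omega> i)"
    by (rule cadlag_paste[OF particle_cadlag[OF \<omega> i] particle_cadlag[OF \<omega> \<pi>[OF i]], of "T \<omega>"])
      (use i in \<open>auto simp: swapped_def\<close>)
  moreover have "swapped n \<pi> T \<omega> i \<in> extensional {0..}" using i by (simp add: swapped_def)
  ultimately show "swapped n \<pi> T \<omega> i \<in> paths" by (simp add: paths_def)
qed (auto simp: swapped_def)

lemma swapped_measurable:
  assumes T: "stopping n y T" and \<pi>: "\<And>i. i \<in> {1..n} \<Longrightarrow> \<pi> i \<in> {1..n}"
  shows "swapped n \<pi> T \<in> completion (particles n y) \<rightarrow>\<^sub>M PiM {1..n} (\<lambda>_. path_sigma {0..})"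
proof (rule measurable_PiM_single')
  let ?N = "completion (particles n y)"
  fix i assume i: "i \<in> {1..n}"
  show "(\<lambda>\<omega>. swapped n \<pi> T \<omega> i) \<in> ?N \<rightarrow>\<^sub>M path_sigma {0..}"
  proof (rule measurable_path_sigma)
    show "(\<lambda>\<omega>. swapped n \<pi> T \<omega> i) \<in> space ?N \<rightarrow> paths"
      using particle_paths[OF swapped_space[OF _ \<pi>] i] by (auto simp: space_particles)
    fix t :: real assume t: "t \<in> {0..}"
    have c: "(\<lambda>\<omega>. \<omega> j t) \<in> borel_measurable ?N" if "j \<in> {1..n}" for j
      using t by (intro completed_past_measurable_completion[OF particle_completed_past[OF that, of t t]]) auto
    have "{\<omega> \<in> space ?N. T \<omega> \<le> ereal t} \<in> sets ?N"
      using completed_past_sets[OF stopping_le[OF T _ order_refl, of t]] t by (simp add: space_particles)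
    then have "{\<omega> \<in> space ?N. \<not> T \<omega> \<le> ereal t} \<in> sets ?N" by (rule sets.sets_Collect_neg)
    then have "(\<lambda>\<omega>. if ereal t < T \<omega> then \<omega> i t else \<omega> (\<pi> i) t) \<in> borel_measurable ?N"
      using c i \<pi> by (intro measurable_If) (auto simp: not_le)
    then show "(\<lambda>\<omega>. swapped n \<pi> T \<omega> i t) \<in> borel_measurable ?N" using i t by (simp add: swapped_def)
  qed
qed (use swapped_space[OF _ \<pi>] in \<open>auto simp: space_particles\<close>)

text \<open>
  A time \<open>s\<close> is approximated by the least multiple of \<open>1 / Suc N\<close> that is strictly
  greater. Strictness makes the approximating times converge to \<open>s\<close> from the right, and so the
  positions of right-continuous paths converge.
\<close>

definition grid :: "nat \<Rightarrow> nat \<Rightarrow> real" where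
  "grid N j = real j / real (Suc N)"

definition next_index :: "nat \<Rightarrow> real \<Rightarrow> nat" where
  "next_index N s = nat \<lfloor>s * real (Suc N)\<rfloor> + 1"

lemma next_index_iff:
  assumes "0 \<le> s"
  shows "1 \<le> j \<and> grid N (j - 1) \<le> s \<and> s < grid N j \<longleftrightarrow> j = next_index N s"
proof -
  define x where "x = s * real (Suc N)"
  have x: "0 \<le> x" using assms by (simp add: x_def)
  have "grid N (j - 1) \<le> s \<longleftrightarrow> real (j - 1) \<le> x" "s < grid N j \<longleftrightarrow> x < real j"
    by (simp_all add: grid_def x_def field_simps)
  moreover have "1 \<le> j \<and> real (j - 1) \<le> x \<and> x < real j \<longleftrightarrow> j = nat \<lfloor>x\<rfloor> + 1"
  proof
    assume a: "1 \<le> j \<and> real (j - 1) \<le> x \<and> x < real j"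
    then have "\<lfloor>x\<rfloor> = int (j - 1)" by (intro floor_unique) (auto simp: of_nat_diff)
    then have "nat \<lfloor>x\<rfloor> = j - 1" by (simp only: nat_int)
    then show "j = nat \<lfloor>x\<rfloor> + 1" using a by simp
  next
    assume "j = nat \<lfloor>x\<rfloor> + 1"
    then show "1 \<le> j \<and> real (j - 1) \<le> x \<and> x < real j" using x by (simp) linarith
  qed
  ultimately show ?thesis by (simp add: next_index_def x_def)
qed

lemma grid_next:
  assumes "0 \<le> s"
  shows "s < grid N (next_index N s)" "grid N (next_index N s) \<le> s + 1 / real (Suc N)"
proof -
  have *: "1 \<le> next_index N s \<and> grid N (next_index N s - 1) \<le> s \<and> s < grid N (next_index N s)"
    using next_index_iff[OF assms, of "next_index N s" N] by blast
  then show "s < grid N (next_index N s)" by blast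
  have "grid N (next_index N s) = grid N (next_index N s - 1) + 1 / real (Suc N)"
    using * by (simp add: grid_def field_simps of_nat_diff)
  then show "grid N (next_index N s) \<le> s + 1 / real (Suc N)" using * by simp
qed

lemma grid_next_tendsto:
  assumes "0 \<le> s"
  shows "(\<lambda>N. grid N (next_index N s)) \<longlonglongrightarrow> s"
proof (rule tendsto_sandwich[of "\<lambda>_. s" _ _ "\<lambda>N. s + 1 / real (Suc N)"])
  show "(\<lambda>N. s + 1 / real (Suc N)) \<longlonglongrightarrow> s"
    using tendsto_add[OF tendsto_const[of s] LIMSEQ_inverse_real_of_nat] by (simp add: inverse_eq_divide)
  show "eventually (\<lambda>N. s \<le> grid N (next_index N s)) sequentially"
    using grid_next(1)[OF assms] by (intro always_eventually allI less_imp_le)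
  show "eventually (\<lambda>N. grid N (next_index N s) \<le> s + 1 / real (Suc N)) sequentially"
    using grid_next(2)[OF assms] by (intro always_eventually allI)
qed simp

lemma grid_sum:
  assumes T: "0 \<le> T"
  shows "(\<Sum>j\<in>{1..K}. indicator {u. ereal (grid N (j - 1)) \<le> u \<and> u < ereal (grid N j)} T * h (grid N j)) =
    (case T of ereal s \<Rightarrow> if next_index N s \<le> K then h (grid N (next_index N s)) else 0 | _ \<Rightarrow> (0::real))"
proof (cases T)
  case (real s)
  then have s: "0 \<le> s" using T by simp
  have "(\<Sum>j\<in>{1..K}. indicator {u. ereal (grid N (j - 1)) \<le> u \<and> u < ereal (grid N j)} T * h (grid N j)) =
      (\<Sum>j\<in>{1..K}. if j = next_index N s then h (grid N j) else 0)"
    using next_index_iff[OF s] by (intro sum.cong) (auto simp: real split: split_indicator)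
  also have "\<dots> = (if next_index N s \<le> K then h (grid N (next_index N s)) else 0)"
    by (simp add: sum.delta' next_index_def)
  finally show ?thesis by (simp add: real)
qed (use T in \<open>auto split: split_indicator\<close>)

text \<open>
  The strong Markov property in the form in which it is needed. Let \<open>q\<close> be the discretised value of
  \<open>T\<close>, one of countably many. Given that \<open>q\<close> has a certain value, which is an event of
  the past at that value, the Markov property replaces the observations from \<open>q\<close> on by functions
  \<open>cond_prod\<close> of the positions at \<open>q\<close>, both for the original paths (\<open>V2\<close>)
  and for the exchanged ones (\<open>V3\<close>). As \<open>q\<close> decreases to \<open>T\<close> the difference
  \<open>V3 - V2\<close> tends to 0, because the exchanged paths are at the same point at time \<open>T\<close>.
\<close>

lemma swapped_integral:
  assumes T: "stopping n y T" and \<pi>: "\<And>i. i \<in> {1..n} \<Longrightarrow> \<pi> i \<in> {1..n} \<and> \<pi> (\<pi> i) = i"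
    and meet: "\<And>\<omega> s i. \<omega> \<in> pspace n \<Longrightarrow> T \<omega> = ereal s \<Longrightarrow> i \<in> {1..n} \<Longrightarrow> \<omega> (\<pi> i) s = \<omega> i s"
    and L: "\<And>i. i \<in> {1..n} \<Longrightarrow> timed_C0 0 (L i)"
  defines "\<Phi> \<equiv> \<lambda>\<omega>::nat \<Rightarrow> real \<Rightarrow> 'a. (\<Prod>i\<in>{1..n}. path_prod (L i) (\<omega> i))"
  shows "(\<integral>\<omega>. \<Phi> (swapped n \<pi> T \<omega>) \<partial>completion (particles n y)) = (\<integral>\<omega>. \<Phi> \<omega> \<partial>completion (particles n y))"
proof -
  let ?N = "completion (particles n y)"
  interpret M: prob_space "particles n y" by (rule prob_particles)
  interpret N: prob_space ?N by (rule M.prob_space_completion)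
  have \<pi>1: "\<And>i. i \<in> {1..n} \<Longrightarrow> \<pi> i \<in> {1..n}" using \<pi> by blast
  have \<pi>bij: "bij_betw \<pi> {1..n} {1..n}" by (rule bij_betwI[of _ _ _ \<pi>]) (use \<pi> in auto)
  define early where "early q i = filter (\<lambda>x. fst x < q) (L i)" for q i
  define late where "late q i = filter (\<lambda>x. q \<le> fst x) (L i)" for q i
  have Le: "timed_C0 0 (early q i)" if "i \<in> {1..n}" for q i
    unfolding early_def by (rule timed_C0_filter[OF L[OF that]])
  have Le': "fst x \<le> q" if "x \<in> set (early q i)" for q i x
    using that by (auto simp: early_def)
  have Ll: "timed_C0 q (late q i)" if "i \<in> {1..n}" for q i
    unfolding late_def by (rule timed_C0_filter_later[OF L[OF that]])
  define \<Phi>1 where "\<Phi>1 q \<omega> = (\<Prod>i\<in>{1..n}. path_prod (early q i) (\<omega> i))" for q and \<omega> :: "nat \<Rightarrow> real \<Rightarrow> 'a"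
  define \<Phi>2 where "\<Phi>2 q \<omega> = (\<Prod>i\<in>{1..n}. path_prod (late q i) (\<omega> i))" for q and \<omega> :: "nat \<Rightarrow> real \<Rightarrow> 'a"
  define \<Phi>3 where "\<Phi>3 q \<omega> = (\<Prod>i\<in>{1..n}. path_prod (late q i) (\<omega> (\<pi> i)))" for q and \<omega> :: "nat \<Rightarrow> real \<Rightarrow> 'a"
  define V2 where "V2 q \<omega> = (\<Prod>i\<in>{1..n}. cond_prod q (late q i) (\<omega> i q))" for q and \<omega> :: "nat \<Rightarrow> real \<Rightarrow> 'a"
  define V3 where "V3 q \<omega> = (\<Prod>i\<in>{1..n}. cond_prod q (late q i) (\<omega> (\<pi> i) q))" for q and \<omega> :: "nat \<Rightarrow> real \<Rightarrow> 'a"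
  have reindex: "(\<Prod>i\<in>{1..n}. f (\<pi> i) i) = (\<Prod>i\<in>{1..n}. f i (\<pi> i))" for f :: "nat \<Rightarrow> nat \<Rightarrow> real"
    using prod.reindex_bij_betw[OF \<pi>bij, of "\<lambda>i. f i (\<pi> i)"] \<pi> by simp
  have range01: "0 \<le> \<Phi>1 q \<omega> \<and> \<Phi>1 q \<omega> \<le> 1" "0 \<le> \<Phi>2 q \<omega> \<and> \<Phi>2 q \<omega> \<le> 1" "0 \<le> \<Phi>3 q \<omega> \<and> \<Phi>3 q \<omega> \<le> 1"
    "0 \<le> V2 q \<omega> \<and> V2 q \<omega> \<le> 1" "0 \<le> V3 q \<omega> \<and> V3 q \<omega> \<le> 1" for q \<omega>
    unfolding \<Phi>1_def \<Phi>2_def \<Phi>3_def V2_def V3_def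
    using path_prod_range[OF Le] path_prod_range[OF Ll] cond_prod_props(2,3)[OF Ll]
    by (auto intro!: prod_nonneg prod_le_1)
  have abs01: "\<bar>a * (b - c)\<bar> \<le> 1" if "0 \<le> a \<and> a \<le> 1" "0 \<le> b \<and> b \<le> 1" "0 \<le> c \<and> c \<le> 1" for a b c :: real
  proof -
    have "\<bar>a * (b - c)\<bar> = \<bar>a\<bar> * \<bar>b - c\<bar>" by (rule abs_mult)
    also have "\<dots> \<le> 1" using that by (intro mult_le_one) auto
    finally show ?thesis .
  qed
  \<comment> \<open>After the last observation time there is nothing to compare, so finitely many values of the discretised
    time suffice.\<close>
  obtain C :: nat where C: "\<And>i x. i \<in> {1..n} \<Longrightarrow> x \<in> set (L i) \<Longrightarrow> fst x < real C"
  proof -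
    define S where "S = insert 0 (\<Union>i\<in>{1..n}. fst ` set (L i))"
    have "finite S" by (auto simp: S_def)
    then have b: "u \<le> Max S" if "u \<in> S" for u using that by (rule Max_ge)
    obtain C :: nat where C: "Max S < real C" using reals_Archimedean2 by blast
    show thesis
    proof (rule that[of C])
      fix i x assume "i \<in> {1..n}" "x \<in> set (L i)"
      then have "fst x \<in> S" by (auto simp: S_def)
      then show "fst x < real C" using b C by fastforce
    qed
  qed
  have late_nil: "late q i = []" if "real C \<le> q" "i \<in> {1..n}" for q i
    using C[OF that(2)] that(1) by (force simp: late_def filter_empty_conv)
  define K where "K N = C * Suc N" for N
  define A where "A N j = {\<omega> \<in> pspace n. ereal (grid N (j - 1)) \<le> T \<omega> \<and> T \<omega> < ereal (grid N j)}" for N j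
  have gpos: "0 \<le> grid N j" for N j by (simp add: grid_def)
  have Asets: "A N j \<in> sets (completed_past n y (grid N j))" if "1 \<le> j" for N j
  proof -
    have "grid N (j - 1) \<le> grid N j" by (simp add: grid_def divide_right_mono)
    then have "{\<omega> \<in> pspace n. T \<omega> < ereal (grid N (j - 1))} \<in> sets (completed_past n y (grid N j))"
      using stopping_less_const[OF T gpos] completed_past_mono by blast
    moreover have "A N j = {\<omega> \<in> pspace n. T \<omega> < ereal (grid N j)} - {\<omega> \<in> pspace n. T \<omega> < ereal (grid N (j - 1))}"
      by (auto simp: A_def)
    ultimately show ?thesis using stopping_less_const[OF T gpos] by auto
  qed
  have mk2: "integrable ?N (\<lambda>\<omega>. indicator (A N j) \<omega> * (\<Phi>1 (grid N j) \<omega> * \<Phi>2 (grid N j) \<omega>))"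
     "integrable ?N (\<lambda>\<omega>. indicator (A N j) \<omega> * (\<Phi>1 (grid N j) \<omega> * V2 (grid N j) \<omega>))"
     "(\<integral>\<omega>. indicator (A N j) \<omega> * (\<Phi>1 (grid N j) \<omega> * \<Phi>2 (grid N j) \<omega>) \<partial>?N) =
      (\<integral>\<omega>. indicator (A N j) \<omega> * (\<Phi>1 (grid N j) \<omega> * V2 (grid N j) \<omega>) \<partial>?N)" if j: "1 \<le> j" for N j
    using particles_markov_completed[OF gpos Asets[OF j, of N], of "early (grid N j)" "late (grid N j)"] Le Le' Ll
    unfolding \<Phi>1_def \<Phi>2_def V2_def by blast+
  have mk3: "integrable ?N (\<lambda>\<omega>. indicator (A N j) \<omega> * (\<Phi>1 (grid N j) \<omega> * \<Phi>3 (grid N j) \<omega>))"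
     "integrable ?N (\<lambda>\<omega>. indicator (A N j) \<omega> * (\<Phi>1 (grid N j) \<omega> * V3 (grid N j) \<omega>))"
     "(\<integral>\<omega>. indicator (A N j) \<omega> * (\<Phi>1 (grid N j) \<omega> * \<Phi>3 (grid N j) \<omega>) \<partial>?N) =
      (\<integral>\<omega>. indicator (A N j) \<omega> * (\<Phi>1 (grid N j) \<omega> * V3 (grid N j) \<omega>) \<partial>?N)" if j: "1 \<le> j" for N j
  proof -
    have e1: "\<Phi>3 q \<omega> = (\<Prod>i\<in>{1..n}. path_prod (late q (\<pi> i)) (\<omega> i))" for q \<omega>
      unfolding \<Phi>3_def by (rule reindex[of "\<lambda>k i. path_prod (late q i) (\<omega> k)"])
    have e2: "V3 q \<omega> = (\<Prod>i\<in>{1..n}. cond_prod q (late q (\<pi> i)) (\<omega> i q))" for q \<omega>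
      unfolding V3_def by (rule reindex[of "\<lambda>k i. cond_prod q (late q i) (\<omega> k q)"])
    show "integrable ?N (\<lambda>\<omega>. indicator (A N j) \<omega> * (\<Phi>1 (grid N j) \<omega> * \<Phi>3 (grid N j) \<omega>))"
     "integrable ?N (\<lambda>\<omega>. indicator (A N j) \<omega> * (\<Phi>1 (grid N j) \<omega> * V3 (grid N j) \<omega>))"
     "(\<integral>\<omega>. indicator (A N j) \<omega> * (\<Phi>1 (grid N j) \<omega> * \<Phi>3 (grid N j) \<omega>) \<partial>?N) =
      (\<integral>\<omega>. indicator (A N j) \<omega> * (\<Phi>1 (grid N j) \<omega> * V3 (grid N j) \<omega>) \<partial>?N)"
      using particles_markov_completed[OF gpos Asets[OF j, of N], of "early (grid N j)" "\<lambda>i. late (grid N j) (\<pi> i)"] Le Le' Ll \<pi>1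
      unfolding \<Phi>1_def e1 e2 by blast+
  qed
  define \<Psi> where "\<Psi> N \<omega> = (\<Sum>j\<in>{1..K N}. indicator (A N j) \<omega> * (\<Phi>1 (grid N j) \<omega> * \<Phi>3 (grid N j) \<omega>)
      - indicator (A N j) \<omega> * (\<Phi>1 (grid N j) \<omega> * \<Phi>2 (grid N j) \<omega>))" for N \<omega>
  define D where "D N \<omega> = (\<Sum>j\<in>{1..K N}. indicator (A N j) \<omega> * (\<Phi>1 (grid N j) \<omega> * V3 (grid N j) \<omega>)
      - indicator (A N j) \<omega> * (\<Phi>1 (grid N j) \<omega> * V2 (grid N j) \<omega>))" for N \<omega>
  have \<Psi>D: "(\<integral>\<omega>. \<Psi> N \<omega> \<partial>?N) = (\<integral>\<omega>. D N \<omega> \<partial>?N)" for N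
    unfolding \<Psi>_def D_def using mk2 mk3
    by (simp add: Bochner_Integration.integral_sum Bochner_Integration.integral_diff)
  have \<Psi>i: "integrable ?N (\<Psi> N)" and Di: "integrable ?N (D N)" for N
    unfolding \<Psi>_def D_def using mk2 mk3 by (auto intro!: Bochner_Integration.integrable_sum Bochner_Integration.integrable_diff)
  have T0: "0 \<le> T \<omega>" for \<omega> using T by (simp add: stopping_def)
  \<comment> \<open>In both sums only the term of the discretised value of \<open>T \<omega>\<close> is nonzero.\<close>
  have \<Psi>_eq: "\<Psi> N \<omega> = (case T \<omega> of ereal s \<Rightarrow> (let q = grid N (next_index N s) in \<Phi>1 q \<omega> * (\<Phi>3 q \<omega> - \<Phi>2 q \<omega>)) | _ \<Rightarrow> 0)"
    and D_eq: "D N \<omega> = (case T \<omega> of ereal s \<Rightarrow> (let q = grid N (next_index N s) in \<Phi>1 q \<omega> * (V3 q \<omega> - V2 q \<omega>)) | _ \<Rightarrow> 0)"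
    if \<omega>: "\<omega> \<in> pspace n" for N \<omega>
  proof -
    have ind: "indicator (A N j) \<omega> = (indicator {u. ereal (grid N (j - 1)) \<le> u \<and> u < ereal (grid N j)} (T \<omega>) :: real)" for j
      using \<omega> by (auto simp: A_def split: split_indicator)
    have big: "real C \<le> grid N (next_index N s)" if "\<not> next_index N s \<le> K N" for s
    proof -
      have "real (C * Suc N) \<le> real (next_index N s)" using that unfolding K_def by linarith
      then show ?thesis by (simp add: grid_def field_simps)
    qed
    have z: "\<Phi>3 q \<omega> = \<Phi>2 q \<omega>" "V3 q \<omega> = V2 q \<omega>" if "real C \<le> q" for q
      unfolding \<Phi>3_def \<Phi>2_def V3_def V2_def using late_nil[OF that] by simp_all
    show "\<Psi> N \<omega> = (case T \<omega> of ereal s \<Rightarrow> (let q = grid N (next_index N s) in \<Phi>1 q \<omega> * (\<Phi>3 q \<omega> - \<Phi>2 q \<omega>)) | _ \<Rightarrow> 0)"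
      using grid_sum[OF T0[of \<omega>], where h = "\<lambda>q. \<Phi>1 q \<omega> * (\<Phi>3 q \<omega> - \<Phi>2 q \<omega>)" and K = "K N" and N = N] z(1)[OF big]
      unfolding \<Psi>_def ind by (auto simp: right_diff_distrib Let_def split: ereal.splits if_splits)
    show "D N \<omega> = (case T \<omega> of ereal s \<Rightarrow> (let q = grid N (next_index N s) in \<Phi>1 q \<omega> * (V3 q \<omega> - V2 q \<omega>)) | _ \<Rightarrow> 0)"
      using grid_sum[OF T0[of \<omega>], where h = "\<lambda>q. \<Phi>1 q \<omega> * (V3 q \<omega> - V2 q \<omega>)" and K = "K N" and N = N] z(2)[OF big]
      unfolding D_def ind by (auto simp: right_diff_distrib Let_def split: ereal.splits if_splits)
  qed
  have \<Psi>b: "norm (\<Psi> N \<omega>) \<le> 1" and Db: "norm (D N \<omega>) \<le> 1" if "\<omega> \<in> pspace n" for N \<omega>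
    using abs01[OF range01(1) range01(3) range01(2)] abs01[OF range01(1) range01(5) range01(4)]
    unfolding \<Psi>_eq[OF that] D_eq[OF that] by (auto simp: Let_def split: ereal.splits)
  \<comment> \<open>For fine grids no observation time lies strictly between \<open>s\<close> and its discretisation. An
    observation at \<open>s\<close> itself counts as early, which is harmless because the paths agree there.\<close>
  have gap: "\<exists>N0. \<forall>N\<ge>N0. \<forall>i\<in>{1..n}. \<forall>x\<in>set (L i). grid N (next_index N s) \<le> fst x \<longleftrightarrow> s < fst x" if s: "0 \<le> s" for s
  proof -
    have "\<exists>N0. \<forall>N\<ge>N0. grid N (next_index N s) \<le> t \<longleftrightarrow> s < t" for t
    proof (cases "s < t")
      case True
      have "eventually (\<lambda>N. grid N (next_index N s) < t) sequentially"
        using grid_next_tendsto[OF s] True by (rule order_tendstoD)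
      then show ?thesis using True by (auto simp: eventually_sequentially intro: less_imp_le)
    next
      case False
      then show ?thesis using grid_next(1)[OF s] by (meson less_le_trans not_le)
    qed
    then have "\<forall>t. eventually (\<lambda>N. grid N (next_index N s) \<le> t \<longleftrightarrow> s < t) sequentially"
      by (auto simp: eventually_sequentially)
    then have "eventually (\<lambda>N. \<forall>i\<in>{1..n}. \<forall>x\<in>set (L i). grid N (next_index N s) \<le> fst x \<longleftrightarrow> s < fst x) sequentially"
      by (intro eventually_ball_finite ballI) auto
    then show ?thesis by (auto simp: eventually_sequentially)
  qed
  have \<Psi>_lim: "(\<lambda>N. \<Psi> N \<omega>) \<longlonglongrightarrow> \<Phi> (swapped n \<pi> T \<omega>) - \<Phi> \<omega>" if \<omega>: "\<omega> \<in> pspace n" for \<omega>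
  proof (cases "T \<omega>")
    case (real s)
    then have s: "0 \<le> s" using T0[of \<omega>] by simp
    obtain N0 where N0: "\<And>N i x. N0 \<le> N \<Longrightarrow> i \<in> {1..n} \<Longrightarrow> x \<in> set (L i) \<Longrightarrow> grid N (next_index N s) \<le> fst x \<longleftrightarrow> s < fst x"
      using gap[OF s] by blast
    have "\<Psi> N \<omega> = \<Phi> (swapped n \<pi> T \<omega>) - \<Phi> \<omega>" if N: "N0 \<le> N" for N
    proof -
      let ?q = "grid N (next_index N s)"
      have "path_prod (L i) (\<omega> i) = path_prod (early ?q i) (\<omega> i) * path_prod (late ?q i) (\<omega> i)" for i
        unfolding early_def late_def by (rule path_prod_split) auto
      then have 1: "\<Phi> \<omega> = \<Phi>1 ?q \<omega> * \<Phi>2 ?q \<omega>" by (simp add: \<Phi>_def \<Phi>1_def \<Phi>2_def prod.distrib)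
      have "path_prod (L i) (swapped n \<pi> T \<omega> i) = path_prod (early ?q i) (\<omega> i) * path_prod (late ?q i) (\<omega> (\<pi> i))" if i: "i \<in> {1..n}" for i
        unfolding early_def late_def
      proof (rule path_prod_split)
        fix t f assume tf: "(t, f) \<in> set (L i)"
        have t0: "0 \<le> t" using timed_C0_times[OF L[OF i] tf] by simp
        have qt: "?q \<le> t \<longleftrightarrow> s < t" using N0[OF N i tf] by simp
        show "(t < ?q \<longrightarrow> swapped n \<pi> T \<omega> i t = \<omega> i t) \<and> (?q \<le> t \<longrightarrow> swapped n \<pi> T \<omega> i t = \<omega> (\<pi> i) t)"
          using qt i t0 meet[OF \<omega> real i] by (cases "t = s") (auto simp: swapped_def real not_le)
      qed
      then have 2: "\<Phi> (swapped n \<pi> T \<omega>) = \<Phi>1 ?q \<omega> * \<Phi>3 ?q \<omega>"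
        by (simp add: \<Phi>_def \<Phi>1_def \<Phi>3_def prod.distrib)
      show ?thesis unfolding \<Psi>_eq[OF \<omega>] 1 2 by (simp add: real Let_def right_diff_distrib)
    qed
    then have "eventually (\<lambda>N. \<Psi> N \<omega> = \<Phi> (swapped n \<pi> T \<omega>) - \<Phi> \<omega>) sequentially"
      by (auto simp: eventually_sequentially)
    then show ?thesis by (rule tendsto_eventually)
  next
    case PInf
    have "path_prod (L i) (swapped n \<pi> T \<omega> i) = path_prod (L i) (\<omega> i)" if i: "i \<in> {1..n}" for i
    proof -
      have "swapped n \<pi> T \<omega> i t = \<omega> i t" if "(t, f) \<in> set (L i)" for t f
        using timed_C0_times[OF L[OF i] that] i PInf by (simp add: swapped_def)
      then show ?thesis unfolding path_prod_def by (intro arg_cong[where f = prod_list] map_cong) auto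
    qed
    then show ?thesis by (simp add: \<Psi>_eq[OF \<omega>] PInf \<Phi>_def)
  qed (use T0[of \<omega>] in auto)
  have D_lim: "(\<lambda>N. D N \<omega>) \<longlonglongrightarrow> 0" if \<omega>: "\<omega> \<in> pspace n" for \<omega>
  proof (cases "T \<omega>")
    case (real s)
    then have s: "0 \<le> s" using T0[of \<omega>] by simp
    obtain N0 where N0: "\<And>N i x. N0 \<le> N \<Longrightarrow> i \<in> {1..n} \<Longrightarrow> x \<in> set (L i) \<Longrightarrow> grid N (next_index N s) \<le> fst x \<longleftrightarrow> s < fst x"
      using gap[OF s] by blast
    define q where "q N = grid (N + N0) (next_index (N + N0) s)" for N
    define R where "R i = filter (\<lambda>x. s < fst x) (L i)" for i
    have late_R: "late (q N) i = R i" if "i \<in> {1..n}" for N i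
      unfolding late_def R_def q_def using N0[of "N + N0" i] that by (intro filter_cong) auto
    have q_lim: "q \<longlonglongrightarrow> s" unfolding q_def using grid_next_tendsto[OF s] by (rule LIMSEQ_ignore_initial_segment)
    have q_gt: "s < q N" for N unfolding q_def by (rule grid_next(1)[OF s])
    have x_lim: "(\<lambda>N. \<omega> i (q N)) \<longlonglongrightarrow> \<omega> i s" if "i \<in> {1..n}" for i
    proof -
      have "((\<lambda>u. \<omega> i u) \<longlongrightarrow> \<omega> i s) (at_right s)"
        using particle_cadlag[OF \<omega> that] s by (auto simp: cadlag_def)
      moreover have "filterlim q (at_right s) sequentially"
      proof -
        have "q N \<noteq> s" for N using q_gt[of N] by simp
        then show ?thesis using q_lim q_gt by (auto simp: filterlim_at)
      qed
      ultimately show ?thesis by (rule filterlim_compose)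
    qed
    have pl: "(\<lambda>N. cond_prod (q N) (R i) (\<omega> k (q N))) \<longlonglongrightarrow> cond_prod s (R i) (\<omega> k s)" if i: "i \<in> {1..n}" and k: "k \<in> {1..n}" for i k
    proof (rule cond_prod_tendsto[OF _ q_lim _ x_lim[OF k]])
      show "timed_C0 (q N) (R i)" for N using Ll[OF i, of "q N"] late_R[OF i] by simp
    qed (use q_gt in \<open>auto intro: less_imp_le\<close>)
    have "(\<lambda>N. V3 (q N) \<omega>) \<longlonglongrightarrow> (\<Prod>i\<in>{1..n}. cond_prod s (R i) (\<omega> (\<pi> i) s))"
      unfolding V3_def using pl \<pi>1 late_R by (intro tendsto_prod) auto
    moreover have "(\<lambda>N. V2 (q N) \<omega>) \<longlonglongrightarrow> (\<Prod>i\<in>{1..n}. cond_prod s (R i) (\<omega> i s))"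
      unfolding V2_def using pl late_R by (intro tendsto_prod) auto
    moreover have "(\<Prod>i\<in>{1..n}. cond_prod s (R i) (\<omega> (\<pi> i) s)) = (\<Prod>i\<in>{1..n}. cond_prod s (R i) (\<omega> i s))"
      using meet[OF \<omega> real] by (intro prod.cong) auto
    ultimately have "(\<lambda>N. V3 (q N) \<omega> - V2 (q N) \<omega>) \<longlonglongrightarrow> 0"
      using tendsto_diff by fastforce
    then have "(\<lambda>N. \<Phi>1 (q N) \<omega> * (V3 (q N) \<omega> - V2 (q N) \<omega>)) \<longlonglongrightarrow> 0"
    proof (rule Lim_null_comparison[rotated, OF tendsto_norm_zero])
      show "eventually (\<lambda>N. norm (\<Phi>1 (q N) \<omega> * (V3 (q N) \<omega> - V2 (q N) \<omega>)) \<le> norm (V3 (q N) \<omega> - V2 (q N) \<omega>)) sequentially"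
        using range01(1) by (intro always_eventually) (auto simp: abs_mult intro!: mult_left_le_one_le)
    qed
    then have "(\<lambda>N. D (N + N0) \<omega>) \<longlonglongrightarrow> 0"
      unfolding D_eq[OF \<omega>] by (simp add: real Let_def q_def)
    then show ?thesis by (rule LIMSEQ_offset)
  qed (use D_eq[OF \<omega>] T0[of \<omega>] in auto)
  have \<Phi>m: "\<Phi> \<in> borel_measurable (PiM {1..n} (\<lambda>_. path_sigma {0..}))"
    unfolding \<Phi>_def
  proof (rule borel_measurable_prod)
    fix i assume i: "i \<in> {1..n}"
    show "(\<lambda>\<omega>. path_prod (L i) (\<omega> i)) \<in> borel_measurable (PiM {1..n} (\<lambda>_. path_sigma {0..}))"
      using timed_C0_times[OF L[OF i]]
      by (intro measurable_compose[OF measurable_component_singleton[OF i]] path_prod_measurable[OF L[OF i]]) force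
  qed
  have \<Phi>r: "0 \<le> \<Phi> \<omega> \<and> \<Phi> \<omega> \<le> 1" for \<omega>
    unfolding \<Phi>_def using path_prod_range[OF L] by (auto intro!: prod_nonneg prod_le_1)
  have idN: "(\<lambda>\<omega>. \<omega>) \<in> ?N \<rightarrow>\<^sub>M PiM {1..n} (\<lambda>_. path_sigma {0..})"
    by (rule measurable_completion) (use measurable_ident_sets[OF sets_particles] in simp)
  have \<Phi>N: "\<Phi> \<in> borel_measurable ?N" using measurable_compose[OF idN \<Phi>m] by simp
  have \<Phi>S: "(\<lambda>\<omega>. \<Phi> (swapped n \<pi> T \<omega>)) \<in> borel_measurable ?N"
    using measurable_compose[OF swapped_measurable[OF T \<pi>1] \<Phi>m] by simp
  have i1: "integrable ?N \<Phi>" using \<Phi>N \<Phi>r by (intro N.integrable_const_bound[of _ 1]) auto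
  have i2: "integrable ?N (\<lambda>\<omega>. \<Phi> (swapped n \<pi> T \<omega>))" using \<Phi>S \<Phi>r by (intro N.integrable_const_bound[of _ 1]) auto
  have sp: "AE \<omega> in ?N. \<omega> \<in> pspace n" by (rule AE_I2) (simp add: space_particles)
  have "(\<lambda>N. \<integral>\<omega>. \<Psi> N \<omega> \<partial>?N) \<longlonglongrightarrow> (\<integral>\<omega>. \<Phi> (swapped n \<pi> T \<omega>) - \<Phi> \<omega> \<partial>?N)"
    by (rule integral_dominated_convergence[where w = "\<lambda>_. 1"])
      (use \<Phi>N \<Phi>S \<Psi>i \<Psi>_lim \<Psi>b in \<open>auto simp: space_particles intro!: AE_I2\<close>)
  moreover have "(\<lambda>N. \<integral>\<omega>. D N \<omega> \<partial>?N) \<longlonglongrightarrow> (\<integral>\<omega>. 0 \<partial>?N)"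
    by (rule integral_dominated_convergence[where w = "\<lambda>_. 1"])
      (use Di D_lim Db in \<open>auto simp: space_particles intro!: AE_I2\<close>)
  ultimately have "(\<integral>\<omega>. \<Phi> (swapped n \<pi> T \<omega>) - \<Phi> \<omega> \<partial>?N) = 0"
    unfolding \<Psi>D using LIMSEQ_unique by fastforce
  then show ?thesis using i1 i2 by simp
qed

text \<open>
  Indicators of open sets are limits of functions in \<open>C0\<close>, so the equality of integrals gives
  equality on cylinders.
\<close>

lemma swapped_law:
  assumes lc: "locally compact (UNIV :: 'a set)"
    and T: "stopping n y T" and \<pi>: "\<And>i. i \<in> {1..n} \<Longrightarrow> \<pi> i \<in> {1..n} \<and> \<pi> (\<pi> i) = i"
    and meet: "\<And>\<omega> s i. \<omega> \<in> pspace n \<Longrightarrow> T \<omega> = ereal s \<Longrightarrow> i \<in> {1..n} \<Longrightarrow> \<omega> (\<pi> i) s = \<omega> i s"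
  shows "distr (completion (particles n y)) (particles n y) (swapped n \<pi> T) = particles n y"
proof (rule measure_eqI_cylinder[of "{1..n}"])
  let ?N = "completion (particles n y)" and ?M = "particles n y"
  interpret M: prob_space ?M by (rule prob_particles)
  interpret N: prob_space ?N by (rule M.prob_space_completion)
  have \<pi>1: "\<And>i. i \<in> {1..n} \<Longrightarrow> \<pi> i \<in> {1..n}" using \<pi> by blast
  have Sm: "swapped n \<pi> T \<in> ?N \<rightarrow>\<^sub>M ?M"
    using swapped_measurable[OF T \<pi>1] sets_particles[of n y] by (simp cong: measurable_cong_sets)
  show "sets (distr ?N ?M (swapped n \<pi> T)) = sets (PiM {1..n} (\<lambda>_. path_sigma {0..}))"
    "sets ?M = sets (PiM {1..n} (\<lambda>_. path_sigma {0..}))" by (simp_all add: sets_particles)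
  show "finite_measure (distr ?N ?M (swapped n \<pi> T))"
    using N.prob_space_distr[OF Sm] by (simp add: prob_space_def)
  fix L :: "nat \<Rightarrow> (real \<times> 'a set) list" assume L: "\<And>i. i \<in> {1..n} \<Longrightarrow> timed_open (L i) \<and> sorted (map fst (L i))"
  have Lo: "open (snd x)" "0 \<le> fst x" if "i \<in> {1..n}" "x \<in> set (L i)" for i x
    using L[OF that(1)] that(2) by (auto simp: timed_open_def)
  have "\<exists>f. \<forall>G. open G \<longrightarrow> (\<forall>n. f G n \<in> C0) \<and> (\<forall>n x. 0 \<le> f G n x \<and> f G n x \<le> (1::real)) \<and>
           (\<forall>x::'a. (\<lambda>n. f G n x) \<longlonglongrightarrow> indicator G x)"
    using C0_approximates_open[OF lc] by (intro choice) blast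
  then obtain f where f': "\<forall>G. open G \<longrightarrow> (\<forall>n. f G n \<in> C0) \<and> (\<forall>n x. 0 \<le> f G n x \<and> f G n x \<le> (1::real)) \<and>
           (\<forall>x::'a. (\<lambda>n. f G n x) \<longlonglongrightarrow> indicator G x)" ..
  have f: "\<And>G n. open G \<Longrightarrow> f G n \<in> C0" "\<And>G n x. open G \<Longrightarrow> 0 \<le> f G n x \<and> f G n x \<le> (1::real)"
      "\<And>G x. open G \<Longrightarrow> (\<lambda>n. f G n (x::'a)) \<longlonglongrightarrow> indicator G x" using f' by blast+
  define Lf where "Lf m i = map (\<lambda>x. (fst x, f (snd x) m)) (L i)" for m i
  have timed: "timed_C0 r (map (\<lambda>x. (fst x, f (snd x) m)) l)"
    if "sorted (map fst l)" "\<And>x. x \<in> set l \<Longrightarrow> open (snd x)" "\<And>x. x \<in> set l \<Longrightarrow> r \<le> fst x" for r m l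
    using that
  proof (induction l arbitrary: r)
    case (Cons a l)
    then show ?case using f by auto
  qed simp
  have LfC: "timed_C0 0 (Lf m i)" if "i \<in> {1..n}" for m i
    unfolding Lf_def using L[OF that] Lo[OF that] by (intro timed) auto
  define \<Phi> where "\<Phi> m \<omega> = (\<Prod>i\<in>{1..n}. path_prod (Lf m i) (\<omega> i))" for m and \<omega> :: "nat \<Rightarrow> real \<Rightarrow> 'a"
  have int: "(\<integral>\<omega>. \<Phi> m (swapped n \<pi> T \<omega>) \<partial>?N) = (\<integral>\<omega>. \<Phi> m \<omega> \<partial>?N)" for m
    unfolding \<Phi>_def
  proof (rule swapped_integral[of n y T \<pi> "Lf m", OF T])
    show "\<pi> i \<in> {1..n} \<and> \<pi> (\<pi> i) = i" if "i \<in> {1..n}" for i by (rule \<pi>[OF that])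
    show "\<omega> (\<pi> i) s = \<omega> i s" if "\<omega> \<in> pspace n" "T \<omega> = ereal s" "i \<in> {1..n}" for \<omega> s i
      by (rule meet[OF that])
    show "timed_C0 0 (Lf m i)" if "i \<in> {1..n}" for i by (rule LfC[OF that])
  qed
  have \<Phi>lim: "(\<lambda>m. \<Phi> m \<omega>) \<longlonglongrightarrow> indicator (cylinder {1..n} L) \<omega>" if \<omega>: "\<omega> \<in> pspace n" for \<omega>
  proof -
    have pl: "(\<lambda>m. path_prod (map (\<lambda>x. (fst x, f (snd x) m)) l) w) \<longlonglongrightarrow> (if \<forall>x\<in>set l. w (fst x) \<in> snd x then 1 else 0)"
      if "\<And>x. x \<in> set l \<Longrightarrow> open (snd x)" for l and w :: "real \<Rightarrow> 'a"
      using that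
    proof (induction l)
      case (Cons a l)
      have "(\<lambda>m. f (snd a) m (w (fst a)) * path_prod (map (\<lambda>x. (fst x, f (snd x) m)) l) w)
          \<longlonglongrightarrow> indicator (snd a) (w (fst a)) * (if \<forall>x\<in>set l. w (fst x) \<in> snd x then 1 else 0)"
        using Cons by (intro tendsto_mult f(3)) auto
      then show ?case by (auto split: if_splits split_indicator_asm)
    qed simp
    have "(\<lambda>m. \<Phi> m \<omega>) \<longlonglongrightarrow> (\<Prod>i\<in>{1..n}. if \<forall>x\<in>set (L i). \<omega> i (fst x) \<in> snd x then 1 else 0)"
      unfolding \<Phi>_def Lf_def using Lo by (intro tendsto_prod pl) auto
    moreover have "(\<Prod>i\<in>{1..n}. if \<forall>x\<in>set (L i). \<omega> i (fst x) \<in> snd x then 1 else (0::real)) = indicator (cylinder {1..n} L) \<omega>"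
    proof (cases "\<omega> \<in> cylinder {1..n} L")
      case True
      then show ?thesis by (auto simp: cylinder_def intro!: prod.neutral)
    next
      case False
      then obtain i where "i \<in> {1..n}" "\<not> (\<forall>x\<in>set (L i). \<omega> i (fst x) \<in> snd x)" using \<omega> unfolding cylinder_def by blast
      then have "(\<Prod>i\<in>{1..n}. if \<forall>x\<in>set (L i). \<omega> i (fst x) \<in> snd x then 1 else (0::real)) = 0" by (intro prod_zero) auto
      then show ?thesis using False by simp
    qed
    ultimately show ?thesis by simp
  qed
  have \<Phi>r: "norm (\<Phi> m \<omega>) \<le> 1" for m \<omega>
  proof -
    have "0 \<le> \<Phi> m \<omega> \<and> \<Phi> m \<omega> \<le> 1"
      unfolding \<Phi>_def using path_prod_range[OF LfC] by (auto intro!: prod_nonneg prod_le_1)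
    then show ?thesis by simp
  qed
  have \<Phi>m: "\<Phi> m \<in> borel_measurable ?M" for m
    unfolding \<Phi>_def
  proof (rule borel_measurable_prod)
    fix i assume i: "i \<in> {1..n}"
    have "(\<lambda>\<omega>. path_prod (Lf m i) (\<omega> i)) \<in> borel_measurable (PiM {1..n} (\<lambda>_. path_sigma {0..}))"
      using timed_C0_times[OF LfC[OF i]]
      by (intro measurable_compose[OF measurable_component_singleton[OF i]] path_prod_measurable[OF LfC[OF i]]) force
    then show "(\<lambda>\<omega>. path_prod (Lf m i) (\<omega> i)) \<in> borel_measurable ?M" using sets_particles[of n y] by (simp cong: measurable_cong_sets)
  qed
  have cyl: "cylinder {1..n} L \<in> sets ?M"
    unfolding sets_particles sets_PiM_path_sigma[OF finite_atLeastAtMost] using L by (intro sigma_sets.Basic) blast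
  have Sp: "swapped n \<pi> T \<omega> \<in> pspace n" if "\<omega> \<in> pspace n" for \<omega> by (rule swapped_space[OF that \<pi>1])
  have l1: "(\<lambda>m. \<integral>\<omega>. \<Phi> m \<omega> \<partial>?N) \<longlonglongrightarrow> (\<integral>\<omega>. indicator (cylinder {1..n} L) \<omega> \<partial>?N)"
    by (rule integral_dominated_convergence[where w = "\<lambda>_. 1"])
      (use \<Phi>m \<Phi>lim \<Phi>r cyl in \<open>auto simp: space_particles intro!: AE_I2 measurable_completion\<close>)
  have l2: "(\<lambda>m. \<integral>\<omega>. \<Phi> m (swapped n \<pi> T \<omega>) \<partial>?N) \<longlonglongrightarrow> (\<integral>\<omega>. indicator (cylinder {1..n} L) (swapped n \<pi> T \<omega>) \<partial>?N)"
    by (rule integral_dominated_convergence[where w = "\<lambda>_. 1"])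
      (use measurable_compose[OF Sm \<Phi>m] measurable_compose[OF Sm borel_measurable_indicator[OF cyl]] \<Phi>lim Sp \<Phi>r in
        \<open>auto simp: space_particles intro!: AE_I2\<close>)
  have eq: "(\<integral>\<omega>. indicator (cylinder {1..n} L) (swapped n \<pi> T \<omega>) \<partial>?N) = (\<integral>\<omega>. indicator (cylinder {1..n} L) \<omega> \<partial>?N :: real)"
    using LIMSEQ_unique[OF l2] l1 unfolding int by blast
  let ?S = "swapped n \<pi> T -` cylinder {1..n} L \<inter> space ?N"
  have S: "?S \<in> sets ?N" by (rule measurable_sets[OF Sm cyl])
  have "(\<integral>\<omega>. indicator (cylinder {1..n} L) (swapped n \<pi> T \<omega>) \<partial>?N) = (\<integral>\<omega>. indicator ?S \<omega> \<partial>?N :: real)"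
    by (intro Bochner_Integration.integral_cong) (auto split: split_indicator)
  then have "measure ?N ?S = measure ?N (cylinder {1..n} L)"
    using eq S cyl by (simp add: Int_absorb2 sets.sets_into_space)
  then have "emeasure ?N ?S = emeasure ?N (cylinder {1..n} L)"
    by (simp add: N.emeasure_eq_measure)
  then show "emeasure (distr ?N ?M (swapped n \<pi> T)) (cylinder {1..n} L) = emeasure ?M (cylinder {1..n} L)"
    using emeasure_distr[OF Sm cyl] cyl by simp
qed simp

end

section \<open>Hitting probabilities of finite systems\<close>

text \<open>
  Adjacent transpositions generate all permutations.
\<close>

lemma list_adjacent_swap_mset:
  assumes swap: "\<And>as a b bs. f (as @ a # b # bs) = f (as @ b # a # bs)" and m: "mset xs = mset ys"
  shows "f xs = f ys"
proof -
  have bubble: "f (as @ us @ x # vs) = f (as @ x # us @ vs)" for as us x vs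
  proof (induction us arbitrary: as)
    case (Cons u us)
    have "f (as @ (u # us) @ x # vs) = f ((as @ [u]) @ us @ x # vs)" by simp
    also have "\<dots> = f ((as @ [u]) @ x # us @ vs)" by (rule Cons)
    also have "\<dots> = f (as @ u # x # us @ vs)" by simp
    also have "\<dots> = f (as @ x # u # us @ vs)" by (rule swap)
    finally show ?case by simp
  qed simp
  have "f (as @ xs) = f (as @ ys)" for as
    using m
  proof (induction xs arbitrary: as ys)
    case (Cons x xs)
    then have "x \<in> set ys" by (metis list.set_intros(1) set_mset_mset)
    then obtain us vs where ys: "ys = us @ x # vs" by (auto simp: in_set_conv_decomp)
    have "f (as @ x # xs) = f ((as @ [x]) @ xs)" by simp
    also have "\<dots> = f ((as @ [x]) @ us @ vs)" using Cons.prems ys by (intro Cons.IH) simp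
    also have "\<dots> = f (as @ us @ x # vs)" using bubble[of as us x vs] by simp
    finally show ?case using ys by simp
  qed simp
  from this[of "[]"] show ?thesis by simp
qed

context feller_paths begin

definition hit_event :: "nat \<Rightarrow> (real \<times> 'a set) list \<Rightarrow> (nat \<Rightarrow> real \<Rightarrow> 'a) set" where
  "hit_event n L = {\<omega> \<in> pspace n. \<forall>x\<in>set L. \<exists>i\<in>{1..n}. coalesce \<omega> i (fst x) \<in> snd x}"

lemma hit_event_sets:
  assumes "timed_open L"
  shows "hit_event n L \<in> sets (completion (particles n y))"
proof -
  let ?N = "completion (particles n y)"
  have "{\<omega> \<in> space ?N. \<forall>x\<in>set L. \<exists>i\<in>{1..n}. coalesce \<omega> i (fst x) \<in> snd x} \<in> sets ?N"
  proof (intro sets.sets_Collect_finite_All sets.sets_Collect_finite_Ex)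
    fix x i assume x: "x \<in> set L" and i: "i \<in> {1..n}"
    then have "(\<lambda>\<omega>. coalesce \<omega> i (fst x)) \<in> borel_measurable ?N"
      using assms by (intro completed_past_measurable_completion[OF coalesce_adapted]) (auto simp: timed_open_def)
    from measurable_sets[OF this, of "snd x"] x assms
    show "{\<omega> \<in> space ?N. coalesce \<omega> i (fst x) \<in> snd x} \<in> sets ?N"
      by (auto simp: timed_open_def vimage_def Int_def conj_commute)
  qed auto
  then show ?thesis by (simp add: hit_event_def space_particles)
qed

text \<open>
  Exchanging the paths \<open>k\<close> and \<open>Suc k\<close> at the swap time preserves the law of the
  system, relabelling them transposes the starting points, and together the two operations only permute the
  coalesced paths, so that the event is mapped to itself.
\<close>

lemma hit_event_transpose:
  assumes lc: "locally compact (UNIV :: 'a set)" and k: "1 \<le> k" "Suc k \<le> n" and L: "timed_open L"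
  defines "\<pi> \<equiv> Transposition.transpose k (Suc k)"
  shows "emeasure (completion (particles n y)) (hit_event n L) =
    emeasure (completion (particles n (y \<circ> \<pi>))) (hit_event n L)"
proof -
  let ?M = "particles n y" and ?M' = "particles n (y \<circ> \<pi>)" and ?N = "completion (particles n y)"
  define T where "T \<omega> = swap_time (coalesce \<omega> ` {1..<k}) (\<omega> k) (\<omega> (Suc k))" for \<omega> :: "nat \<Rightarrow> real \<Rightarrow> 'a"
  have T: "stopping n y T" unfolding T_def by (rule swap_time_stopping[OF k])
  have \<pi>: "\<pi> i \<in> {1..n} \<and> \<pi> (\<pi> i) = i" if "i \<in> {1..n}" for i
    using that k by (auto simp: \<pi>_def Transposition.transpose_def)
  have \<pi>1: "\<pi> i \<in> {1..n}" if "i \<in> {1..n}" for i using \<pi>[OF that] by blast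
  have meet: "\<omega> (\<pi> i) s = \<omega> i s" if \<omega>: "\<omega> \<in> pspace n" and s: "T \<omega> = ereal s" for \<omega> s i
  proof -
    let ?Z = "coalesce \<omega> ` {1..<k}"
    have c: "cadlag (\<omega> k)" "cadlag (\<omega> (Suc k))" using k by (auto intro!: particle_cadlag[OF \<omega>])
    have Z: "right_cont z" if "z \<in> ?Z" for z
    proof -
      obtain j where j: "z = coalesce \<omega> j" "j \<in> {1..<k}" using \<open>z \<in> ?Z\<close> by blast
      then show ?thesis using k by (auto intro!: cadlag_right_cont pspace_cadlag[OF \<omega>])
    qed
    have r: "right_closed (meets ?Z (\<omega> k))" "right_closed (meets ?Z (\<omega> (Suc k)))"
      using right_closed_meets[of ?Z "\<omega> k"] right_closed_meets[of ?Z "\<omega> (Suc k)"] Z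
        cadlag_right_cont[OF c(1)] cadlag_right_cont[OF c(2)] by blast+
    have "\<omega> k s = \<omega> (Suc k) s"
      using r cadlag_right_cont[OF c(1)] cadlag_right_cont[OF c(2)]
    proof (cases rule: swap_time_cases)
      case never then show ?thesis using s by (simp add: T_def)
    next
      case (swap T') then show ?thesis using s by (simp add: T_def)
    qed
    then show ?thesis by (auto simp: \<pi>_def Transposition.transpose_def)
  qed
  define R where "R \<omega> = (\<lambda>i\<in>{1..n}. \<omega> (\<pi> i))" for \<omega> :: "nat \<Rightarrow> real \<Rightarrow> 'a"
  have inj: "inj_on \<pi> {1..n}" by (rule inj_on_inverseI[of _ \<pi>]) (use \<pi> in auto)
  have RM: "distr ?M ?M' R = ?M'"
    using distr_PiM_reindex[of "{1..n}" "\<lambda>i. Q (y i)" \<pi> "{1..n}"] inj \<pi>1 prob_Q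
    unfolding particles_def R_def by (auto simp: comp_def)
  have Rm: "R \<in> ?M \<rightarrow>\<^sub>M ?M'"
  proof -
    have "R \<in> PiM {1..n} (\<lambda>_. path_sigma {0..}) \<rightarrow>\<^sub>M PiM {1..n} (\<lambda>_. path_sigma {0..} :: (real \<Rightarrow> 'a) measure)"
      unfolding R_def using \<pi>1 by (intro measurable_restrict measurable_component_singleton)
    then show ?thesis using sets_particles[of n y] sets_particles[of n "y \<circ> \<pi>"] by (simp cong: measurable_cong_sets)
  qed
  have Sm: "swapped n \<pi> T \<in> ?N \<rightarrow>\<^sub>M ?M"
    using swapped_measurable[OF T \<pi>1] sets_particles[of n y] by (simp cong: measurable_cong_sets)
  have Sd: "distr ?N ?M (swapped n \<pi> T) = ?M"
  proof (rule swapped_law[of n y T \<pi>, OF lc T])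
    show "\<pi> i \<in> {1..n} \<and> \<pi> (\<pi> i) = i" if "i \<in> {1..n}" for i by (rule \<pi>[OF that])
    show "\<omega> (\<pi> i) s = \<omega> i s" if "\<omega> \<in> pspace n" "T \<omega> = ereal s" "i \<in> {1..n}" for \<omega> s i
      by (rule meet[OF that(1,2)])
  qed
  have Fm: "R \<circ> swapped n \<pi> T \<in> ?N \<rightarrow>\<^sub>M ?M'" by (rule measurable_comp[OF Sm Rm])
  have Fd: "distr ?N ?M' (R \<circ> swapped n \<pi> T) = ?M'"
    using distr_distr[OF Rm Sm] Sd RM by simp
  have "(R \<circ> swapped n \<pi> T) -` hit_event n L \<inter> space ?M = hit_event n L"
  proof -
    have "(R \<circ> swapped n \<pi> T) \<omega> \<in> hit_event n L \<longleftrightarrow> \<omega> \<in> hit_event n L" if \<omega>: "\<omega> \<in> pspace n" for \<omega>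
    proof -
      let ?\<eta> = "(R \<circ> swapped n \<pi> T) \<omega>"
      have S: "swapped n \<pi> T \<omega> \<in> pspace n" by (rule swapped_space[OF \<omega> \<pi>1])
      have \<eta>: "?\<eta> \<in> pspace n"
        unfolding comp_def R_def using particle_paths[OF S \<pi>1] by (intro restrict_PiE_iff[THEN iffD2]) auto
      have key: "coalesce ?\<eta> i = coalesce \<omega> (\<pi> i)" if "i \<in> {1..n}" for i
      proof (rule coalesce_swap[where n = n and k = k and T = "T \<omega>" and c = "\<lambda>_. undefined", OF _ k])
        show "T \<omega> = swap_time (coalesce \<omega> ` {1..<k}) (\<omega> k) (\<omega> (Suc k))" by (simp add: T_def)
        show "\<pi> = Transposition.transpose k (Suc k)" by (simp add: \<pi>_def)
        show "cadlag (\<omega> i)" if "i \<in> {1..n}" for i by (rule particle_cadlag[OF \<omega> that])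
        show "cadlag (?\<eta> i)" if "i \<in> {1..n}" for i by (rule particle_cadlag[OF \<eta> that])
        show "?\<eta> i t = (if ereal t < T \<omega> then \<omega> (\<pi> i) t else \<omega> i t)" if "i \<in> {1..n}" "0 \<le> t" for i t
          using that \<pi>[OF that(1)] by (simp add: R_def swapped_def)
        show "\<omega> i t = undefined \<and> ?\<eta> i t = undefined" if "i \<in> {1..n}" "t < 0" for i t
          using particle_paths[OF \<omega> that(1)] particle_paths[OF \<eta> that(1)] that(2)
          by (auto simp: paths_def extensional_def)
        show "i \<in> {1..n}" by fact
      qed
      have "(\<exists>i\<in>{1..n}. coalesce ?\<eta> i t \<in> G) \<longleftrightarrow> (\<exists>i\<in>{1..n}. coalesce \<omega> i t \<in> G)" for t G
      proof
        assume "\<exists>i\<in>{1..n}. coalesce ?\<eta> i t \<in> G"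
        then show "\<exists>i\<in>{1..n}. coalesce \<omega> i t \<in> G" using key \<pi>1 by metis
      next
        assume "\<exists>i\<in>{1..n}. coalesce \<omega> i t \<in> G"
        then show "\<exists>i\<in>{1..n}. coalesce ?\<eta> i t \<in> G" using key \<pi> by metis
      qed
      then show ?thesis using \<omega> \<eta> by (simp add: hit_event_def)
    qed
    moreover have "hit_event n L \<subseteq> pspace n" by (auto simp: hit_event_def)
    ultimately show ?thesis by (auto simp: space_particles)
  qed
  then show ?thesis
    using completion_pullback(2)[OF Fm Fd hit_event_sets[OF L]] by simp
qed

definition started :: "'a list \<Rightarrow> (nat \<Rightarrow> real \<Rightarrow> 'a) measure" where
  "started xs = particles (length xs) (\<lambda>i. xs ! (i - 1))"

definition hit_prob :: "'a list \<Rightarrow> (real \<times> 'a set) list \<Rightarrow> real" where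
  "hit_prob xs L = measure (completion (started xs)) (hit_event (length xs) L)"

lemma hit_prob_adjacent:
  assumes lc: "locally compact (UNIV :: 'a set)" and L: "timed_open L"
  shows "hit_prob (as @ a # b # bs) L = hit_prob (as @ b # a # bs) L"
proof -
  let ?xs = "as @ a # b # bs" and ?ys = "as @ b # a # bs" and ?k = "Suc (length as)"
  let ?\<pi> = "Transposition.transpose ?k (Suc ?k)"
  have "particles (length ?xs) ((\<lambda>i. ?xs ! (i - 1)) \<circ> ?\<pi>) = started ?ys"
    unfolding started_def particles_def
  proof (rule PiM_cong)
    fix i assume "i \<in> {1..length ?xs}"
    have "?xs ! (?\<pi> i - 1) = ?ys ! (i - 1)"
    proof (cases "i = ?k \<or> i = Suc ?k")
      case True
      then show ?thesis by (auto simp: Transposition.transpose_def nth_append)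
    next
      case False
      then have "?\<pi> i = i" by (auto simp: Transposition.transpose_def)
      moreover have "?xs ! j = ?ys ! j" if "j \<noteq> length as" "j \<noteq> Suc (length as)" for j
        using that by (auto simp: nth_append nth_Cons split: nat.splits)
      ultimately show ?thesis using False \<open>i \<in> {1..length ?xs}\<close> by auto
    qed
    then show "Q (((\<lambda>i. ?xs ! (i - 1)) \<circ> ?\<pi>) i) = Q (?ys ! (i - 1))" by simp
  qed simp
  moreover have "emeasure (completion (particles (length ?xs) (\<lambda>i. ?xs ! (i - 1)))) (hit_event (length ?xs) L) =
     emeasure (completion (particles (length ?xs) ((\<lambda>i. ?xs ! (i - 1)) \<circ> ?\<pi>))) (hit_event (length ?xs) L)"
    by (rule hit_event_transpose[OF lc _ _ L]) auto
  ultimately show ?thesis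
    by (simp add: hit_prob_def started_def Sigma_Algebra.measure_def)
qed

lemma hit_prob_mset:
  assumes "locally compact (UNIV :: 'a set)" "timed_open L" "mset xs = mset ys"
  shows "hit_prob xs L = hit_prob ys L"
  by (rule list_adjacent_swap_mset[where f = "\<lambda>xs. hit_prob xs L", OF hit_prob_adjacent[OF assms(1,2)] assms(3)])

lemma restrict_started:
  shows "(\<lambda>\<omega>. restrict \<omega> {1..length xs}) \<in> started (xs @ zs) \<rightarrow>\<^sub>M started xs"
    and "distr (started (xs @ zs)) (started xs) (\<lambda>\<omega>. restrict \<omega> {1..length xs}) = started xs"
proof -
  let ?n = "length xs" and ?K = "{1..length (xs @ zs)}"
  have sub: "{1..?n} \<subseteq> ?K" by auto
  have s1: "started xs = PiM {1..?n} (\<lambda>i. Q ((xs @ zs) ! (i - 1)))"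
    unfolding started_def particles_def by (intro PiM_cong refl) (auto simp: nth_append)
  have s2: "started (xs @ zs) = PiM ?K (\<lambda>i. Q ((xs @ zs) ! (i - 1)))"
    unfolding started_def particles_def ..
  show "(\<lambda>\<omega>. restrict \<omega> {1..?n}) \<in> started (xs @ zs) \<rightarrow>\<^sub>M started xs"
    unfolding s1 s2 by (rule measurable_restrict_subset[OF sub])
  show "distr (started (xs @ zs)) (started xs) (\<lambda>\<omega>. restrict \<omega> {1..?n}) = started xs"
    using distr_PiM_reindex[of ?K "\<lambda>i. Q ((xs @ zs) ! (i - 1))" "\<lambda>i. i" "{1..?n}"] sub prob_Q
    unfolding s1 s2 by (auto simp: restrict_def)
qed

lemma coalesce_restrict:
  assumes \<omega>: "\<omega> \<in> pspace m" and "n \<le> m" "i \<in> {1..n}" "0 \<le> t"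
  shows "coalesce (restrict \<omega> {1..n}) i t = coalesce \<omega> i t"
proof (rule coalesce_cong[of n])
  have c: "cadlag (\<omega> i)" if "i \<in> {1..n}" for i
    using that assms(2) by (intro particle_cadlag[OF \<omega>]) auto
  then show "cadlag (\<omega> i)" "cadlag (restrict \<omega> {1..n} i)" if "i \<in> {1..n}" for i
    using that by auto
qed (use assms in auto)

lemma restrict_pspace:
  fixes m n :: nat
  assumes "\<omega> \<in> pspace m" "n \<le> m"
  shows "restrict \<omega> {1..n} \<in> pspace n"
  unfolding restrict_PiE_iff
proof
  fix i assume "i \<in> {1..n}"
  then show "\<omega> i \<in> paths" using assms(2) by (intro particle_paths[OF assms(1)]) auto
qed

lemma prob_started: "prob_space (completion (started xs))"
  unfolding started_def by (rule prob_space.prob_space_completion[OF prob_particles])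

text \<open>
  For a comparison of systems of different size the event of the smaller system is realised on the probability
  space of the larger one.
\<close>

lemma hit_prob_restrict:
  assumes L: "timed_open L"
  shows "(\<lambda>\<omega>. restrict \<omega> {1..length xs}) -` hit_event (length xs) L \<inter> space (started (xs @ zs)) \<in> sets (completion (started (xs @ zs)))"
    and "measure (completion (started (xs @ zs)))
       ((\<lambda>\<omega>. restrict \<omega> {1..length xs}) -` hit_event (length xs) L \<inter> space (started (xs @ zs))) = hit_prob xs L"
  using completion_pullback_measurable[OF restrict_started, of "hit_event (length xs) L"] hit_event_sets[OF L]
  unfolding hit_prob_def started_def by (auto simp: Sigma_Algebra.measure_def)

lemma restrict_hit_event:
  assumes L: "timed_open L" and \<omega>: "\<omega> \<in> pspace (length (xs @ zs))"
  shows "restrict \<omega> {1..length xs} \<in> hit_event (length xs) L \<longleftrightarrow>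
     (\<forall>x\<in>set L. \<exists>i\<in>{1..length xs}. coalesce \<omega> i (fst x) \<in> snd x)"
proof -
  have "coalesce (restrict \<omega> {1..length xs}) i (fst x) = coalesce \<omega> i (fst x)" if "x \<in> set L" "i \<in> {1..length xs}" for x i
    using L that by (intro coalesce_restrict[OF \<omega>]) (auto simp: timed_open_def)
  then show ?thesis using restrict_pspace[OF \<omega>, of "length xs"] by (simp add: hit_event_def)
qed

text \<open>
  A coalesced path depends only on paths with smaller or equal labels, so the first particles of the longer system
  form a copy of the shorter one.
\<close>

lemma hit_prob_prefix:
  assumes L: "timed_open L"
  shows "hit_prob xs L \<le> hit_prob (xs @ zs) L"
proof -
  interpret prob_space "completion (started (xs @ zs))" by (rule prob_started)
  have "hit_event (length (xs @ zs)) L \<in> sets (completion (started (xs @ zs)))"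
    unfolding started_def by (rule hit_event_sets[OF L])
  moreover have "(\<lambda>\<omega>. restrict \<omega> {1..length xs}) -` hit_event (length xs) L \<inter> space (started (xs @ zs)) \<subseteq> hit_event (length (xs @ zs)) L"
  proof
    fix \<omega> assume a: "\<omega> \<in> (\<lambda>\<omega>. restrict \<omega> {1..length xs}) -` hit_event (length xs) L \<inter> space (started (xs @ zs))"
    then have \<omega>: "\<omega> \<in> pspace (length (xs @ zs))" by (simp add: started_def space_particles)
    have "\<forall>x\<in>set L. \<exists>i\<in>{1..length xs}. coalesce \<omega> i (fst x) \<in> snd x"
      using a restrict_hit_event[OF L \<omega>] by blast
    moreover have "{1..length xs} \<subseteq> {1..length (xs @ zs)}" by auto
    ultimately show "\<omega> \<in> hit_event (length (xs @ zs)) L" using \<omega> unfolding hit_event_def by blast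
  qed
  ultimately show ?thesis
    unfolding hit_prob_restrict(2)[OF L, of xs zs, symmetric] hit_prob_def[of "xs @ zs"]
    using hit_prob_restrict(1)[OF L] by (intro finite_measure_mono)
qed

definition meet_event :: "real \<Rightarrow> ((real \<Rightarrow> 'a) \<times> (real \<Rightarrow> 'a)) set" where
  "meet_event t = {w \<in> paths \<times> paths. \<exists>s\<in>{0..t}. fst w s = snd w s}"

definition meet_prob :: "'a \<Rightarrow> 'a \<Rightarrow> real \<Rightarrow> real" where
  "meet_prob x z t = measure (completion (Q x \<Otimes>\<^sub>M Q z)) (meet_event t)"

lemma prob_pair: "prob_space (Q x \<Otimes>\<^sub>M Q z)"
  by (intro prob_space_pair prob_Q)

lemma meet_event_sets: "meet_event t \<in> sets (completion (Q x \<Otimes>\<^sub>M Q z))"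
proof -
  let ?N = "completion (Q x \<Otimes>\<^sub>M Q z)"
  have "{w \<in> space ?N. \<exists>s\<in>{0..t}. fst w s = snd w s} \<in> sets ?N"
  proof (rule meeting_event_measurable)
    show "complete_measure ?N" by (rule completion.complete_measure_axioms)
    show "finite_measure ?N"
      using prob_space.prob_space_completion[OF prob_pair] by (simp add: prob_space_def)
    show "(\<lambda>w. fst w s) \<in> borel_measurable ?N" if "0 \<le> s" for s
      using measurable_compose[OF measurable_fst component_Q[OF that]] by (rule measurable_completion)
    show "(\<lambda>w. snd w s) \<in> borel_measurable ?N" if "0 \<le> s" for s
      using measurable_compose[OF measurable_snd component_Q[OF that]] by (rule measurable_completion)
  qed (auto simp: space_pair_measure space_Q paths_def cadlag_def)
  then show ?thesis by (simp add: meet_event_def space_pair_measure space_Q)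
qed

text \<open>
  The hypothesis on meeting probabilities is a limit at a punctured neighbourhood; this supplies the value at the
  point itself, needed when the two families of starting points have a point in common.
\<close>

lemma meet_prob_same:
  assumes "0 \<le> t"
  shows "meet_prob x x t = 1"
proof -
  interpret P: pair_prob_space "Q x" "Q x"
    unfolding pair_prob_space_def pair_sigma_finite_def using prob_Q prob_space_imp_sigma_finite by auto
  interpret C: prob_space "completion (Q x \<Otimes>\<^sub>M Q x)" by (rule P.prob_space_completion)
  have "AE w in Q x \<Otimes>\<^sub>M Q x. fst w 0 = x \<and> snd w 0 = x"
  proof (rule P.AE_pair_measure)
    have "{w \<in> space (Q x \<Otimes>\<^sub>M Q x). fst w 0 = x} = (\<lambda>w. fst w 0) -` {x} \<inter> space (Q x \<Otimes>\<^sub>M Q x)"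
      "{w \<in> space (Q x \<Otimes>\<^sub>M Q x). snd w 0 = x} = (\<lambda>w. snd w 0) -` {x} \<inter> space (Q x \<Otimes>\<^sub>M Q x)" by auto
    moreover have "(\<lambda>w. fst w 0) -` {x} \<inter> space (Q x \<Otimes>\<^sub>M Q x) \<in> sets (Q x \<Otimes>\<^sub>M Q x)"
      by (rule measurable_sets[OF measurable_compose[OF measurable_fst component_Q]]) auto
    moreover have "(\<lambda>w. snd w 0) -` {x} \<inter> space (Q x \<Otimes>\<^sub>M Q x) \<in> sets (Q x \<Otimes>\<^sub>M Q x)"
      by (rule measurable_sets[OF measurable_compose[OF measurable_snd component_Q]]) auto
    ultimately show "{w \<in> space (Q x \<Otimes>\<^sub>M Q x). fst w 0 = x \<and> snd w 0 = x} \<in> sets (Q x \<Otimes>\<^sub>M Q x)"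
      by (intro sets.sets_Collect_conj) simp_all
    show "AE w in Q x. AE w' in Q x. fst (w, w') 0 = x \<and> snd (w, w') 0 = x"
      using start_Q[of x]
    proof eventually_elim
      case (elim w)
      show ?case using start_Q[of x] by eventually_elim (use elim in simp)
    qed
  qed
  then have "AE w in Q x \<Otimes>\<^sub>M Q x. w \<in> meet_event t"
    using AE_space
  proof eventually_elim
    case (elim w)
    then show ?case using assms by (auto simp: meet_event_def space_pair_measure space_Q intro!: bexI[of _ 0])
  qed
  then have "AE w in completion (Q x \<Otimes>\<^sub>M Q x). w \<in> meet_event t" by (simp add: AE_completion_iff)
  then show ?thesis unfolding meet_prob_def using C.prob_eq_1[OF meet_event_sets] by simp
qed

lemma distr_two_particles:
  assumes "i \<in> {1..n}" "j \<in> {1..n}" "i \<noteq> j"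
  shows "(\<lambda>\<omega>. (\<omega> i, \<omega> j)) \<in> particles n y \<rightarrow>\<^sub>M Q (y i) \<Otimes>\<^sub>M Q (y j)"
    and "distr (particles n y) (Q (y i) \<Otimes>\<^sub>M Q (y j)) (\<lambda>\<omega>. (\<omega> i, \<omega> j)) = Q (y i) \<Otimes>\<^sub>M Q (y j)"
proof -
  show m: "(\<lambda>\<omega>. (\<omega> i, \<omega> j)) \<in> particles n y \<rightarrow>\<^sub>M Q (y i) \<Otimes>\<^sub>M Q (y j)"
    unfolding particles_def using assms by (intro measurable_Pair measurable_component_singleton)
  interpret product_prob_space "\<lambda>i. Q (y i)" "{1..n}"
    by (rule product_prob_spaceI) (rule prob_Q)
  have "Q (y i) \<Otimes>\<^sub>M Q (y j) = distr (particles n y) (Q (y i) \<Otimes>\<^sub>M Q (y j)) (\<lambda>\<omega>. (\<omega> i, \<omega> j))"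
  proof (rule pair_measure_eqI)
    show "sigma_finite_measure (Q (y i))" "sigma_finite_measure (Q (y j))"
      using prob_Q prob_space_imp_sigma_finite by auto
    fix A B assume A: "A \<in> sets (Q (y i))" and B: "B \<in> sets (Q (y j))"
    have "(\<lambda>\<omega>. (\<omega> i, \<omega> j)) -` (A \<times> B) \<inter> space (particles n y) =
        {x \<in> space (PiM {1..n} (\<lambda>i. Q (y i))). \<forall>k\<in>{i, j}. x k \<in> (if k = i then A else B)}"
      using assms(3) by (auto simp: particles_def)
    then have "emeasure (particles n y) ((\<lambda>\<omega>. (\<omega> i, \<omega> j)) -` (A \<times> B) \<inter> space (particles n y)) =
        emeasure (particles n y) {x \<in> space (PiM {1..n} (\<lambda>i. Q (y i))). \<forall>k\<in>{i, j}. x k \<in> (if k = i then A else B)}"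
      by (simp only:)
    also have "\<dots> = (\<Prod>k\<in>{i, j}. emeasure (Q (y k)) (if k = i then A else B))"
    proof -
      have "(if k = i then A else B) \<in> sets (Q (y k))" if "k \<in> {i, j}" for k
        using that A B assms(3) by auto
      moreover have "{i, j} \<subseteq> {1..n}" using assms(1,2) by blast
      ultimately have "emeasure (PiM {1..n} (\<lambda>i. Q (y i)))
            {x \<in> space (PiM {1..n} (\<lambda>i. Q (y i))). \<forall>k\<in>{i, j}. x k \<in> (if k = i then A else B)} =
          (\<Prod>k\<in>{i, j}. emeasure (Q (y k)) (if k = i then A else B))"
        by (intro emeasure_PiM_Collect) simp_all
      then show "emeasure (particles n y) {x \<in> space (PiM {1..n} (\<lambda>i. Q (y i))). \<forall>k\<in>{i, j}. x k \<in> (if k = i then A else B)} =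
          (\<Prod>k\<in>{i, j}. emeasure (Q (y k)) (if k = i then A else B))"
        by (simp only: particles_def)
    qed
    also have "\<dots> = emeasure (Q (y i)) A * emeasure (Q (y j)) B" using assms(3) by simp
    finally show "emeasure (Q (y i)) A * emeasure (Q (y j)) B =
        emeasure (distr (particles n y) (Q (y i) \<Otimes>\<^sub>M Q (y j)) (\<lambda>\<omega>. (\<omega> i, \<omega> j))) (A \<times> B)"
      using emeasure_distr[OF m, of "A \<times> B"] A B by simp
  qed simp
  then show "distr (particles n y) (Q (y i) \<Otimes>\<^sub>M Q (y j)) (\<lambda>\<omega>. (\<omega> i, \<omega> j)) = Q (y i) \<Otimes>\<^sub>M Q (y j)" ..
qed

text \<open>
  Particle 1 is never altered by the recursion. So if the path of the new particle meets it by time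
  \<open>t0\<close>, the new particle has by then met one of the older coalesced paths and follows it at all times
  in \<open>L\<close>.
\<close>

lemma hit_prob_append_first:
  assumes L: "timed_open L" and t0: "0 \<le> t0" and times: "\<And>x. x \<in> set L \<Longrightarrow> t0 \<le> fst x"
  shows "hit_prob ((a # xs) @ [z]) L \<le> hit_prob (a # xs) L + (1 - meet_prob z a t0)"
proof -
  let ?ys = "(a # xs) @ [z]" and ?n = "length (a # xs)"
  let ?N = "completion (started ?ys)"
  interpret prob_space ?N by (rule prob_started)
  define G where "G = (\<lambda>\<omega>. restrict \<omega> {1..?n}) -` hit_event ?n L \<inter> space (started ?ys)"
  define Me where "Me = (\<lambda>\<omega>. (\<omega> (Suc ?n), \<omega> 1)) -` meet_event t0 \<inter> space (started ?ys)"
  have Gs: "G \<in> sets ?N" "prob G = hit_prob (a # xs) L"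
    unfolding G_def using hit_prob_restrict[OF L, of "a # xs" "[z]"] by auto
  have len: "length ?ys = Suc ?n" by simp
  have two: "(\<lambda>\<omega>. (\<omega> (Suc ?n), \<omega> 1)) \<in> started ?ys \<rightarrow>\<^sub>M Q z \<Otimes>\<^sub>M Q a"
    "distr (started ?ys) (Q z \<Otimes>\<^sub>M Q a) (\<lambda>\<omega>. (\<omega> (Suc ?n), \<omega> 1)) = Q z \<Otimes>\<^sub>M Q a"
    using distr_two_particles[of "Suc ?n" "length ?ys" 1 "\<lambda>i. ?ys ! (i - 1)"]
    unfolding started_def by (auto simp: nth_append)
  have Ms: "Me \<in> sets ?N" "prob Me = meet_prob z a t0"
    using completion_pullback_measurable[OF two meet_event_sets] unfolding Me_def meet_prob_def
    by (auto simp: Sigma_Algebra.measure_def)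
  have Hs: "hit_event (length ?ys) L \<in> sets ?N" unfolding started_def by (rule hit_event_sets[OF L])
  have "hit_event (length ?ys) L \<subseteq> G \<union> (space ?N - Me)"
  proof
    fix \<omega> assume h: "\<omega> \<in> hit_event (length ?ys) L"
    then have \<omega>: "\<omega> \<in> pspace (length ?ys)" by (simp add: hit_event_def)
    then have \<omega>s: "\<omega> \<in> space (started ?ys)" by (simp add: started_def space_particles)
    show "\<omega> \<in> G \<union> (space ?N - Me)"
    proof (cases "\<omega> \<in> Me")
      case False then show ?thesis using \<omega>s by simp
    next
      case True
      then obtain s where s: "0 \<le> s" "s \<le> t0" "\<omega> (Suc ?n) s = \<omega> 1 s"
        by (auto simp: Me_def meet_event_def)
      let ?Z = "coalesce \<omega> ` {1..<Suc ?n}"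
      have i: "Suc ?n \<in> {1..length ?ys}" by simp
      have c1: "coalesce \<omega> 1 = \<omega> 1" by (rule coalesce_1)
      have "coalesce \<omega> 1 \<in> ?Z" by (rule imageI) simp
      then have "meets ?Z (\<omega> (Suc ?n)) s" using s(3) c1 unfolding meets_def by metis
      then obtain s0 where s0: "0 \<le> s0" "s0 \<le> s" "meets ?Z (\<omega> (Suc ?n)) s0"
          "\<And>u. 0 \<le> u \<Longrightarrow> u < s0 \<Longrightarrow> \<not> meets ?Z (\<omega> (Suc ?n)) u"
        using first_meeting[OF pspace_right_closed[OF \<omega> i] s(1)] by metis
      obtain w where w: "w \<in> ?Z" "\<And>t. s0 \<le> t \<Longrightarrow> coalesce \<omega> (Suc ?n) t = w t"
        using joinedD2[OF pspace_joined[OF \<omega> i] s0(1,3,4)] by metis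
      then obtain j where j: "j \<in> {1..<Suc ?n}" "w = coalesce \<omega> j" by blast
      have "\<exists>i\<in>{1..?n}. coalesce \<omega> i (fst x) \<in> snd x" if x: "x \<in> set L" for x
      proof -
        obtain i where i: "i \<in> {1..length ?ys}" "coalesce \<omega> i (fst x) \<in> snd x"
          using h x by (auto simp: hit_event_def)
        show ?thesis
        proof (cases "i = Suc ?n")
          case True
          then have "coalesce \<omega> j (fst x) \<in> snd x"
            using i(2) w(2)[of "fst x"] j(2) times[OF x] s s0(2) by auto
          then show ?thesis using j(1) by auto
        next
          case False
          then show ?thesis using i len by (intro bexI[of _ i]) auto
        qed
      qed
      then have "\<omega> \<in> G"
        unfolding G_def using restrict_hit_event[OF L \<omega>] \<omega>s by blast
      then show ?thesis by blast
    qed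
  qed
  then have "prob (hit_event (length ?ys) L) \<le> prob (G \<union> (space ?N - Me))"
    using Hs Gs Ms by (intro finite_measure_mono) auto
  also have "\<dots> \<le> prob G + prob (space ?N - Me)"
    using Gs Ms by (intro measure_Un_le) auto
  also have "\<dots> = hit_prob (a # xs) L + (1 - meet_prob z a t0)"
    using prob_compl[OF Ms(1)] Gs Ms by simp
  finally show ?thesis by (simp add: hit_prob_def)
qed

text \<open>
  Before each point of \<open>zs\<close> is added, the list is reordered so that a point close to it comes first.
\<close>

lemma hit_prob_append_close:
  assumes lc: "locally compact (UNIV :: 'a set)" and L: "timed_open L" and t0: "0 \<le> t0" and times: "\<And>x. x \<in> set L \<Longrightarrow> t0 \<le> fst x"
    and close: "\<And>z. z \<in> set zs \<Longrightarrow> \<exists>a\<in>set xs. 1 - e \<le> meet_prob z a t0"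
  shows "hit_prob (xs @ zs) L \<le> hit_prob xs L + real (length zs) * e"
  using close
proof (induction zs rule: rev_induct)
  case (snoc z zs)
  obtain a where a: "a \<in> set xs" "1 - e \<le> meet_prob z a t0" using snoc.prems[of z] by auto
  obtain us vs where xs: "xs = us @ a # vs" using a(1) by (auto simp: in_set_conv_decomp)
  let ?ws = "us @ vs @ zs"
  have "hit_prob (xs @ zs @ [z]) L = hit_prob ((a # ?ws) @ [z]) L"
    using xs by (intro hit_prob_mset[OF lc L]) simp
  also have "\<dots> \<le> hit_prob (a # ?ws) L + (1 - meet_prob z a t0)"
    by (rule hit_prob_append_first[OF L t0 times])
  also have "hit_prob (a # ?ws) L = hit_prob (xs @ zs) L"
    using xs by (intro hit_prob_mset[OF lc L]) simp
  also have "hit_prob (xs @ zs) L \<le> hit_prob xs L + real (length zs) * e"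
    using snoc.prems by (intro snoc.IH) auto
  finally show ?case using a(2) by (simp add: algebra_simps)
qed simp

text \<open>
  Adding all points of \<open>xs\<close> to \<open>zs\<close> does not decrease the probability, and the joint
  list may be read as \<open>zs\<close> appended to \<open>xs\<close>.
\<close>

lemma hit_prob_compare:
  assumes lc: "locally compact (UNIV :: 'a set)" and L: "timed_open L" and t0: "0 \<le> t0" and times: "\<And>x. x \<in> set L \<Longrightarrow> t0 \<le> fst x"
    and close: "\<And>z. z \<in> set zs \<Longrightarrow> \<exists>a\<in>set xs. 1 - e \<le> meet_prob z a t0"
  shows "hit_prob zs L \<le> hit_prob xs L + real (length zs) * e"
proof -
  have "hit_prob zs L \<le> hit_prob (zs @ xs) L" by (rule hit_prob_prefix[OF L])
  also have "\<dots> = hit_prob (xs @ zs) L" by (rule hit_prob_mset[OF lc L]) simp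
  also have "\<dots> \<le> hit_prob xs L + real (length zs) * e" by (rule hit_prob_append_close[OF lc L t0 times close])
  finally show ?thesis .
qed

end

section \<open>From the process to finite systems\<close>

lemma (in feller_paths) meet_prob_process:
  assumes X: "feller_markov_process P X" and Q: "Q = path_law P X"
  shows "measure (completion (P x \<Otimes>\<^sub>M P z)) {\<omega> \<in> space (P x \<Otimes>\<^sub>M P z). \<exists>t\<in>{0..t0}. X t (fst \<omega>) = X t (snd \<omega>)} =
     meet_prob x z t0"
proof -
  have sp: "sample_path X \<in> P x \<rightarrow>\<^sub>M path_sigma {0..}" for x by (rule feller_process_paths(2)[OF X])
  have spQ: "sample_path X \<in> P x \<rightarrow>\<^sub>M Q x" for x using sp[of x] sets_Q[of x] by (simp cong: measurable_cong_sets)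
  have dQ: "distr (P x) (Q x) (sample_path X) = Q x" for x
    unfolding Q path_law_def by (rule distr_cong) auto
  let ?S = "\<lambda>(a, b). (sample_path X a, sample_path X b)"
  have Sm: "?S \<in> P x \<Otimes>\<^sub>M P z \<rightarrow>\<^sub>M Q x \<Otimes>\<^sub>M Q z" using spQ by (simp add: case_prod_beta')
  have Sd: "distr (P x \<Otimes>\<^sub>M P z) (Q x \<Otimes>\<^sub>M Q z) ?S = Q x \<Otimes>\<^sub>M Q z"
    using pair_measure_distr[OF spQ[of x] spQ[of z]] dQ prob_space_imp_sigma_finite[OF prob_Q] by simp
  have "?S -` meet_event t0 \<inter> space (P x \<Otimes>\<^sub>M P z) =
      {\<omega> \<in> space (P x \<Otimes>\<^sub>M P z). \<exists>t\<in>{0..t0}. X t (fst \<omega>) = X t (snd \<omega>)}"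
    using measurable_space[OF sp] by (auto simp: meet_event_def space_pair_measure sample_path_def)
  then show ?thesis
    using completion_pullback_measurable(2)[OF Sm Sd meet_event_sets[of t0 x z]]
    by (simp add: meet_prob_def Sigma_Algebra.measure_def)
qed

text \<open>
  An increasing sequence of initial segments that exhausts the labels whether \<open>N\<close> is finite or
  infinite.
\<close>

definition level :: "enat \<Rightarrow> nat \<Rightarrow> nat" where
  "level N k = (if enat (Suc k) \<le> N then Suc k else the_enat N)"

lemma level_props:
  assumes "1 \<le> N"
  shows "{1..level N k} \<subseteq> labels N" "1 \<le> level N k" "k \<le> l \<Longrightarrow> level N k \<le> level N l"
    "i \<in> labels N \<Longrightarrow> i \<le> level N i"
  using assms by (cases N; auto simp: level_def labels_def one_enat_def)+

locale copies = feller_paths p Q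
  for p :: "real \<Rightarrow> 'a::{metric_space, second_countable_topology} \<Rightarrow> 'a measure" and Q +
  fixes P :: "'a \<Rightarrow> 'w measure" and X :: "real \<Rightarrow> 'w \<Rightarrow> 'a" and N :: enat and x :: "nat \<Rightarrow> 'a"
    and M :: "'v measure" and \<xi> :: "nat \<Rightarrow> real \<Rightarrow> 'v \<Rightarrow> 'a"
  assumes process: "feller_markov_process P X" and Q_eq: "Q = path_law P X"
    and N1: "1 \<le> N" and copies: "independent_copies P X (labels N) x M \<xi>"
begin

lemma prob_M: "prob_space M"
  and cadlag_M: "i \<in> labels N \<Longrightarrow> \<omega> \<in> space M \<Longrightarrow> cadlag (\<lambda>t. \<xi> i t \<omega>)"
  and start_M: "i \<in> labels N \<Longrightarrow> AE \<omega> in M. \<xi> i 0 \<omega> = x i"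
  and law_M: "i \<in> labels N \<Longrightarrow> distr M path_algebra (sample_path (\<xi> i)) = distr (P (x i)) path_algebra (sample_path X)"
  and indep_M: "prob_space.indep_vars M (\<lambda>_. path_algebra) (\<lambda>i. sample_path (\<xi> i)) (labels N)"
  using copies by (auto simp: independent_copies_def)

sublocale M: prob_space M by (rule prob_M)
sublocale CM: prob_space "completion M" by (rule M.prob_space_completion)

definition joint :: "nat \<Rightarrow> 'v \<Rightarrow> nat \<Rightarrow> real \<Rightarrow> 'a" where
  "joint n \<omega> = (\<lambda>i\<in>{1..n}. sample_path (\<xi> i) \<omega>)"

lemma sample_measurable: "i \<in> labels N \<Longrightarrow> sample_path (\<xi> i) \<in> M \<rightarrow>\<^sub>M path_algebra"
  using indep_M unfolding M.indep_vars_def by auto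

lemma sample_measurable_paths:
  assumes "i \<in> labels N"
  shows "sample_path (\<xi> i) \<in> M \<rightarrow>\<^sub>M path_sigma {0..}"
proof (rule measurable_path_sigma)
  show "sample_path (\<xi> i) \<in> space M \<rightarrow> paths"
    using cadlag_M[OF assms] by (auto intro!: sample_path_in_paths)
  fix t :: real assume "t \<in> {0..}"
  then show "(\<lambda>\<omega>. sample_path (\<xi> i) \<omega> t) \<in> borel_measurable M"
    by (intro measurable_compose[OF sample_measurable[OF assms] measurable_component_singleton])
qed

lemma sample_process_measurable: "sample_path X \<in> P z \<rightarrow>\<^sub>M path_algebra"
proof -
  have "\<And>t. 0 \<le> t \<Longrightarrow> X t \<in> borel_measurable (P z)"
    using process by (auto simp: feller_markov_process_def)
  then show ?thesis unfolding sample_path_def by (intro measurable_restrict) auto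
qed

lemma sample_law:
  assumes i: "i \<in> labels N" and A: "A \<in> sets (path_sigma {0..})" "B \<in> sets path_algebra" "A = B \<inter> paths"
  shows "emeasure M (sample_path (\<xi> i) -` B \<inter> space M) = emeasure (Q (x i)) A"
proof -
  have "emeasure M (sample_path (\<xi> i) -` B \<inter> space M) = emeasure (distr M path_algebra (sample_path (\<xi> i))) B"
    using emeasure_distr[OF sample_measurable[OF i] A(2)] by simp
  also have "\<dots> = emeasure (P (x i)) (sample_path X -` B \<inter> space (P (x i)))"
    unfolding law_M[OF i] by (rule emeasure_distr[OF sample_process_measurable A(2)])
  also have "sample_path X -` B \<inter> space (P (x i)) = sample_path X -` A \<inter> space (P (x i))"
    using measurable_space[OF feller_process_paths(2)[OF process]] A(3) by auto
  also have "emeasure (P (x i)) \<dots> = emeasure (Q (x i)) A"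
    unfolding Q_eq path_law_def by (rule emeasure_distr[OF feller_process_paths(2)[OF process] A(1), symmetric])
  finally show ?thesis .
qed

text \<open>
  The distribution and independence of the copies are given on the product space of all functions; on the space of
  cadlag paths every event is the trace of such a set.
\<close>

lemma joint_law:
  assumes n: "1 \<le> n" "{1..n} \<subseteq> labels N"
  shows "joint n \<in> M \<rightarrow>\<^sub>M particles n x" "distr M (particles n x) (joint n) = particles n x"
proof -
  have "joint n \<in> M \<rightarrow>\<^sub>M PiM {1..n} (\<lambda>_. path_sigma {0..})"
    unfolding joint_def using n sample_measurable_paths by (intro measurable_restrict) auto
  then show m: "joint n \<in> M \<rightarrow>\<^sub>M particles n x" using sets_particles[of n x] by (simp cong: measurable_cong_sets)
  interpret product_sigma_finite "\<lambda>i. Q (x i)"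
    unfolding product_sigma_finite_def using prob_Q prob_space_imp_sigma_finite by auto
  show "distr M (particles n x) (joint n) = particles n x"
    unfolding particles_def
  proof (rule PiM_eqI)
    fix A assume A: "\<And>i. i \<in> {1..n} \<Longrightarrow> A i \<in> sets (Q (x i))"
    then have A0: "A i \<in> sets (path_sigma {0..})" if "i \<in> {1..n}" for i using that sets_Q by auto
    have "\<forall>i\<in>{1..n}. \<exists>B. B \<in> sets path_algebra \<and> A i = B \<inter> paths"
      using path_sigma_trace[OF A0] by blast
    then obtain B where B: "\<And>i. i \<in> {1..n} \<Longrightarrow> B i \<in> sets path_algebra" "\<And>i. i \<in> {1..n} \<Longrightarrow> A i = B i \<inter> paths"
      by metis
    have AP: "PiE {1..n} A \<in> sets (particles n x)"
      unfolding particles_def using A by (intro sets_PiM_I_finite) auto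
    have "emeasure (distr M (particles n x) (joint n)) (PiE {1..n} A) = emeasure M (joint n -` PiE {1..n} A \<inter> space M)"
      by (rule emeasure_distr[OF m AP])
    also have "joint n -` PiE {1..n} A \<inter> space M = (\<Inter>i\<in>{1..n}. sample_path (\<xi> i) -` B i \<inter> space M)"
    proof (intro equalityI subsetI)
      fix \<omega> assume "\<omega> \<in> joint n -` PiE {1..n} A \<inter> space M"
      then have \<omega>: "\<omega> \<in> space M" and J: "joint n \<omega> i \<in> A i" if "i \<in> {1..n}" for i
        using that by (auto simp: PiE_def Pi_def)
      show "\<omega> \<in> (\<Inter>i\<in>{1..n}. sample_path (\<xi> i) -` B i \<inter> space M)"
        using \<omega> J B(2) n(1) by (force simp: joint_def)
    next
      fix \<omega> assume h: "\<omega> \<in> (\<Inter>i\<in>{1..n}. sample_path (\<xi> i) -` B i \<inter> space M)"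
      have \<omega>: "\<omega> \<in> space M" using h n(1) by auto
      have "sample_path (\<xi> i) \<omega> \<in> A i" if i: "i \<in> {1..n}" for i
      proof -
        have "sample_path (\<xi> i) \<omega> \<in> B i" using h i by blast
        moreover have "sample_path (\<xi> i) \<omega> \<in> paths"
          using measurable_space[OF sample_measurable_paths, of i \<omega>] \<omega> i n(2) by auto
        ultimately show ?thesis using B(2)[OF i] by blast
      qed
      then show "\<omega> \<in> joint n -` PiE {1..n} A \<inter> space M" using \<omega> by (auto simp: joint_def)
    qed
    also have "emeasure M \<dots> = ennreal (\<Prod>i\<in>{1..n}. M.prob (sample_path (\<xi> i) -` B i \<inter> space M))"
      unfolding M.emeasure_eq_measure
      by (subst M.indep_varsD[OF indep_M]) (use n B in auto)
    also have "\<dots> = (\<Prod>i\<in>{1..n}. emeasure M (sample_path (\<xi> i) -` B i \<inter> space M))"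
      unfolding M.emeasure_eq_measure by (rule prod_ennreal[symmetric]) simp
    also have "\<dots> = (\<Prod>i\<in>{1..n}. emeasure (Q (x i)) (A i))"
      using n by (intro prod.cong refl sample_law A0 B) auto
    finally show "emeasure (distr M (PiM {1..n} (\<lambda>i. Q (x i))) (joint n)) (PiE {1..n} A) = (\<Prod>i\<in>{1..n}. emeasure (Q (x i)) (A i))"
      by (simp add: particles_def)
  qed simp_all
qed

abbreviation "start_list n \<equiv> map x [1..<Suc n]"

lemma started_start_list: "started (start_list n) = particles n x"
  unfolding started_def particles_def
proof (rule PiM_cong)
  fix i assume "i \<in> {1..length (start_list n)}"
  then show "Q (start_list n ! (i - 1)) = Q (x i)" by (auto simp del: upt_Suc)
qed simp

definition finite_hits :: "nat \<Rightarrow> (real \<times> 'a set) list \<Rightarrow> 'v set" where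
  "finite_hits n L = {\<omega> \<in> space M. \<forall>u\<in>set L. \<exists>i\<in>{1..n}. coalesce (\<lambda>i s. \<xi> i s \<omega>) i (fst u) \<in> snd u}"

lemma finite_hits_prob:
  assumes n: "1 \<le> n" "{1..n} \<subseteq> labels N" and L: "timed_open L"
  shows "finite_hits n L \<in> sets (completion M)" "measure (completion M) (finite_hits n L) = hit_prob (start_list n) L"
proof -
  have "joint n -` hit_event n L \<inter> space M = finite_hits n L"
  proof -
    have "joint n \<omega> \<in> hit_event n L \<longleftrightarrow> \<omega> \<in> finite_hits n L" if \<omega>: "\<omega> \<in> space M" for \<omega>
    proof -
      have J: "joint n \<omega> \<in> pspace n" using measurable_space[OF joint_law(1)[OF n] \<omega>] by (simp add: space_particles)
      have "coalesce (joint n \<omega>) i t = coalesce (\<lambda>i s. \<xi> i s \<omega>) i t" if "i \<in> {1..n}" "0 \<le> t" for i t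
      proof (rule coalesce_cong[of n])
        show "cadlag (joint n \<omega> i)" if "i \<in> {1..n}" for i by (rule particle_cadlag[OF J that])
        show "cadlag (\<lambda>s. \<xi> i s \<omega>)" if "i \<in> {1..n}" for i using cadlag_M[of i \<omega>] \<omega> that n by auto
        show "joint n \<omega> i t = \<xi> i t \<omega>" if "i \<in> {1..n}" "0 \<le> t" for i t
          using that by (simp add: joint_def sample_path_def)
      qed (use that in auto)
      then show ?thesis using L J \<omega> by (auto simp: hit_event_def finite_hits_def timed_open_def)
    qed
    then show ?thesis by (auto simp: finite_hits_def)
  qed
  note pull = completion_pullback_measurable[OF joint_law[OF n] hit_event_sets[OF L], unfolded this]
  show "finite_hits n L \<in> sets (completion M)" by (rule pull(1))
  have "length (start_list n) = n" by (simp del: upt_Suc)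
  then show "measure (completion M) (finite_hits n L) = hit_prob (start_list n) L"
    unfolding hit_prob_def started_start_list Sigma_Algebra.measure_def pull(2) by (simp only:)
qed

definition hits :: "(real \<times> 'a set) list \<Rightarrow> 'v set" where
  "hits L = {\<omega> \<in> space M. \<forall>u\<in>set L. coalescing_set N \<xi> (fst u) \<omega> \<inter> snd u \<noteq> {}}"

lemma coalescing_set_hits:
  assumes "open G"
  shows "coalescing_set N \<xi> t \<omega> \<inter> G \<noteq> {} \<longleftrightarrow> (\<exists>i\<in>labels N. coalesce (\<lambda>i s. \<xi> i s \<omega>) i t \<in> G)"
  unfolding coalescing_set_def using open_Int_closure_eq_empty[OF assms] by (auto simp: Int_commute)

lemma hits_Union:
  assumes L: "timed_open L"
  shows "hits L = (\<Union>k. finite_hits (level N k) L)" "incseq (\<lambda>k. finite_hits (level N k) L)"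
proof -
  note lev = level_props[OF N1]
  have hits: "\<omega> \<in> hits L \<longleftrightarrow> \<omega> \<in> space M \<and> (\<forall>u\<in>set L. \<exists>i\<in>labels N. coalesce (\<lambda>i s. \<xi> i s \<omega>) i (fst u) \<in> snd u)" for \<omega>
    unfolding hits_def using coalescing_set_hits L by (auto simp: timed_open_def)
  show "hits L = (\<Union>k. finite_hits (level N k) L)"
  proof (intro equalityI subsetI)
    fix \<omega> assume "\<omega> \<in> hits L"
    then have \<omega>: "\<omega> \<in> space M" and "\<forall>u\<in>set L. \<exists>i. i \<in> labels N \<and> coalesce (\<lambda>i s. \<xi> i s \<omega>) i (fst u) \<in> snd u"
      using hits by auto
    then obtain i where i: "\<And>u. u \<in> set L \<Longrightarrow> i u \<in> labels N \<and> coalesce (\<lambda>i s. \<xi> i s \<omega>) (i u) (fst u) \<in> snd u" by metis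
    define k where "k = Max (insert 0 (i ` set L))"
    have "i u \<in> {1..level N k}" if u: "u \<in> set L" for u
    proof -
      have "i u \<le> k" unfolding k_def using u by (intro Max_ge) auto
      then have "i u \<le> level N k" using lev(4)[of "i u"] lev(3)[of "i u" k] i[OF u] by auto
      then show ?thesis using i[OF u] by (auto simp: labels_def)
    qed
    then have "\<omega> \<in> finite_hits (level N k) L" unfolding finite_hits_def using \<omega> i by blast
    then show "\<omega> \<in> (\<Union>k. finite_hits (level N k) L)" by blast
  next
    fix \<omega> assume "\<omega> \<in> (\<Union>k. finite_hits (level N k) L)"
    then show "\<omega> \<in> hits L" unfolding hits finite_hits_def using lev(1) by blast
  qed
  show "incseq (\<lambda>k. finite_hits (level N k) L)"
  proof (rule incseq_SucI)
    fix k
    have "{1..level N k} \<subseteq> {1..level N (Suc k)}" using lev(3)[of k "Suc k"] by auto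
    then show "finite_hits (level N k) L \<subseteq> finite_hits (level N (Suc k)) L"
      unfolding finite_hits_def by blast
  qed
qed

lemma hits_sets:
  assumes "timed_open L"
  shows "hits L \<in> sets (completion M)"
  unfolding hits_Union(1)[OF assms] using finite_hits_prob(1)[OF level_props(2)[OF N1] level_props(1)[OF N1] assms] by auto

lemma hits_lim:
  assumes "timed_open L"
  shows "(\<lambda>k. hit_prob (start_list (level N k)) L) \<longlonglongrightarrow> measure (completion M) (hits L)"
    and "hit_prob (start_list (level N k)) L \<le> measure (completion M) (hits L)"
proof -
  note fh = finite_hits_prob[OF level_props(2)[OF N1] level_props(1)[OF N1] assms]
  have "(\<lambda>k. measure (completion M) (finite_hits (level N k) L)) \<longlonglongrightarrow> measure (completion M) (\<Union>k. finite_hits (level N k) L)"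
    using fh(1) hits_Union(2)[OF assms] by (intro CM.finite_Lim_measure_incseq) auto
  then show "(\<lambda>k. hit_prob (start_list (level N k)) L) \<longlonglongrightarrow> measure (completion M) (hits L)"
    unfolding fh(2) hits_Union(1)[OF assms, symmetric] .
  have "measure (completion M) (finite_hits (level N k) L) \<le> measure (completion M) (hits L)"
    using fh(1) hits_sets[OF assms] unfolding hits_Union(1)[OF assms] by (intro CM.finite_measure_mono) auto
  then show "hit_prob (start_list (level N k)) L \<le> measure (completion M) (hits L)" unfolding fh(2) .
qed

text \<open>
  At time 0 every coalesced path is still at its starting point, so conditions at time 0 either hold almost surely
  or almost never, and only the closure of the starting points decides which.
\<close>

lemma hits_start:
  assumes L: "timed_open L"
  shows "measure (completion M) (hits L) =
    (if \<forall>u\<in>set L. fst u = 0 \<longrightarrow> closure (x ` labels N) \<inter> snd u \<noteq> {}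
     then measure (completion M) (hits (filter (\<lambda>u. 0 < fst u) L)) else 0)"
proof -
  let ?L = "filter (\<lambda>u. 0 < fst u) L" and ?C = "\<forall>u\<in>set L. fst u = 0 \<longrightarrow> closure (x ` labels N) \<inter> snd u \<noteq> {}"
  have L': "timed_open ?L" using L by (auto simp: timed_open_def)
  have "AE \<omega> in M. \<forall>i\<in>labels N. \<xi> i 0 \<omega> = x i"
    using start_M by (subst AE_ball_countable) auto
  then have "AE \<omega> in M. \<omega> \<in> hits L \<longleftrightarrow> ?C \<and> \<omega> \<in> hits ?L"
    using AE_space
  proof eventually_elim
    case (elim \<omega>)
    have "coalesce (\<lambda>i s. \<xi> i s \<omega>) i 0 = x i" if i: "i \<in> labels N" for i
    proof -
      have "cadlag (\<lambda>s. \<xi> j s \<omega>)" if "j \<in> {1..i}" for j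
      proof -
        have "enat j \<le> N" using that i by (auto simp: labels_def intro: order.trans[of _ "enat i"])
        then show ?thesis using that elim by (intro cadlag_M) (auto simp: labels_def)
      qed
      then have "joined (coalesce (\<lambda>i s. \<xi> i s \<omega>) ` {1..<i}) (\<lambda>s. \<xi> i s \<omega>) (coalesce (\<lambda>i s. \<xi> i s \<omega>) i)"
        using coalesce_joined[of i "\<lambda>i s. \<xi> i s \<omega>" i] i by (auto simp: labels_def)
      from joined_initial[OF this] show ?thesis using elim i by simp
    qed
    then have "(\<lambda>i. coalesce (\<lambda>i s. \<xi> i s \<omega>) i 0) ` labels N = x ` labels N" by (rule image_cong[OF refl])
    then have "{coalesce (\<lambda>i s. \<xi> i s \<omega>) i 0 | i. i \<in> labels N} = x ` labels N" by (simp only: Setcompr_eq_image)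
    then have c0: "coalescing_set N \<xi> 0 \<omega> = closure (x ` labels N)" by (simp add: coalescing_set_def)
    have "(\<forall>u\<in>set L. coalescing_set N \<xi> (fst u) \<omega> \<inter> snd u \<noteq> {}) \<longleftrightarrow>
        ?C \<and> (\<forall>u\<in>set ?L. coalescing_set N \<xi> (fst u) \<omega> \<inter> snd u \<noteq> {})"
    proof (intro iffI conjI ballI impI)
      fix u assume a: "?C \<and> (\<forall>u\<in>set ?L. coalescing_set N \<xi> (fst u) \<omega> \<inter> snd u \<noteq> {})" and u: "u \<in> set L"
      have "fst u = 0 \<or> 0 < fst u" using L u by (auto simp: timed_open_def le_less)
      then show "coalescing_set N \<xi> (fst u) \<omega> \<inter> snd u \<noteq> {}" using a u c0 by auto
    next
      fix u assume "\<forall>u\<in>set L. coalescing_set N \<xi> (fst u) \<omega> \<inter> snd u \<noteq> {}" "u \<in> set L" "fst u = 0"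
      then show "closure (x ` labels N) \<inter> snd u \<noteq> {}" using c0 by metis
    qed auto
    then show ?case using elim by (simp add: hits_def)
  qed
  then have AE: "AE \<omega> in completion M. \<omega> \<in> hits L \<longleftrightarrow> ?C \<and> \<omega> \<in> hits ?L" by (simp add: AE_completion_iff)
  show ?thesis
  proof (cases ?C)
    case True
    then have "AE \<omega> in completion M. \<omega> \<in> hits L \<longleftrightarrow> \<omega> \<in> hits ?L" using AE by simp
    then show ?thesis using True hits_sets[OF L] hits_sets[OF L'] by (simp add: CM.finite_measure_eq_AE)
  next
    case False
    have "AE \<omega> in completion M. \<omega> \<in> hits L \<longleftrightarrow> \<omega> \<in> {}"
      using AE by eventually_elim (use False in blast)
    then have "measure (completion M) (hits L) = measure (completion M) {}"
      using hits_sets[OF L] by (intro CM.finite_measure_eq_AE) auto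
    then show ?thesis using False by (simp only: if_False measure_empty)
  qed
qed

lemma coalescing_set_state: "coalescing_set N \<xi> t \<omega> \<in> set_states"
proof -
  have "1 \<in> labels N" using N1 by (simp add: labels_def one_enat_def)
  then show ?thesis unfolding set_states_eq coalescing_set_def by (auto simp: closure_eq_empty)
qed

lemma coalescing_set_measurable:
  assumes "0 \<le> t"
  shows "coalescing_set N \<xi> t \<in> completion M \<rightarrow>\<^sub>M hit_algebra"
  unfolding hit_algebra_def
proof (rule measurable_measure_of[OF hit_set_subset])
  show "coalescing_set N \<xi> t \<in> space (completion M) \<rightarrow> set_states" using coalescing_set_state by auto
  fix y :: "'a set set" assume "y \<in> {hit_set G | G. open G}"
  then obtain G where G: "y = hit_set G" "open G" by blast
  have "coalescing_set N \<xi> t -` y \<inter> space (completion M) = hits [(t, G)]"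
    using coalescing_set_state by (auto simp: hits_def G(1) hit_set_def)
  then show "coalescing_set N \<xi> t -` y \<inter> space (completion M) \<in> sets (completion M)"
    using hits_sets[of "[(t, G)]"] assms G(2) by (simp add: timed_open_def)
qed

lemma set_process_measurable: "sample_path (coalescing_set N \<xi>) \<in> completion M \<rightarrow>\<^sub>M PiM {0..} (\<lambda>_. hit_algebra)"
  unfolding sample_path_def using coalescing_set_measurable by (intro measurable_restrict) auto

end

section \<open>Comparison of two families of starting points\<close>

text \<open>
  The least of 1 and the times in \<open>L\<close> serves as \<open>t0\<close>. Given \<open>n\<close> starting
  points of the first family and \<open>e > 0\<close>, each has a point of the second family so near that the
  two meet by \<open>t0\<close> with probability at least \<open>1 - e / n\<close>. These points lie in some
  finite initial segment of the second family, and \<open>hit_prob_compare\<close> bounds the loss by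
  \<open>n * (e / n)\<close>.
\<close>

lemma hits_le:
  fixes x' x'' :: "nat \<Rightarrow> 'a::{metric_space, second_countable_topology}"
  assumes lc: "locally compact (UNIV :: 'a set)"
    and c1: "copies p Q P X N x' M' \<xi>'" and c2: "copies p Q P X N x'' M'' \<xi>''"
    and meet: "\<And>t0 y'. t0 > 0 \<Longrightarrow>
           ((\<lambda>y''. measure (completion (P y' \<Otimes>\<^sub>M P y''))
                {\<omega> \<in> space (P y' \<Otimes>\<^sub>M P y''). \<exists>t\<in>{0..t0}. X t (fst \<omega>) = X t (snd \<omega>)})
             \<longlongrightarrow> 1) (at y')"
    and cl: "closure (x' ` labels N) \<subseteq> closure (x'' ` labels N)"
    and L: "timed_open L" "\<And>u. u \<in> set L \<Longrightarrow> 0 < fst u"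
  shows "measure (completion M') (copies.hits N M' \<xi>' L) \<le> measure (completion M'') (copies.hits N M'' \<xi>'' L)"
proof -
  interpret c1: copies p Q P X N x' M' \<xi>' by fact
  interpret c2: copies p Q P X N x'' M'' \<xi>'' by fact
  define t0 where "t0 = Min (insert 1 (fst ` set L))"
  have t0: "0 < t0" "\<And>u. u \<in> set L \<Longrightarrow> t0 \<le> fst u"
    unfolding t0_def using L(2) by (auto simp: Min_gr_iff intro!: Min_le)
  have near: "\<exists>\<delta>>0. \<forall>a. dist a z < \<delta> \<longrightarrow> 1 - e \<le> c1.meet_prob z a t0" if e: "0 < e" for z e
  proof -
    have "((\<lambda>a. c1.meet_prob z a t0) \<longlongrightarrow> 1) (at z)"
      using meet[OF t0(1), of z] unfolding c1.meet_prob_process[OF c1.process c1.Q_eq] .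
    then have "eventually (\<lambda>a. 1 - e < c1.meet_prob z a t0) (at z)"
      using e by (intro order_tendstoD(1)) auto
    then obtain \<delta> where \<delta>: "0 < \<delta>" "\<And>a. a \<noteq> z \<Longrightarrow> dist a z < \<delta> \<Longrightarrow> 1 - e < c1.meet_prob z a t0"
      by (auto simp: eventually_at)
    have "1 - e \<le> c1.meet_prob z a t0" if "dist a z < \<delta>" for a
      using \<delta>(2)[of a] that c1.meet_prob_same[of t0 z] t0(1) e by (cases "a = z") auto
    then show ?thesis using \<delta>(1) by blast
  qed
  have "c1.hit_prob (c1.start_list (level N k)) L \<le> measure (completion M'') (c2.hits L)" for k
  proof (rule field_le_epsilon)
    fix e :: real assume e: "0 < e"
    let ?zs = "c1.start_list (level N k)"
    let ?e = "e / real (level N k)"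
    have lk: "0 < level N k" using level_props(2)[OF c1.N1, of k] by simp
    have ex: "\<exists>i. i \<in> labels N \<and> 1 - ?e \<le> c1.meet_prob z (x'' i) t0" if z: "z \<in> set ?zs" for z
    proof -
      obtain \<delta> where \<delta>: "0 < \<delta>" "\<And>a. dist a z < \<delta> \<Longrightarrow> 1 - ?e \<le> c1.meet_prob z a t0"
        using near[of ?e z] e lk by auto
      have "z \<in> x' ` {1..level N k}"
        using z by (simp only: set_map set_upt atLeastLessThanSuc_atLeastAtMost)
      then obtain j where j: "j \<in> {1..level N k}" "z = x' j" by blast
      have "z \<in> x' ` labels N" using j level_props(1)[OF c1.N1, of k] by auto
      then have "z \<in> closure (x'' ` labels N)" using cl closure_subset[of "x' ` labels N"] by blast
      then obtain i where "i \<in> labels N" "dist (x'' i) z < \<delta>"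
        using \<delta>(1) by (auto simp: closure_approachable)
      then show ?thesis using \<delta>(2) by blast
    qed
    then obtain i where i: "\<And>z. z \<in> set ?zs \<Longrightarrow> i z \<in> labels N \<and> 1 - ?e \<le> c1.meet_prob z (x'' (i z)) t0"
      by metis
    define l where "l = Max (insert 0 (i ` set ?zs))"
    have close: "\<exists>a\<in>set (c2.start_list (level N l)). 1 - ?e \<le> c1.meet_prob z a t0" if z: "z \<in> set ?zs" for z
    proof -
      have "i z \<le> l" unfolding l_def using z by (intro Max_ge) auto
      then have "i z \<le> level N l"
        using level_props(3,4)[OF c1.N1, of "i z"] i[OF z] by (meson order.trans)
      then have "i z \<in> {1..level N l}" using i[OF z] by (auto simp: labels_def)
      then show ?thesis using i[OF z] by (intro bexI[of _ "x'' (i z)"]) (auto simp del: upt_Suc)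
    qed
    have "c1.hit_prob ?zs L \<le> c1.hit_prob (c2.start_list (level N l)) L + real (length ?zs) * ?e"
      using c1.hit_prob_compare[OF lc L(1) less_imp_le[OF t0(1)] t0(2) close] by blast
    also have "real (length ?zs) * ?e = e" using lk by (simp del: upt_Suc)
    also have "c1.hit_prob (c2.start_list (level N l)) L \<le> measure (completion M'') (c2.hits L)"
      by (rule c2.hits_lim(2)[OF L(1)])
    finally show "c1.hit_prob ?zs L \<le> measure (completion M'') (c2.hits L) + e" by simp
  qed
  then show ?thesis using LIMSEQ_le_const2[OF c1.hits_lim(1)[OF L(1)]] by blast
qed

lemma hits_eq:
  fixes x' x'' :: "nat \<Rightarrow> 'a::{metric_space, second_countable_topology}"
  assumes lc: "locally compact (UNIV :: 'a set)"
    and c1: "copies p Q P X N x' M' \<xi>'" and c2: "copies p Q P X N x'' M'' \<xi>''"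
    and meet: "\<And>t0 y'. t0 > 0 \<Longrightarrow>
           ((\<lambda>y''. measure (completion (P y' \<Otimes>\<^sub>M P y''))
                {\<omega> \<in> space (P y' \<Otimes>\<^sub>M P y''). \<exists>t\<in>{0..t0}. X t (fst \<omega>) = X t (snd \<omega>)})
             \<longlongrightarrow> 1) (at y')"
    and cl: "closure (x' ` labels N) = closure (x'' ` labels N)"
    and L: "timed_open L"
  shows "measure (completion M') (copies.hits N M' \<xi>' L) = measure (completion M'') (copies.hits N M'' \<xi>'' L)"
proof -
  interpret c1: copies p Q P X N x' M' \<xi>' by fact
  interpret c2: copies p Q P X N x'' M'' \<xi>'' by fact
  let ?L = "filter (\<lambda>u. 0 < fst u) L"
  have L': "timed_open ?L" "\<And>u. u \<in> set ?L \<Longrightarrow> 0 < fst u" using L by (auto simp: timed_open_def)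
  have "measure (completion M') (c1.hits ?L) = measure (completion M'') (c2.hits ?L)"
    using hits_le[OF lc c1 c2 meet _ L'] hits_le[OF lc c2 c1 meet _ L'] cl by (intro antisym) auto
  then show ?thesis unfolding c1.hits_start[OF L] c2.hits_start[OF L] cl by auto
qed

section \<open>Laws of set-valued processes\<close>

definition set_cylinder :: "(real \<times> 'a::topological_space set) list \<Rightarrow> (real \<Rightarrow> 'a set) set" where
  "set_cylinder L = {F \<in> PiE {0..} (\<lambda>_. set_states). \<forall>u\<in>set L. F (fst u) \<inter> snd u \<noteq> {}}"

lemma sets_PiM_hit_algebra:
  "sets (PiM {0..} (\<lambda>_. hit_algebra :: 'a::topological_space set measure)) =
     sigma_sets (PiE {0..} (\<lambda>_. set_states)) {set_cylinder L | L. timed_open L}"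
proof -
  let ?\<Omega> = "PiE {0..} (\<lambda>_. set_states :: 'a set set) :: (real \<Rightarrow> 'a set) set"
  let ?C = "{set_cylinder L | L. timed_open L} :: (real \<Rightarrow> 'a set) set set"
  let ?P = "PiM {0..} (\<lambda>_. hit_algebra) :: (real \<Rightarrow> 'a set) measure"
  let ?N = "sigma ?\<Omega> ?C"
  have CP: "?C \<subseteq> Pow ?\<Omega>" by (auto simp: set_cylinder_def)
  have sN: "space ?N = ?\<Omega>" "sets ?N = sigma_sets ?\<Omega> ?C" using CP by (auto simp: space_measure_of sets_measure_of)
  have "sets ?P \<subseteq> sets ?N"
  proof (rule sets_PiM_in_sets)
    show "space ?N = (\<Pi>\<^sub>E t\<in>{0..}. space (hit_algebra :: 'a set measure))" using sN by simp
    fix t :: real and A :: "'a set set" assume t: "t \<in> {0..}" and A: "A \<in> sets hit_algebra"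
    have "(\<lambda>F. F t) \<in> ?N \<rightarrow>\<^sub>M hit_algebra"
      unfolding hit_algebra_def
    proof (rule measurable_measure_of[OF hit_set_subset])
      show "(\<lambda>F. F t) \<in> space ?N \<rightarrow> set_states" using t unfolding sN(1) by (auto simp: PiE_def Pi_def)
      fix y :: "'a set set" assume "y \<in> {hit_set G | G. open G}"
      then obtain G where G: "y = hit_set G" "open G" by blast
      have "(\<lambda>F. F t) -` y \<inter> space ?N = set_cylinder [(t, G)]"
        unfolding sN(1) G(1) using t by (auto simp: set_cylinder_def hit_set_def)
      also have "\<dots> \<in> ?C" using t G by (auto simp: timed_open_def intro!: exI[of _ "[(t, G)]"])
      finally show "(\<lambda>F. F t) -` y \<inter> space ?N \<in> sets ?N" unfolding sN(2) by (rule sigma_sets.Basic)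
    qed
    from measurable_sets[OF this A] show "{F \<in> space ?N. F t \<in> A} \<in> sets ?N"
      by (simp add: vimage_def Int_def conj_commute)
  qed
  moreover have "sigma_sets (space ?P) ?C \<subseteq> sets ?P"
  proof (rule sets.sigma_sets_subset, safe)
    fix L :: "(real \<times> 'a set) list" assume L: "timed_open L"
    have "{F \<in> space ?P. \<forall>u\<in>set L. F (fst u) \<in> hit_set (snd u)} \<in> sets ?P"
    proof (rule sets.sets_Collect_finite_All)
      fix u assume u: "u \<in> set L"
      have m: "(\<lambda>F. F (fst u)) \<in> ?P \<rightarrow>\<^sub>M hit_algebra"
        using L u by (intro measurable_component_singleton) (auto simp: timed_open_def)
      have "hit_set (snd u) \<in> sets hit_algebra" using L u by (intro hit_set_in_sets) (auto simp: timed_open_def)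
      from measurable_sets[OF m this] show "{F \<in> space ?P. F (fst u) \<in> hit_set (snd u)} \<in> sets ?P"
        by (simp add: vimage_def Int_def conj_commute)
    qed simp
    moreover have "{F \<in> space ?P. \<forall>u\<in>set L. F (fst u) \<in> hit_set (snd u)} = set_cylinder L"
      using L by (auto simp: set_cylinder_def hit_set_def space_PiM timed_open_def PiE_def Pi_def)
    ultimately show "set_cylinder L \<in> sets ?P" by simp
  qed
  ultimately show ?thesis unfolding sN by (simp add: space_PiM)
qed

lemma measure_eqI_set_cylinder:
  fixes M N :: "(real \<Rightarrow> 'a::topological_space set) measure"
  assumes s: "sets M = sets (PiM {0..} (\<lambda>_. hit_algebra))" "sets N = sets (PiM {0..} (\<lambda>_. hit_algebra))"
    and fin: "finite_measure M"
    and eq: "\<And>L. timed_open L \<Longrightarrow> emeasure M (set_cylinder L) = emeasure N (set_cylinder L)"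
  shows "M = N"
proof (rule measure_eqI_generator_eq)
  let ?\<Omega> = "PiE {0..} (\<lambda>_. set_states :: 'a set set) :: (real \<Rightarrow> 'a set) set"
  let ?C = "{set_cylinder L | L. timed_open L} :: (real \<Rightarrow> 'a set) set set"
  show "Int_stable ?C"
  proof (rule Int_stableI, elim CollectE exE conjE)
    fix a b :: "(real \<Rightarrow> 'a set) set" and L L' assume "a = set_cylinder L" "b = set_cylinder L'" "timed_open L" "timed_open L'"
    then have "a \<inter> b = set_cylinder (L @ L')" "timed_open (L @ L')"
      by (auto simp: set_cylinder_def timed_open_append)
    then show "a \<inter> b \<in> ?C" by blast
  qed
  show "?C \<subseteq> Pow ?\<Omega>" by (auto simp: set_cylinder_def)
  show "sets M = sigma_sets ?\<Omega> ?C" "sets N = sigma_sets ?\<Omega> ?C"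
    unfolding s sets_PiM_hit_algebra by simp_all
  show "emeasure M X = emeasure N X" if "X \<in> ?C" for X using eq that by blast
next
  show "range (\<lambda>_::nat. set_cylinder []) \<subseteq> {set_cylinder L | L. timed_open L}"
    by (auto simp: timed_open_def intro!: exI[of _ "[]"])
  show "(\<Union>i::nat. set_cylinder []) = PiE {0..} (\<lambda>_. set_states)" by (auto simp: set_cylinder_def)
  show "emeasure M (set_cylinder []) \<noteq> \<infinity>" for i :: nat
    using finite_measure.emeasure_finite[OF fin] by simp
qed

lemma sets_set_path_algebra_subset:
  fixes d :: "'a::metric_space option \<Rightarrow> 'a option \<Rightarrow> real"
  assumes "\<not> compact (UNIV :: 'a set) \<Longrightarrow>
           Metric_space UNIV d \<and> Metric_space.mtopology UNIV d = compactified"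
  shows "sets (set_path_algebra d) \<subseteq> sets (PiM {0..} (\<lambda>_. hit_algebra))"
    and "space (set_path_algebra d) = space (PiM {0..} (\<lambda>_. hit_algebra :: 'a set measure))"
proof -
  note sb = set_borel_subset_hit[of d, OF assms]
  show sp: "space (set_path_algebra d) = space (PiM {0..} (\<lambda>_. hit_algebra :: 'a set measure))"
    by (simp add: space_PiM sb(2))
  show "sets (set_path_algebra d) \<subseteq> sets (PiM {0..} (\<lambda>_. hit_algebra))"
  proof (rule sets_PiM_in_sets)
    show "space (PiM {0..} (\<lambda>_. hit_algebra)) = (\<Pi>\<^sub>E t\<in>{0..}. space (set_borel d))" by (simp add: space_PiM sb(2))
    fix t :: real and A assume t: "t \<in> {0..}" and A: "A \<in> sets (set_borel d)"
    have "A \<in> sets hit_algebra" using A sb(1) by blast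
    from measurable_sets[OF measurable_component_singleton[OF t, of "\<lambda>_. hit_algebra"] this]
    show "{F \<in> space (PiM {0..} (\<lambda>_. hit_algebra)). F t \<in> A} \<in> sets (PiM {0..} (\<lambda>_. hit_algebra))"
      by (simp add: vimage_def Int_def conj_commute)
  qed
qed

theorem proposition2p5:
  fixes P :: "'a::{metric_space, second_countable_topology} \<Rightarrow> 'w measure"
    and X :: "real \<Rightarrow> 'w \<Rightarrow> 'a"
    and N :: enat
    and x' x'' :: "nat \<Rightarrow> 'a"
    and M' :: "'u measure" and \<xi>' :: "nat \<Rightarrow> real \<Rightarrow> 'u \<Rightarrow> 'a"
    and M'' :: "'v measure" and \<xi>'' :: "nat \<Rightarrow> real \<Rightarrow> 'v \<Rightarrow> 'a"
    and d :: "'a option \<Rightarrow> 'a option \<Rightarrow> real"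
  assumes "locally compact (UNIV :: 'a set)"
    and "feller_markov_process P X"
    and "\<And>t0 y'. t0 > 0 \<Longrightarrow>
           ((\<lambda>y''. measure (completion (P y' \<Otimes>\<^sub>M P y''))
                {\<omega> \<in> space (P y' \<Otimes>\<^sub>M P y''). \<exists>t\<in>{0..t0}. X t (fst \<omega>) = X t (snd \<omega>)})
             \<longlongrightarrow> 1) (at y')"
    and "N \<ge> 1"
    and "closure (x' ` labels N) = closure (x'' ` labels N)"
    and "independent_copies P X (labels N) x' M' \<xi>'"
    and "independent_copies P X (labels N) x'' M'' \<xi>''"
    and "\<not> compact (UNIV :: 'a set) \<Longrightarrow>
           Metric_space UNIV d \<and> Metric_space.mtopology UNIV d = compactified"
  shows "sample_path (coalescing_set N \<xi>') \<in> completion M' \<rightarrow>\<^sub>M set_path_algebra d \<and>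
         sample_path (coalescing_set N \<xi>'') \<in> completion M'' \<rightarrow>\<^sub>M set_path_algebra d \<and>
         distr (completion M') (set_path_algebra d) (sample_path (coalescing_set N \<xi>')) =
         distr (completion M'') (set_path_algebra d) (sample_path (coalescing_set N \<xi>''))"
proof -
  obtain p where p: "feller_paths p (path_law P X)" using feller_process_paths(1)[OF assms(2)] by blast
  have c1: "copies p (path_law P X) P X N x' M' \<xi>'" and c2: "copies p (path_law P X) P X N x'' M'' \<xi>''"
    using p assms(2,4,6,7) by (auto simp: copies_def copies_axioms_def)
  interpret c1: copies p "path_law P X" P X N x' M' \<xi>' by fact
  interpret c2: copies p "path_law P X" P X N x'' M'' \<xi>'' by fact
  let ?H = "PiM {0..} (\<lambda>_. hit_algebra) :: (real \<Rightarrow> 'a set) measure"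
  let ?X' = "sample_path (coalescing_set N \<xi>')" and ?X'' = "sample_path (coalescing_set N \<xi>'')"
  note m1 = c1.set_process_measurable and m2 = c2.set_process_measurable
  have hits: "?X' -` set_cylinder L \<inter> space M' = c1.hits L" "?X'' -` set_cylinder L \<inter> space M'' = c2.hits L"
    if "timed_open L" for L
    using that measurable_space[OF m1] measurable_space[OF m2]
    by (auto simp: set_cylinder_def c1.hits_def c2.hits_def timed_open_def sample_path_def space_PiM
        c1.coalescing_set_state c2.coalescing_set_state)
  have law: "distr (completion M') ?H ?X' = distr (completion M'') ?H ?X''"
  proof (rule measure_eqI_set_cylinder)
    show "finite_measure (distr (completion M') ?H ?X')"
      using c1.CM.prob_space_distr[OF m1] by (simp add: prob_space_def)
    fix L :: "(real \<times> 'a set) list" assume L: "timed_open L"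
    have S: "set_cylinder L \<in> sets ?H" unfolding sets_PiM_hit_algebra using L by (intro sigma_sets.Basic) blast
    show "emeasure (distr (completion M') ?H ?X') (set_cylinder L) = emeasure (distr (completion M'') ?H ?X'') (set_cylinder L)"
      unfolding emeasure_distr[OF m1 S] emeasure_distr[OF m2 S] space_completion hits[OF L]
        c1.CM.emeasure_eq_measure c2.CM.emeasure_eq_measure
      using hits_eq[OF assms(1) c1 c2 assms(3,5) L] by simp
  qed simp_all
  note sub = sets_set_path_algebra_subset[of d, OF assms(8)]
  have m1': "?X' \<in> completion M' \<rightarrow>\<^sub>M set_path_algebra d" and m2': "?X'' \<in> completion M'' \<rightarrow>\<^sub>M set_path_algebra d"
    using m1 m2 sub unfolding measurable_def by auto
  moreover have "distr (completion M') (set_path_algebra d) ?X' = distr (completion M'') (set_path_algebra d) ?X''"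
  proof (rule measure_eqI)
    fix A assume "A \<in> sets (distr (completion M') (set_path_algebra d) ?X')"
    then have A: "A \<in> sets (set_path_algebra d)" by simp
    then have AH: "A \<in> sets ?H" using sub(1) by blast
    have "emeasure (distr (completion M') ?H ?X') A = emeasure (distr (completion M'') ?H ?X'') A"
      by (simp only: law)
    then show "emeasure (distr (completion M') (set_path_algebra d) ?X') A =
        emeasure (distr (completion M'') (set_path_algebra d) ?X'') A"
      unfolding emeasure_distr[OF m1' A] emeasure_distr[OF m2' A] emeasure_distr[OF m1 AH] emeasure_distr[OF m2 AH] .
  qed simp
  ultimately show ?thesis by blast
qed

end
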